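(* Let $\mathcal{G}$ be a finite triangulation of a closed orientable surface whose faces are properly $2$-coloured black and white and whose vertex set $V$ has a proper vertex $3$-colouring $V=R\cup C\cup S$ (every triangle has exactly one vertex in each of $R,C,S$), with $R=\{r_1,\dots,r_k\}$. Define $T=(t_{ij})$ by: for $i\ne j$, $t_{ij}$ is the number of edges $e$ with one end in $C$ and one in $S$ such that the white triangle containing $e$ has vertex $r_j$ and the black triangle containing $e$ has vertex $r_i$; $t_{ii}=-\sum_{j\ne i}t_{ij}$. Define $T'$ in the same way with black and white interchanged. Let $\mathcal{B}_W$ (resp. $\mathcal{B}_B$) be the abelian group generated by $x_1,\dots,x_k$ subject to $\sum_j t_{ij}x_j=0$ (resp. $\sum_j t'_{ij}x_j=0$) for $1\le i\le k$, and let $\mathcal{A}_W$ (resp. $\mathcal{A}_B$) be the abelian group generated by $V$ subject to $r+c+s=0$ for every white (resp. black) triangle with vertex set $\{r,c,s\}$. Then $\mathcal{B}_W\cong\mathcal{B}_B$, the torsion subgroup $\mathcal{C}_W$ of $\mathcal{B}_W$ is finite, and $\mathcal{A}_W\cong\mathbb{Z}\oplus\mathbb{Z}\oplus M$ and $\mathcal{A}_B\cong\mathbb{Z}\oplus\mathbb{Z}\oplus N$ where $M$ and $N$ are quotients of $\mathcal{C}_W$.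
   Context: A triangulation of a surface is a $2$-cell embedding of a finite graph (multiple edges allowed, no loops) in the surface in which every face is bounded by a $3$-cycle with three distinct vertices; "properly $2$-coloured" means no two faces of the same colour share an edge, so every edge lies in exactly one white and one black triangle. *)

theory Defs
  imports "HOL-Homology.Homology"
begin

definition closed_surface :: "'a topology \<Rightarrow> bool" where
  "closed_surface X \<longleftrightarrow>
     topspace X \<noteq> {} \<and> compact_space X \<and> connected_space X \<and> Hausdorff_space X \<and>
     (\<forall>x\<in>topspace X. \<exists>U. openin X U \<and> x \<in> U \<and>
        subtopology X U homeomorphic_space (euclidean :: (real^2) topology))"

text \<open>
  An orientation is a choice of generators \<open>\<mu> x\<close> of the local homology groups
  \<open>H\<^sub>2(X, X - {x})\<close> which is locally consistent: near every point, the generators are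
  the restrictions of a single class in \<open>H\<^sub>2(X, X - U)\<close>.
\<close>

definition surface_orientation :: "'a topology \<Rightarrow> ('a \<Rightarrow> 'a chain set) \<Rightarrow> bool" where
  "surface_orientation X \<mu> \<longleftrightarrow>
     (\<forall>x\<in>topspace X.
        \<mu> x \<in> carrier (relative_homology_group 2 X (topspace X - {x})) \<and>
        generate (relative_homology_group 2 X (topspace X - {x})) {\<mu> x} =
          carrier (relative_homology_group 2 X (topspace X - {x}))) \<and>
     (\<forall>x\<in>topspace X. \<exists>U. openin X U \<and> x \<in> U \<and>
        (\<exists>g\<in>carrier (relative_homology_group 2 X (topspace X - U)). \<forall>y\<in>U.
           hom_induced 2 X (topspace X - U) X (topspace X - {y}) id g = \<mu> y))"

definition closed_orientable_surface :: "'a topology \<Rightarrow> bool" where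
  "closed_orientable_surface X \<longleftrightarrow> closed_surface X \<and> (\<exists>\<mu>. surface_orientation X \<mu>)"

text \<open>
  A finite loopless multigraph embedded in \<open>X\<close> is given by its finite set \<open>V\<close> of
  points and its finite set \<open>E\<close> of edges, an edge being identified with the closed arc
  it occupies. The ends of \<open>e\<close> are the elements of \<open>e \<inter> V\<close>; they are distinct because
  the arc is injectively parametrised. Several edges may have the same ends.
\<close>

definition embedded_graph :: "'a topology \<Rightarrow> 'a set \<Rightarrow> 'a set set \<Rightarrow> bool" where
  "embedded_graph X V E \<longleftrightarrow>
     finite V \<and> V \<subseteq> topspace X \<and> finite E \<and>
     (\<forall>e\<in>E. \<exists>g. embedding_map (top_of_set {0..1::real}) X g \<and>
        e = g ` {0..1} \<and> e \<inter> V = {g 0, g 1}) \<and>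
     (\<forall>e\<in>E. \<forall>e'\<in>E. e \<noteq> e' \<longrightarrow> e \<inter> e' \<subseteq> V)"

definition faces :: "'a topology \<Rightarrow> 'a set \<Rightarrow> 'a set set \<Rightarrow> 'a set set" where
  "faces X V E = connected_components_of (subtopology X (topspace X - (V \<union> \<Union>E)))"

definition two_cell_embedding :: "'a topology \<Rightarrow> 'a set \<Rightarrow> 'a set set \<Rightarrow> bool" where
  "two_cell_embedding X V E \<longleftrightarrow>
     embedded_graph X V E \<and>
     (\<forall>F\<in>faces X V E. subtopology X F homeomorphic_space top_of_set (ball (0 :: real^2) 1))"

text \<open>
  A face is bounded by a cycle if its closure is a closed disc whose boundary circle is that
  cycle. (Requiring only that the frontier of the face be the cycle would not prevent the
  boundary walk from traversing the cycle more than once.)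
\<close>

definition bounded_by_triangle :: "'a topology \<Rightarrow> 'a set \<Rightarrow> 'a set set \<Rightarrow> 'a set \<Rightarrow> bool" where
  "bounded_by_triangle X V E F \<longleftrightarrow>
     (\<exists>h u v w e1 e2 e3.
        homeomorphic_map (top_of_set (cball (0 :: real^2) 1)) (subtopology X (X closure_of F)) h \<and>
        h ` ball 0 1 = F \<and> h ` sphere 0 1 = e1 \<union> e2 \<union> e3 \<and>
        e1 \<in> E \<and> e2 \<in> E \<and> e3 \<in> E \<and> u \<noteq> v \<and> v \<noteq> w \<and> u \<noteq> w \<and>
        e1 \<inter> V = {u, v} \<and> e2 \<inter> V = {v, w} \<and> e3 \<inter> V = {u, w})"

definition triangulation :: "'a topology \<Rightarrow> 'a set \<Rightarrow> 'a set set \<Rightarrow> bool" where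
  "triangulation X V E \<longleftrightarrow>
     two_cell_embedding X V E \<and> (\<forall>F\<in>faces X V E. bounded_by_triangle X V E F)"

definition face_edges :: "'a topology \<Rightarrow> 'a set set \<Rightarrow> 'a set \<Rightarrow> 'a set set" where
  "face_edges X E F = {e \<in> E. e \<subseteq> X closure_of F}"

definition face_vertices :: "'a topology \<Rightarrow> 'a set \<Rightarrow> 'a set \<Rightarrow> 'a set" where
  "face_vertices X V F = V \<inter> X closure_of F"

definition proper_face_2_colouring ::
  "'a topology \<Rightarrow> 'a set \<Rightarrow> 'a set set \<Rightarrow> 'a set set \<Rightarrow> 'a set set \<Rightarrow> bool" where
  "proper_face_2_colouring X V E W B \<longleftrightarrow>
     W \<union> B = faces X V E \<and> W \<inter> B = {} \<and>
     (\<forall>P\<in>{W, B}. \<forall>F\<in>P. \<forall>F'\<in>P. F \<noteq> F' \<longrightarrow> face_edges X E F \<inter> face_edges X E F' = {})"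

definition proper_vertex_3_colouring ::
  "'a set \<Rightarrow> 'a set set \<Rightarrow> 'a set \<Rightarrow> 'a set \<Rightarrow> 'a set \<Rightarrow> bool" where
  "proper_vertex_3_colouring V E R C S \<longleftrightarrow>
     V = R \<union> C \<union> S \<and> R \<inter> C = {} \<and> R \<inter> S = {} \<and> C \<inter> S = {} \<and>
     (\<forall>e\<in>E. \<forall>u v. e \<inter> V = {u, v} \<longrightarrow> (\<forall>Z\<in>{R, C, S}. \<not> (u \<in> Z \<and> v \<in> Z)))"

text \<open>
  In a properly 2-coloured triangulation every edge lies in exactly one face of each colour,
  so the existential quantifiers over \<open>P\<close> and \<open>Q\<close> below speak about the triangle of that
  colour on \<open>e\<close>.
\<close>

definition CS_edges ::
  "'a topology \<Rightarrow> 'a set \<Rightarrow> 'a set set \<Rightarrow> 'a set \<Rightarrow> 'a set \<Rightarrow>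
   'a set set \<Rightarrow> 'a set set \<Rightarrow> 'a \<Rightarrow> 'a \<Rightarrow> 'a set set" where
  "CS_edges X V E C S P Q p q =
     {e \<in> E. (\<exists>c\<in>C. \<exists>s\<in>S. e \<inter> V = {c, s}) \<and>
        (\<exists>F\<in>P. e \<in> face_edges X E F \<and> p \<in> face_vertices X V F) \<and>
        (\<exists>F\<in>Q. e \<in> face_edges X E F \<and> q \<in> face_vertices X V F)}"

text \<open>
  With \<open>P\<close> the white and \<open>Q\<close> the black triangles this is the matrix \<open>T\<close>; the matrix \<open>T'\<close> is
  obtained by interchanging \<open>P\<close> and \<open>Q\<close>.
\<close>

definition CS_matrix ::
  "'a topology \<Rightarrow> 'a set \<Rightarrow> 'a set set \<Rightarrow> 'a set \<Rightarrow> 'a set \<Rightarrow> nat \<Rightarrow> (nat \<Rightarrow> 'a) \<Rightarrow>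
   'a set set \<Rightarrow> 'a set set \<Rightarrow> nat \<Rightarrow> nat \<Rightarrow> int" where
  "CS_matrix X V E C S k r P Q i j =
     (if i \<noteq> j then int (card (CS_edges X V E C S P Q (r j) (r i)))
      else - (\<Sum>l\<in>{1..k} - {i}. int (card (CS_edges X V E C S P Q (r l) (r i)))))"

definition presented_abelian_group ::
  "'b set \<Rightarrow> ('b \<Rightarrow>\<^sub>0 int) set \<Rightarrow> ('b \<Rightarrow>\<^sub>0 int) set monoid" where
  "presented_abelian_group G rels =
     free_Abelian_group G Mod generate (free_Abelian_group G) rels"

definition torsion_subgroup :: "('b, 'm) monoid_scheme \<Rightarrow> ('b, 'm) monoid_scheme" where
  "torsion_subgroup G =
     G\<lparr>carrier := {x \<in> carrier G. \<exists>n::nat. n > 0 \<and> x [^]\<^bsub>G\<^esub> n = \<one>\<^bsub>G\<^esub>}\<rparr>"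

definition matrix_group :: "nat \<Rightarrow> (nat \<Rightarrow> nat \<Rightarrow> int) \<Rightarrow> (nat \<Rightarrow>\<^sub>0 int) set monoid" where
  "matrix_group k t =
     presented_abelian_group {1..k} {\<Sum>j\<in>{1..k}. frag_cmul (t i j) (frag_of j) |i. i \<in> {1..k}}"

definition triangle_group ::
  "'a topology \<Rightarrow> 'a set \<Rightarrow> 'a set \<Rightarrow> 'a set \<Rightarrow> 'a set \<Rightarrow> 'a set set \<Rightarrow> ('a \<Rightarrow>\<^sub>0 int) set monoid" where
  "triangle_group X V R C S P =
     presented_abelian_group V
       {frag_of r + frag_of c + frag_of s |r c s F.
          F \<in> P \<and> r \<in> R \<and> c \<in> C \<and> s \<in> S \<and> face_vertices X V F = {r, c, s}}"

end

theory Submission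
  imports Defs
begin

text \<open>
  The topology enters through invariance of domain: the graph has empty interior and a point inside
  an edge cannot lie on only one closed face, so every edge lies in exactly one face of each colour.
  As deleting the vertices does not disconnect the surface, the dual graph is connected.

  The triangles then form two families \<open>W\<close> and \<open>B\<close>, paired by three bijections (across the edges
  avoiding \<open>R\<close>, \<open>S\<close> and \<open>C\<close>, respectively). Counting triangles at a vertex of \<open>R\<close> shows that \<open>T\<close> has
  zero column sums as well, so that \<open>T'\<close> is the transpose of \<open>T\<close>; diagonalising \<open>T\<close> over the integers
  gives \<open>\<B>\<^sub>W \<cong> \<B>\<^sub>B\<close>. A vector in the kernel of \<open>T\<close> is a harmonic function on a connected balanced
  digraph, hence constant, so \<open>\<C>\<^sub>W\<close> is the kernel of the homomorphism \<open>\<B>\<^sub>W \<rightarrow> \<int>\<close>, \<open>x\<^sub>j \<mapsto> 1\<close>.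

  The \<open>i\<close>-th relation of \<open>\<B>\<^sub>W\<close> becomes, under \<open>x\<^sub>j \<mapsto> r\<^sub>j\<close>, a difference of sums of relations of \<open>\<A>\<^sub>W\<close>:
  the white triangles opposite to the black ones at \<open>r\<^sub>i\<close> minus the white ones at \<open>r\<^sub>i\<close>. The image of
  \<open>\<B>\<^sub>W \<rightarrow> \<A>\<^sub>W\<close> is the kernel of \<open>r \<mapsto> 0\<close>, \<open>c \<mapsto> 1\<close>, \<open>s \<mapsto> -1\<close>; splitting off this homomorphism and
  then \<open>r \<mapsto> 1\<close>, \<open>c \<mapsto> 0\<close>, \<open>s \<mapsto> -1\<close> leaves the image of \<open>\<C>\<^sub>W\<close>.
\<close>

section \<open>Subsets of surfaces\<close>

text \<open>There is no evident map between the cokernels of a matrix and of its transpose, so both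
  are compared with a common diagonal form. The same form shows that the torsion is finite and is
  the common kernel of all homomorphisms to \<int>; a homomorphism from \<open>\<B>\<^sub>W\<close>
  to \<int> is a vector in the kernel of \<open>T\<close>, which is how harmonic functions enter.
  The two homomorphisms split off from \<open>\<A>\<^sub>W\<close> come from vertex weights constant
  on each colour class: values a, b, c respect the relations when a + b + c = 0, which leaves a
  lattice of rank two. Connectedness of the dual graph acts twice: it makes harmonic functions
  constant, and it shows that modulo the image of \<open>\<B>\<^sub>W\<close> all vertices of
  \<open>C\<close> agree and those of \<open>S\<close> are their negatives. Exchanging the colours
  yields \<open>\<A>\<^sub>B\<close> with a quotient of the torsion of \<open>\<B>\<^sub>B\<close>;
  the isomorphism of \<open>\<B>\<^sub>W\<close> with \<open>\<B>\<^sub>B\<close> turns it into a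
  quotient of \<open>\<C>\<^sub>W\<close>.\<close>

definition locally_planar :: "'a topology \<Rightarrow> bool" where
  "locally_planar X \<longleftrightarrow>
     (\<forall>x\<in>topspace X. \<exists>U. openin X U \<and> x \<in> U \<and>
        subtopology X U homeomorphic_space (euclidean :: (real^2) topology))"

text \<open>Openness is local: near each point of \<open>G\<close> the map is read in a chart, where
  invariance of domain for the plane applies. It will show that points, arcs and one-sided
  neighbourhoods of an edge are not open in the surface.\<close>

lemma locally_planar_invariance_of_domain:
  fixes g :: "'a \<Rightarrow> real^2"
  assumes X: "locally_planar X" and G: "openin X G"
    and g: "continuous_map (subtopology X G) euclidean g" and inj: "inj_on g G"
  shows "open (g ` G)"
  unfolding open_subopen[of "g ` G"]
proof (intro ballI)
  fix y assume "y \<in> g ` G"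
  then obtain x where x: "x \<in> G" "y = g x" by auto
  then have "x \<in> topspace X" using G openin_subset by blast
  then obtain U where U: "openin X U" "x \<in> U"
      "subtopology X U homeomorphic_space (euclidean :: (real^2) topology)"
    using X unfolding locally_planar_def by blast
  then obtain f f' where f: "homeomorphic_maps (subtopology X U) (euclidean :: (real^2) topology) f f'"
    unfolding homeomorphic_space_def by blast
  have UX: "U \<subseteq> topspace X" using U openin_subset by blast
  have f': "continuous_map euclidean (subtopology X U) f'"
    using f homeomorphic_maps_def by blast
  define N where "N = f ` (U \<inter> G)"
  have fmap: "homeomorphic_map (subtopology X U) (euclidean :: (real^2) topology) f"
    using f homeomorphic_maps_map by blast
  have opUG: "openin (subtopology X U) (U \<inter> G)"
    using G by (simp add: openin_subtopology_Int2)
  have "openin euclidean (f ` (U \<inter> G))"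
    using homeomorphic_imp_open_map[OF fmap] opUG by (simp only: open_map_def)
  then have "open N" by (simp add: N_def)
  have f'N: "f' ` N = U \<inter> G"
  proof -
    have "f' (f z) = z" if "z \<in> U \<inter> G" for z
      using f UX that unfolding homeomorphic_maps_def by auto
    then show ?thesis unfolding N_def by (simp add: image_image)
  qed
  have "continuous_map (top_of_set N) (subtopology X G) f'"
    using f' f'N unfolding continuous_map_in_subtopology
    by (auto simp: continuous_map_from_subtopology)
  then have "continuous_map (top_of_set N) euclidean (g \<circ> f')"
    using g continuous_map_compose by blast
  then have cont: "continuous_on N (g \<circ> f')" by simp
  have "inj_on f' N"
    using f unfolding homeomorphic_maps_def by (intro inj_on_inverseI[of _ f]) auto
  then have "inj_on (g \<circ> f') N"
    using f'N inj by (metis comp_inj_on inf_le2 inj_on_subset)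
  then have "open ((g \<circ> f') ` N)"
    using cont \<open>open N\<close> invariance_of_domain by blast
  then have "open (g ` (U \<inter> G))"
    by (metis f'N image_comp)
  then show "\<exists>T. open T \<and> y \<in> T \<and> T \<subseteq> g ` G"
    using x U by blast
qed

lemma locally_planar_interior_singleton:
  assumes "locally_planar X" "openin X G" "G \<subseteq> {v}"
  shows "G = {}"
proof (rule ccontr)
  assume ne: "G \<noteq> {}"
  have "open ((\<lambda>_. 0 :: real^2) ` G)"
    using assms by (intro locally_planar_invariance_of_domain) (auto simp: inj_on_def)
  moreover have "(\<lambda>_. 0 :: real^2) ` G = {0}" using ne by auto
  ultimately show False using not_open_singleton by metis
qed

lemma axis_line_no_interior:
  assumes "open (S :: (real^2) set)" "S \<subseteq> range (\<lambda>t. t *\<^sub>R axis 1 1)"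
  shows "S = {}"
proof -
  have "x $ 2 = 0" if "x \<in> S" for x
    using that assms(2) by (auto simp: axis_def)
  then have "S \<subseteq> {x. axis 2 1 \<bullet> x = 0}"
    by (auto simp: inner_axis' )
  moreover have "interior {x :: real^2. axis 2 1 \<bullet> x = 0} = {}"
    by (rule interior_hyperplane) (simp add: axis_eq_0_iff)
  ultimately show ?thesis
    using assms(1) by (metis interior_mono interior_open subset_empty)
qed

text \<open>The inverse of the parametrisation, followed by the embedding of the line as an axis of
  the plane, carries \<open>G\<close> injectively onto an open set of the plane inside a
  line.\<close>

lemma locally_planar_interior_arc:
  assumes X: "locally_planar X" and g: "embedding_map (top_of_set {0..1::real}) X g"
    and G: "openin X G" "G \<subseteq> g ` {0..1}"
  shows "G = {}"
proof -
  let ?axis = "\<lambda>t::real. t *\<^sub>R (axis 1 1 :: real^2)"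
  have "homeomorphic_map (top_of_set {0..1}) (subtopology X (g ` {0..1})) g"
    using g by (simp add: embedding_map_def)
  then obtain g' where g': "homeomorphic_maps (top_of_set {0..1}) (subtopology X (g ` {0..1})) g g'"
    using homeomorphic_map_maps by blast
  have "continuous_map (subtopology X G) (top_of_set {0..1}) g'"
    using g' G(2) continuous_map_from_subtopology_mono unfolding homeomorphic_maps_def by blast
  then have c1: "continuous_map (subtopology X G) euclideanreal g'"
    by (simp add: continuous_map_in_subtopology)
  have "continuous_map (subtopology X G) euclidean (?axis \<circ> g')"
  proof (rule continuous_map_compose[OF c1])
    show "continuous_map euclidean euclidean ?axis"
      by (auto intro!: continuous_intros)
  qed
  moreover have "inj_on g' G"
    using g' G openin_subset[OF G(1)] unfolding homeomorphic_maps_def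
    by (intro inj_on_inverseI[of _ g]) auto
  then have "inj_on (?axis \<circ> g') G"
    by (auto simp: inj_on_def axis_eq_0_iff)
  ultimately have "open ((?axis \<circ> g') ` G)"
    using X G locally_planar_invariance_of_domain by blast
  then have "(?axis \<circ> g') ` G = {}"
    by (rule axis_line_no_interior) auto
  then show ?thesis by simp
qed

text \<open>Removing one closed member from \<open>G\<close> leaves an open set covered by the other
  members; it is empty by induction, so \<open>G\<close> lies in that member.\<close>

lemma closedin_Union_empty_interior:
  assumes "finite \<A>" "\<And>A. A \<in> \<A> \<Longrightarrow> closedin X A"
    and "\<And>A G. A \<in> \<A> \<Longrightarrow> openin X G \<Longrightarrow> G \<subseteq> A \<Longrightarrow> G = {}"
    and "openin X G" "G \<subseteq> \<Union>\<A>"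
  shows "G = {}"
  using assms
proof (induction \<A> arbitrary: G rule: finite_induct)
  case (insert A \<A>)
  have "openin X (G - A)" using insert.prems(1)[of A] insert.prems(3) by (simp add: openin_diff)
  have "G - A = {}"
  proof (rule insert.IH)
    show "openin X (G - A)" by fact
    show "G - A \<subseteq> \<Union> \<A>" using insert.prems(4) by blast
    show "closedin X A'" if "A' \<in> \<A>" for A' using insert.prems(1) that by simp
    show "G' = {}" if "A' \<in> \<A>" "openin X G'" "G' \<subseteq> A'" for A' G'
      by (rule insert.prems(2)[OF _ that(2,3)]) (simp add: that)
  qed
  then have "G \<subseteq> A" by blast
  then show ?case using insert.prems(2)[OF _ insert.prems(3)] by blast
qed auto

text \<open>A separation of the complement would extend across \<open>S\<close>: a chart minus a
  finite set is connected, so around every point, including those of \<open>S\<close>, only one side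
  occurs. The extended sides overlap only inside \<open>S\<close>, which contains no nonempty open
  set.\<close>

lemma planar_connected_diff_finite:
  assumes X: "locally_planar X" "Hausdorff_space X" and con: "connected_space X" and fin: "finite S"
  shows "connectedin X (topspace X - S)"
proof -
  have noint: "G = {}" if G: "openin X G" "G \<subseteq> S" for G
  proof (rule closedin_Union_empty_interior)
    show "finite ((\<lambda>x. {x}) ` (S \<inter> topspace X))" using fin by simp
    show "G \<subseteq> \<Union> ((\<lambda>x. {x}) ` (S \<inter> topspace X))"
      using G openin_subset by fastforce
    show "openin X G" by fact
  next
    fix A assume "A \<in> (\<lambda>x. {x}) ` (S \<inter> topspace X)"
    then obtain x where x: "A = {x}" "x \<in> topspace X" by blast
    then show "closedin X A" using closedin_Hausdorff_singleton[OF X(2)] by simp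
    show "G' = {}" if "openin X G'" "G' \<subseteq> A" for G'
      using locally_planar_interior_singleton[OF X(1) that(1)] that(2) x by blast
  qed
  show ?thesis
  proof (rule ccontr)
    assume "\<not> connectedin X (topspace X - S)"
    then have "\<exists>A B. openin X A \<and> openin X B \<and> topspace X - S \<subseteq> A \<union> B \<and>
       A \<inter> B \<inter> (topspace X - S) = {} \<and> A \<inter> (topspace X - S) \<noteq> {} \<and> B \<inter> (topspace X - S) \<noteq> {}"
      unfolding connectedin by (meson Diff_subset)
    then obtain A B where AB: "openin X A" "openin X B" "topspace X - S \<subseteq> A \<union> B"
       "A \<inter> B \<inter> (topspace X - S) = {}" "A \<inter> (topspace X - S) \<noteq> {}" "B \<inter> (topspace X - S) \<noteq> {}"
      by metis
    have one_side: "\<exists>U. openin X U \<and> x \<in> U \<and> (U - S \<subseteq> A \<or> U - S \<subseteq> B)" if x: "x \<in> topspace X" for x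
    proof -
      obtain U where U: "openin X U" "x \<in> U"
        "subtopology X U homeomorphic_space (euclidean :: (real^2) topology)"
        using X x unfolding locally_planar_def by blast
      then obtain f f' where f: "homeomorphic_maps (subtopology X U) (euclidean :: (real^2) topology) f f'"
        unfolding homeomorphic_space_def by blast
      have UX: "U \<subseteq> topspace X" using U openin_subset by blast
      have f': "continuous_map euclidean (subtopology X U) f'"
        using f homeomorphic_maps_def by blast
      have "connected (- f ` (S \<inter> U))"
        using fin by (intro path_connected_imp_connected path_connected_complement_countable)
          (auto simp: countable_finite)
      then have "connectedin (subtopology X U) (f' ` (- f ` (S \<inter> U)))"
        by (intro connectedin_continuous_map_image[OF f']) simp
      moreover have "f' ` (- f ` (S \<inter> U)) = U - S"
      proof
        show "f' ` (- f ` (S \<inter> U)) \<subseteq> U - S"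
        proof clarify
          fix z assume z: "z \<notin> f ` (S \<inter> U)"
          have "f' z \<in> U" "f (f' z) = z"
            using f f' unfolding homeomorphic_maps_def continuous_map_def by auto
          then show "f' z \<in> U - S" using z by (metis DiffI IntI imageI)
        qed
        show "U - S \<subseteq> f' ` (- f ` (S \<inter> U))"
        proof
          fix y assume y: "y \<in> U - S"
          have inv: "f' (f z) = z" if "z \<in> U" for z
            using f UX that unfolding homeomorphic_maps_def by auto
          have "f y \<notin> f ` (S \<inter> U)"
            using y inv by (metis DiffD1 DiffD2 IntE imageE)
          then show "y \<in> f' ` (- f ` (S \<inter> U))"
            using inv[of y] y by (metis ComplI DiffD1 image_eqI)
        qed
      qed
      ultimately have "connectedin X (U - S)"
        by (simp add: connectedin_subtopology)
      moreover have "U - S \<subseteq> A \<union> B" "A \<inter> B \<inter> (U - S) = {}"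
        using AB UX by blast+
      ultimately have "A \<inter> (U - S) = {} \<or> B \<inter> (U - S) = {}"
        unfolding connectedin using AB(1,2) by meson
      then have "U - S \<subseteq> A \<or> U - S \<subseteq> B"
        using \<open>U - S \<subseteq> A \<union> B\<close> by blast
      then show ?thesis using U by blast
    qed
    define A' where "A' = \<Union>{U. openin X U \<and> U - S \<subseteq> A}"
    define B' where "B' = \<Union>{U. openin X U \<and> U - S \<subseteq> B}"
    have op: "openin X A'" "openin X B'" unfolding A'_def B'_def by auto
    have cover: "topspace X \<subseteq> A' \<union> B'"
    proof
      fix x assume "x \<in> topspace X"
      from one_side[OF this] show "x \<in> A' \<union> B'" unfolding A'_def B'_def by auto
    qed
    have "A' - S \<subseteq> A" "B' - S \<subseteq> B" unfolding A'_def B'_def by auto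
    then have "A' \<inter> B' \<subseteq> S" using AB(4) openin_subset[OF op(1)] by blast
    then have "A' \<inter> B' = {}" using noint op by blast
    moreover have "A \<subseteq> A'" "B \<subseteq> B'" unfolding A'_def B'_def using AB(1,2) by auto
    then have "A' \<noteq> {}" "B' \<noteq> {}" using AB(5,6) by auto
    ultimately show False
      using con op cover unfolding connected_space_def by meson
  qed
qed

section \<open>Faces and edges of a triangulation\<close>

locale coloured_triangulation =
  fixes X :: "'a topology" and V :: "'a set" and E W B :: "'a set set"
  assumes surface: "closed_surface X"
    and triangulation: "triangulation X V E"
    and face_colouring: "proper_face_2_colouring X V E W B"
begin

lemma planar: "locally_planar X"
  using surface unfolding closed_surface_def locally_planar_def by blast

lemma Hausdorff: "Hausdorff_space X"
  using surface unfolding closed_surface_def by blast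

lemma graph: "embedded_graph X V E"
  using triangulation unfolding triangulation_def two_cell_embedding_def by blast

lemma finite_graph: "finite V" "finite E" "V \<subseteq> topspace X"
  using graph unfolding embedded_graph_def by auto

lemma faces_eq: "faces X V E = W \<union> B"
  using face_colouring unfolding proper_face_2_colouring_def by blast

lemma edge_arc:
  assumes "e \<in> E"
  obtains g where "embedding_map (top_of_set {0..1::real}) X g" "e = g ` {0..1}" "e \<inter> V = {g 0, g 1}"
proof -
  have "\<exists>g. embedding_map (top_of_set {0..1::real}) X g \<and> e = g ` {0..1} \<and> e \<inter> V = {g 0, g 1}"
    using assms graph by (simp add: embedded_graph_def)
  then show thesis using that by metis
qed

lemma edges_meet_in_vertices: "e \<in> E \<Longrightarrow> e' \<in> E \<Longrightarrow> e \<noteq> e' \<Longrightarrow> e \<inter> e' \<subseteq> V"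
  using graph unfolding embedded_graph_def by blast

lemma edge_closed: "e \<in> E \<Longrightarrow> closedin X e"
proof -
  assume "e \<in> E"
  then obtain g where g: "embedding_map (top_of_set {0..1::real}) X g" "e = g ` {0..1}"
    by (rule edge_arc)
  have "compactin (top_of_set {0..1::real}) {0..1}"
    by (simp add: compactin_subtopology)
  moreover have "continuous_map (top_of_set {0..1::real}) X g"
    using homeomorphic_imp_continuous_map[OF g(1)[unfolded embedding_map_def]]
    by (simp add: continuous_map_in_subtopology)
  ultimately have "compactin X e"
    unfolding g(2) by (rule image_compactin)
  then show ?thesis by (rule compactin_imp_closedin[OF Hausdorff])
qed

text \<open>Distinct edges meet only in \<open>V\<close>, so a point of an edge outside
  \<open>V\<close> identifies that edge. The midpoint of the parametrisation is one, since the arc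
  meets \<open>V\<close> only in its ends.\<close>

lemma edge_inner_point:
  assumes "e \<in> E"
  obtains p where "p \<in> e" "p \<notin> V"
proof -
  obtain g where g: "embedding_map (top_of_set {0..1::real}) X g" "e = g ` {0..1}" "e \<inter> V = {g 0, g 1}"
    using assms by (rule edge_arc)
  have "inj_on g {0..1}"
    using homeomorphic_imp_injective_map[OF g(1)[unfolded embedding_map_def]] by simp
  then have "g (1/2) \<noteq> g 0" "g (1/2) \<noteq> g 1"
    using inj_onD[of g "{0..1}" "1/2" 0] inj_onD[of g "{0..1}" "1/2" 1] by auto
  moreover have "g (1/2) \<in> e" using g by auto
  ultimately have "g (1/2) \<notin> V" using g(3) by blast
  with \<open>g (1/2) \<in> e\<close> show thesis by (rule that)
qed

lemma face_closure:
  assumes "F \<in> faces X V E"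
  obtains h :: "real^2 \<Rightarrow> 'a" and u v w e1 e2 e3
    where "homeomorphic_map (top_of_set (cball 0 1)) (subtopology X (X closure_of F)) h"
      "h ` ball 0 1 = F" "X closure_of F = F \<union> (e1 \<union> e2 \<union> e3)"
      "e1 \<in> E" "e2 \<in> E" "e3 \<in> E" "u \<noteq> v" "v \<noteq> w" "u \<noteq> w"
      "e1 \<inter> V = {u, v}" "e2 \<inter> V = {v, w}" "e3 \<inter> V = {u, w}"
proof -
  obtain h :: "real^2 \<Rightarrow> 'a" and u v w e1 e2 e3
    where h: "homeomorphic_map (top_of_set (cball 0 1)) (subtopology X (X closure_of F)) h"
      "h ` ball 0 1 = F" "h ` sphere 0 1 = e1 \<union> e2 \<union> e3"
      and e: "e1 \<in> E" "e2 \<in> E" "e3 \<in> E" "u \<noteq> v" "v \<noteq> w" "u \<noteq> w"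
      "e1 \<inter> V = {u, v}" "e2 \<inter> V = {v, w}" "e3 \<inter> V = {u, w}"
  proof -
    have "bounded_by_triangle X V E F" using assms triangulation by (simp add: triangulation_def)
    then show thesis
      unfolding bounded_by_triangle_def by (elim exE conjE) (rule that; assumption)
  qed
  have ball_sphere: "ball 0 1 \<union> sphere 0 1 = cball (0 :: real^2) 1" by auto
  have "h ` cball 0 1 = X closure_of F"
    using homeomorphic_imp_surjective_map[OF h(1)] closure_of_subset_topspace[of X F]
    by auto
  then have "X closure_of F = F \<union> (e1 \<union> e2 \<union> e3)"
    unfolding h(2,3)[symmetric] image_Un[symmetric] ball_sphere by simp
  then show thesis by (rule that[OF h(1,2) _ e])
qed

lemma faces_disjoint: "F \<in> faces X V E \<Longrightarrow> F' \<in> faces X V E \<Longrightarrow> F \<noteq> F' \<Longrightarrow> F \<inter> F' = {}"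
  unfolding faces_def
  using pairwise_disjoint_connected_components_of[of "subtopology X (topspace X - (V \<union> \<Union>E))"]
  by (simp add: pairwise_def disjnt_def)

lemma face_off_graph: "F \<in> faces X V E \<Longrightarrow> F \<inter> (V \<union> \<Union>E) = {}"
  unfolding faces_def using connected_components_of_subset by fastforce

lemma Union_faces: "\<Union>(faces X V E) = topspace X - (V \<union> \<Union>E)"
  unfolding faces_def Union_connected_components_of by auto

lemma same_colour_no_common_edge:
  assumes "P \<in> {W, B}" "F \<in> P" "F' \<in> P" "e \<in> face_edges X E F" "e \<in> face_edges X E F'"
  shows "F = F'"
proof (rule ccontr)
  assume "F \<noteq> F'"
  have "\<forall>P\<in>{W, B}. \<forall>F\<in>P. \<forall>F'\<in>P. F \<noteq> F' \<longrightarrow> face_edges X E F \<inter> face_edges X E F' = {}"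
    using face_colouring unfolding proper_face_2_colouring_def by (elim conjE)
  from bspec[OF this assms(1)] have "face_edges X E F \<inter> face_edges X E F' = {}"
    using assms(2,3) \<open>F \<noteq> F'\<close> by simp
  then show False using assms(4,5) by blast
qed

lemma face_edges_nonempty:
  assumes "F \<in> faces X V E"
  shows "face_edges X E F \<noteq> {}"
  by (rule face_closure[OF assms]) (auto simp: face_edges_def)

text \<open>Faces of one colour have disjoint nonempty edge sets, so they inject into the power set
  of the finite set \<open>E\<close>. Finiteness makes unions of closures of faces closed.\<close>

lemma finite_faces: "finite (faces X V E)"
proof -
  have "finite P" if P: "P \<in> {W, B}" for P
  proof (rule inj_on_finite[of "face_edges X E" P "Pow E"])
    show "inj_on (face_edges X E) P"
    proof (rule inj_onI, rule ccontr)
      fix F F' assume F: "F \<in> P" "F' \<in> P" "face_edges X E F = face_edges X E F'" "F \<noteq> F'"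
      have "F \<in> faces X V E" using F P faces_eq by blast
      then obtain e where "e \<in> face_edges X E F" using face_edges_nonempty by blast
      then show False using same_colour_no_common_edge[OF P F(1,2)] F(3,4) by simp
    qed
  qed (auto simp: face_edges_def finite_graph)
  then show ?thesis by (simp add: faces_eq)
qed

lemma graph_no_interior:
  assumes "openin X G" "G \<subseteq> V \<union> \<Union>E"
  shows "G = {}"
proof (rule closedin_Union_empty_interior)
  show "finite ((\<lambda>v. {v}) ` V \<union> E)" using finite_graph by simp
  show "openin X G" by fact
  show "G \<subseteq> \<Union> ((\<lambda>v. {v}) ` V \<union> E)" using assms(2) by auto
next
  fix A assume A: "A \<in> (\<lambda>v. {v}) ` V \<union> E"
  then show "closedin X A"
    using edge_closed closedin_Hausdorff_singleton[OF Hausdorff] finite_graph(3) by blast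
  fix G' assume G': "openin X G'" "G' \<subseteq> A"
  from A show "G' = {}"
  proof
    assume "A \<in> (\<lambda>v. {v}) ` V"
    then obtain v where "A = {v}" by blast
    then show ?thesis using locally_planar_interior_singleton[OF planar G'(1), of v] G'(2) by simp
  next
    assume "A \<in> E"
    then obtain g where "embedding_map (top_of_set {0..1::real}) X g" "A = g ` {0..1}"
      by (rule edge_arc)
    then show ?thesis using locally_planar_interior_arc[OF planar _ G'(1), of g] G'(2) by simp
  qed
qed

lemma closures_cover:
  assumes "x \<in> topspace X"
  shows "\<exists>F\<in>faces X V E. x \<in> X closure_of F"
proof -
  have "topspace X - (\<Union>F\<in>faces X V E. X closure_of F) = {}"
  proof (rule graph_no_interior)
    have "closedin X (\<Union>F\<in>faces X V E. X closure_of F)"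
      by (rule closedin_Union) (use finite_faces in \<open>auto simp only: finite_imageI closedin_closure_of\<close>)
    then show "openin X (topspace X - (\<Union>F\<in>faces X V E. X closure_of F))"
      by (rule openin_diff[OF openin_topspace])
    have "F \<subseteq> X closure_of F" if F: "F \<in> faces X V E" for F
    proof (rule closure_of_subset)
      have "F \<subseteq> \<Union>(faces X V E)" using F by (rule Union_upper)
      then show "F \<subseteq> topspace X" unfolding Union_faces by blast
    qed
    then have "\<Union>(faces X V E) \<subseteq> (\<Union>F\<in>faces X V E. X closure_of F)" by blast
    then show "topspace X - (\<Union>F\<in>faces X V E. X closure_of F) \<subseteq> V \<union> \<Union>E"
      unfolding Union_faces by blast
  qed
  then have "x \<in> (\<Union>F\<in>faces X V E. X closure_of F)"
    using assms unfolding Diff_eq_empty_iff by (rule subsetD)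
  then show ?thesis by simp
qed

text \<open>A point of the closure outside the face lies on one of the three boundary edges; off
  \<open>V\<close> no other edge passes through it.\<close>

lemma edge_in_closure:
  assumes F: "F \<in> faces X V E" and e: "e \<in> E" and p: "p \<in> e" "p \<notin> V" "p \<in> X closure_of F"
  shows "e \<in> face_edges X E F"
proof -
  obtain e1 e2 e3 where "X closure_of F = F \<union> (e1 \<union> e2 \<union> e3)" "e1 \<in> E" "e2 \<in> E" "e3 \<in> E"
    by (rule face_closure[OF F]) (rule that; assumption)
  moreover have "p \<notin> F" using face_off_graph[OF F] p e by blast
  ultimately show ?thesis
    using p e edges_meet_in_vertices[OF e] unfolding face_edges_def
    by (metis (no_types, lifting) CollectI IntI Un_iff subsetD subsetI)
qed

text \<open>If an inner point \<open>p\<close> of the edge lay in the closure of one face only, a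
  whole neighbourhood of \<open>p\<close> would lie in that closed disc. Read in the disc, the
  neighbourhood is open in the plane and hence misses the boundary circle, so \<open>p\<close> would
  lie in the open face.\<close>

lemma edge_two_faces:
  assumes e: "e \<in> E"
  obtains F F' where "F \<in> faces X V E" "F' \<in> faces X V E" "F \<noteq> F'"
    "e \<in> face_edges X E F" "e \<in> face_edges X E F'"
proof -
  obtain p where p: "p \<in> e" "p \<notin> V" using edge_inner_point[OF e] .
  have "p \<in> topspace X" using closedin_subset[OF edge_closed[OF e]] p by blast
  then obtain F where F: "F \<in> faces X V E" "p \<in> X closure_of F" using closures_cover[of p] by blast
  show thesis
  proof (cases "\<exists>F'\<in>faces X V E. F' \<noteq> F \<and> p \<in> X closure_of F'")
    case True
    then show thesis using that F edge_in_closure[OF _ e p] by metis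
  next
    case False
    \<comment> \<open>A neighbourhood of \<open>p\<close> that avoids the closures of all faces
      other than \<open>F\<close>; as the closures cover the surface, it lies in the closure of
      \<open>F\<close>.\<close>
    define G where "G = topspace X - (\<Union>F'\<in>faces X V E - {F}. X closure_of F')"
    have G: "openin X G" unfolding G_def
      using finite_faces by (intro openin_diff openin_topspace closedin_Union) auto
    have pG: "p \<in> G" using False \<open>p \<in> topspace X\<close> unfolding G_def by blast
    have GF: "G \<subseteq> X closure_of F" using closures_cover unfolding G_def by blast
    obtain h :: "real^2 \<Rightarrow> 'a"
      where h: "homeomorphic_map (top_of_set (cball 0 1)) (subtopology X (X closure_of F)) h"
        "h ` ball 0 1 = F"
      by (rule face_closure[OF F(1)]) (rule that; assumption)
    then obtain k where k: "homeomorphic_maps (top_of_set (cball 0 1)) (subtopology X (X closure_of F)) h k"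
      using homeomorphic_map_maps by blast
    have "continuous_map (subtopology X G) (top_of_set (cball 0 1)) k"
      using k GF continuous_map_from_subtopology_mono unfolding homeomorphic_maps_def by blast
    then have cont: "continuous_map (subtopology X G) euclidean k" and kG: "k ` G \<subseteq> cball 0 1"
      using openin_subset[OF G]
      by (auto simp: continuous_map_in_subtopology image_subset_iff_funcset Int_absorb1)
    have hk: "h (k x) = x" if "x \<in> G" for x
      using k that GF openin_subset[OF G] unfolding homeomorphic_maps_def by auto
    then have "inj_on k G" by (rule inj_on_inverseI)
    with cont have "open (k ` G)"
      using locally_planar_invariance_of_domain[OF planar G] by blast
    then have "k ` G \<subseteq> ball 0 1"
      using kG by (metis interior_cball interior_maximal)
    then have "p \<in> F" using hk[OF pG] pG h(2) by (metis image_eqI image_subset_iff)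
    then show thesis using face_off_graph[OF F(1)] p e by blast
  qed
qed

lemma edge_colours:
  assumes e: "e \<in> E" and P: "P \<in> {W, B}"
  shows "\<exists>!F. F \<in> P \<and> e \<in> face_edges X E F"
proof -
  obtain F F' where F: "F \<in> W \<union> B" "F' \<in> W \<union> B" "F \<noteq> F'"
    "e \<in> face_edges X E F" "e \<in> face_edges X E F'"
    using edge_two_faces[OF e] faces_eq by metis
  have "F \<in> W \<and> F' \<in> B \<or> F \<in> B \<and> F' \<in> W"
    using F same_colour_no_common_edge[of W F F' e] same_colour_no_common_edge[of B F F' e] by auto
  then show ?thesis using F(4,5) P same_colour_no_common_edge[OF P] by (intro ex_ex1I) auto
qed

text \<open>Connectedness is expressed by functions that are constant along adjacency. The closures
  of the faces with value \<open>f F0\<close> and those of the other faces form two closed sets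
  covering the surface. Off \<open>V\<close> they cannot meet, since a common point would lie in an
  open face or inside an edge, whose faces share a value; and the surface minus \<open>V\<close> is
  connected.\<close>

lemma dual_graph_connected:
  assumes f: "\<And>e F F'. e \<in> E \<Longrightarrow> F \<in> W \<Longrightarrow> F' \<in> B \<Longrightarrow> e \<in> face_edges X E F \<Longrightarrow>
      e \<in> face_edges X E F' \<Longrightarrow> f F = f F'"
    and F: "F0 \<in> W \<union> B" "F1 \<in> W \<union> B"
  shows "f F0 = f F1"
proof (rule ccontr)
  assume ne: "f F0 \<noteq> f F1"
  define Z1 where "Z1 = (\<Union>F\<in>{F \<in> faces X V E. f F = f F0}. X closure_of F)"
  define Z2 where "Z2 = (\<Union>F\<in>{F \<in> faces X V E. f F \<noteq> f F0}. X closure_of F)"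
  have cl: "closedin X Z1" "closedin X Z2"
    unfolding Z1_def Z2_def using finite_faces by (auto intro!: closedin_Union)
  have cover: "topspace X - V \<subseteq> Z1 \<union> Z2"
    using closures_cover unfolding Z1_def Z2_def by blast
  have share: "f F = f F'" if FF: "F \<in> faces X V E" "F' \<in> faces X V E"
    "e \<in> face_edges X E F" "e \<in> face_edges X E F'" for e F F'
  proof -
    have e: "e \<in> E" using FF unfolding face_edges_def by blast
    obtain G G' where G: "G \<in> W" "e \<in> face_edges X E G" "G' \<in> B" "e \<in> face_edges X E G'"
      using edge_colours[OF e, of W] edge_colours[OF e, of B] by auto
    have "f H = f G" if H: "H \<in> faces X V E" "e \<in> face_edges X E H" for H
    proof (cases "H \<in> W")
      case True
      then have "H = G" using edge_colours[OF e, of W] G H by auto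
      then show ?thesis by simp
    next
      case False
      then have "H \<in> B" using H faces_eq by blast
      then show ?thesis using f[OF e G(1) _ G(2) H(2)] by simp
    qed
    then show ?thesis using FF by metis
  qed
  have disj: "Z1 \<inter> Z2 \<inter> (topspace X - V) = {}"
  proof (rule ccontr)
    assume "Z1 \<inter> Z2 \<inter> (topspace X - V) \<noteq> {}"
    then obtain p G G' where p: "p \<in> topspace X" "p \<notin> V"
      and G: "G \<in> faces X V E" "p \<in> X closure_of G" "f G = f F0"
      and G': "G' \<in> faces X V E" "p \<in> X closure_of G'" "f G' \<noteq> f F0"
      unfolding Z1_def Z2_def by blast
    have cases: "p \<in> H \<or> (p \<in> \<Union>E)" if "H \<in> faces X V E" "p \<in> X closure_of H" for H
      by (rule face_closure[OF that(1)]) (use that(2) in blast)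
    show False
    proof (cases "p \<in> \<Union>E")
      case True
      then obtain e where "e \<in> E" "p \<in> e" by blast
      then show False
        using share[OF G(1) G'(1)] edge_in_closure[OF _ _ _ p(2)] G G' by metis
    next
      case False
      then have "p \<in> G \<inter> G'" using cases G G' by blast
      then show False using faces_disjoint[OF G(1) G'(1)] G G' by auto
    qed
  qed
  have meets: "X closure_of F \<inter> (topspace X - V) \<noteq> {}" if "F \<in> W \<union> B" for F
  proof -
    have "face_edges X E F \<noteq> {}" using face_edges_nonempty[of F] that by (simp add: faces_eq)
    then obtain e where e: "e \<in> E" "e \<subseteq> X closure_of F" by (auto simp: face_edges_def)
    obtain p where "p \<in> e" "p \<notin> V" using edge_inner_point[OF e(1)] .
    then show ?thesis using e closure_of_subset_topspace[of X F] by blast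
  qed
  have "X closure_of F0 \<subseteq> Z1" "X closure_of F1 \<subseteq> Z2"
    unfolding Z1_def Z2_def faces_eq using F ne by (auto simp del: Un_iff)
  then have "Z1 \<inter> (topspace X - V) \<noteq> {}" "Z2 \<inter> (topspace X - V) \<noteq> {}"
    using meets[OF F(1)] meets[OF F(2)] by auto
  moreover have "connectedin X (topspace X - V)"
    using planar_connected_diff_finite[OF planar Hausdorff _ finite_graph(1)] surface
    by (simp add: closed_surface_def)
  ultimately show False
    using cl cover disj unfolding connectedin_closedin by meson
qed

lemma faces_nonempty: "faces X V E \<noteq> {}"
  using closures_cover surface unfolding closed_surface_def by blast

lemma vertex_in_face:
  assumes "v \<in> V"
  shows "\<exists>F\<in>faces X V E. v \<in> face_vertices X V F"
  using assms closures_cover finite_graph unfolding face_vertices_def by blast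

lemma face_triangle:
  assumes "F \<in> faces X V E"
  obtains u v w e1 e2 e3 where "face_vertices X V F = {u, v, w}" "face_edges X E F = {e1, e2, e3}"
      "u \<noteq> v" "v \<noteq> w" "u \<noteq> w" "e1 \<inter> V = {u, v}" "e2 \<inter> V = {v, w}" "e3 \<inter> V = {u, w}"
proof -
  obtain u v w e1 e2 e3 where cl: "X closure_of F = F \<union> (e1 \<union> e2 \<union> e3)"
      and e: "e1 \<in> E" "e2 \<in> E" "e3 \<in> E" and ne: "u \<noteq> v" "v \<noteq> w" "u \<noteq> w"
      and ends: "e1 \<inter> V = {u, v}" "e2 \<inter> V = {v, w}" "e3 \<inter> V = {u, w}"
    by (rule face_closure[OF assms]) (rule that; assumption)
  have "V \<inter> X closure_of F = (F \<inter> V) \<union> (e1 \<inter> V) \<union> (e2 \<inter> V) \<union> (e3 \<inter> V)"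
    unfolding cl by blast
  moreover have "F \<inter> V = {}" using face_off_graph[OF assms] by blast
  ultimately have "face_vertices X V F = {u, v, w}"
    unfolding face_vertices_def ends by auto
  moreover have "face_edges X E F = {e1, e2, e3}"
  proof
    show "face_edges X E F \<subseteq> {e1, e2, e3}"
    proof
      fix e' assume e': "e' \<in> face_edges X E F"
      then have "e' \<in> E" "e' \<subseteq> X closure_of F" unfolding face_edges_def by auto
      obtain p where p: "p \<in> e'" "p \<notin> V" using edge_inner_point[OF \<open>e' \<in> E\<close>] .
      have "p \<notin> F" using face_off_graph[OF assms] \<open>e' \<in> E\<close> p(1) by blast
      then have "p \<in> e1 \<union> e2 \<union> e3"
        using p(1) \<open>e' \<subseteq> X closure_of F\<close> unfolding cl by blast
      then show "e' \<in> {e1, e2, e3}"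
        using p e edges_meet_in_vertices[OF \<open>e' \<in> E\<close>] by (metis IntI UnE insertI1 insertI2 subsetD)
    qed
    show "{e1, e2, e3} \<subseteq> face_edges X E F" unfolding face_edges_def cl using e by blast
  qed
  ultimately show thesis using ne ends by (rule that)
qed

end

section \<open>Diagonalisation of integer matrices\<close>

text \<open>The only operations are additions of a multiple of one row or column to another, so each
  step is undone by the opposite multiple. Matrices are total functions, of which only rows and
  columns indexed by \<open>I\<close> are altered.\<close>

inductive add_equiv :: "'i set \<Rightarrow> ('i \<Rightarrow> 'i \<Rightarrow> int) \<Rightarrow> ('i \<Rightarrow> 'i \<Rightarrow> int) \<Rightarrow> bool"
  for I A where
  base: "add_equiv I A A"
| add_row: "add_equiv I A B \<Longrightarrow> i \<in> I \<Longrightarrow> j \<in> I \<Longrightarrow> i \<noteq> j \<Longrightarrow>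
    add_equiv I A (\<lambda>x y. if x = i then B i y + q * B j y else B x y)"
| add_col: "add_equiv I A B \<Longrightarrow> i \<in> I \<Longrightarrow> j \<in> I \<Longrightarrow> i \<noteq> j \<Longrightarrow>
    add_equiv I A (\<lambda>x y. if y = i then B x i + q * B x j else B x y)"

lemma add_equiv_trans:
  assumes "add_equiv I B C" "add_equiv I A B"
  shows "add_equiv I A C"
  using assms by (induction rule: add_equiv.induct) (auto intro: add_equiv.intros)

lemma add_equiv_mono:
  assumes "add_equiv J A B" "J \<subseteq> I"
  shows "add_equiv I A B"
  using assms(1)
proof (induction rule: add_equiv.induct)
  case (add_row B i j q)
  then show ?case using assms(2) by (intro add_equiv.add_row) auto
next
  case (add_col B i j q)
  then show ?case using assms(2) by (intro add_equiv.add_col) auto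
qed (rule add_equiv.base)

lemma add_equiv_transpose:
  assumes "add_equiv I A B"
  shows "add_equiv I (\<lambda>x y. A y x) (\<lambda>x y. B y x)"
  using assms
proof (induction rule: add_equiv.induct)
  case (add_row B i j q)
  then show ?case using add_equiv.add_col[OF add_row.IH add_row.hyps(2-4), of q] by simp
next
  case (add_col B i j q)
  then show ?case using add_equiv.add_row[OF add_col.IH add_col.hyps(2-4), of q] by simp
qed (rule add_equiv.base)

text \<open>Diagonalisation recurses on \<open>J\<close> after row and column \<open>a\<close> have
  been cleared; this keeps them cleared.\<close>

lemma add_equiv_isolated:
  assumes "add_equiv J A B" "a \<notin> J" "\<And>x. x \<in> J \<Longrightarrow> A x a = 0 \<and> A a x = 0"
  shows "\<forall>x\<in>J. B x a = 0 \<and> B a x = 0"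
  using assms(1)
proof (induction rule: add_equiv.induct)
  case base
  then show ?case using assms by blast
qed (use assms(2) in auto)

text \<open>Otherwise subtracting a multiple of row \<open>i\<close> from row \<open>x\<close> leaves a smaller nonzero remainder.\<close>

lemma minimal_entry_dvd_column:
  assumes eq: "add_equiv I A B" and I: "i \<in> I" "j \<in> I" "x \<in> I" and nz: "B i j \<noteq> 0"
    and min: "\<And>B' i' j'. add_equiv I A B' \<Longrightarrow> i' \<in> I \<Longrightarrow> j' \<in> I \<Longrightarrow> B' i' j' \<noteq> 0 \<Longrightarrow>
       \<bar>B i j\<bar> \<le> \<bar>B' i' j'\<bar>"
  shows "B i j dvd B x j"
proof (cases "x = i")
  case False
  let ?q = "- (B x j div B i j)"
  have "B x j + ?q * B i j = B x j mod B i j"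
    by (simp add: minus_div_mult_eq_mod)
  moreover have "B x j + ?q * B i j = 0"
  proof (rule ccontr)
    assume "B x j + ?q * B i j \<noteq> 0"
    with min[OF add_equiv.add_row[OF eq I(3,1) False, of ?q] I(3,2)]
    have "\<bar>B i j\<bar> \<le> \<bar>B x j + ?q * B i j\<bar>" by simp
    then show False
      using nz \<open>B x j + ?q * B i j = _\<close> abs_mod_less[of "B i j" "B x j"] by simp
  qed
  ultimately show ?thesis by (simp add: dvd_eq_mod_eq_0)
qed simp

text \<open>An entry of least nonzero absolute value among all equivalent matrices divides every
  entry of its row and column. It is brought to position \<open>(a, a)\<close> by additions, its row
  and column are cleared, and the recursion continues on \<open>J\<close>.\<close>

lemma add_equiv_diagonal:
  assumes "finite I"
  shows "\<exists>D. add_equiv I A D \<and> (\<forall>i\<in>I. \<forall>j\<in>I. i \<noteq> j \<longrightarrow> D i j = 0)"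
  using assms
proof (induction I arbitrary: A rule: finite_induct)
  case empty
  then show ?case using add_equiv.base by blast
next
  case (insert a J)
  let ?I = "insert a J"
  show ?case
  proof (cases "\<forall>i\<in>?I. \<forall>j\<in>?I. A i j = 0")
    case True
    then show ?thesis using add_equiv.base by blast
  next
    case False
    \<comment> \<open>The minimum is taken over all equivalent matrices and all positions, so it
      remains minimal after each further operation.\<close>
    define M where "M = {nat \<bar>B i j\<bar> | B i j. add_equiv ?I A B \<and> i \<in> ?I \<and> j \<in> ?I \<and> B i j \<noteq> 0}"
    have "M \<noteq> {}" using False add_equiv.base[of ?I A] unfolding M_def by blast
    define m where "m = (LEAST n. n \<in> M)"
    have "m \<in> M" unfolding m_def using \<open>M \<noteq> {}\<close> by (meson LeastI_ex ex_in_conv)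
    then obtain B0 i0 j0 where B0: "add_equiv ?I A B0" "i0 \<in> ?I" "j0 \<in> ?I" "\<bar>B0 i0 j0\<bar> = int m" "m > 0"
      unfolding M_def by force
    have min: "int m \<le> \<bar>B' i' j'\<bar>" if "add_equiv ?I A B'" "i' \<in> ?I" "j' \<in> ?I" "B' i' j' \<noteq> 0" for B' i' j'
    proof -
      have "nat \<bar>B' i' j'\<bar> \<in> M" unfolding M_def using that by blast
      then show ?thesis unfolding m_def using Least_le[of "\<lambda>n. n \<in> M"] by fastforce
    qed
    have dvd_col: "B i j dvd B x j"
      if "add_equiv ?I A B" "i \<in> ?I" "j \<in> ?I" "x \<in> ?I" "\<bar>B i j\<bar> = int m" for B i j x
    proof (rule minimal_entry_dvd_column[OF that(1-4)])
      show "B i j \<noteq> 0" using that(5) B0(5) by auto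
      show "\<bar>B i j\<bar> \<le> \<bar>B' i' j'\<bar>"
        if "add_equiv ?I A B'" "i' \<in> ?I" "j' \<in> ?I" "B' i' j' \<noteq> 0" for B' i' j'
        using min[OF that] \<open>\<bar>B i j\<bar> = int m\<close> by simp
    qed
    have dvd_row: "B i j dvd B i y"
      if "add_equiv ?I A B" "i \<in> ?I" "j \<in> ?I" "y \<in> ?I" "\<bar>B i j\<bar> = int m" for B i j y
    proof (rule minimal_entry_dvd_column[OF add_equiv_transpose[OF that(1)], OF that(3,2,4)])
      show "B i j \<noteq> 0" using that(5) B0(5) by auto
      show "\<bar>B i j\<bar> \<le> \<bar>B' i' j'\<bar>"
        if "add_equiv ?I (\<lambda>x y. A y x) B'" "i' \<in> ?I" "j' \<in> ?I" "B' i' j' \<noteq> 0" for B' i' j'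
        using min[OF add_equiv_transpose[OF that(1)] that(3,2,4)] \<open>\<bar>B i j\<bar> = int m\<close> by simp
    qed
    obtain B1 where B1: "add_equiv ?I A B1" "\<bar>B1 a j0\<bar> = int m"
    proof (cases "i0 = a")
      case True
      then show thesis using that B0 by blast
    next
      case False
      \<comment> \<open>As \<open>B0 a j0\<close> is \<open>c\<close> times \<open>B0 i0 j0\<close>,
        adding \<open>1 - c\<close> times row \<open>i0\<close> to row \<open>a\<close> makes the
        two entries equal; this does the work of a swap.\<close>
      obtain c where c: "B0 a j0 = B0 i0 j0 * c"
        using dvd_col[OF B0(1-3) _ B0(4), of a] by auto
      show thesis
        using that[OF add_equiv.add_row[OF B0(1) _ B0(2) False[symmetric], of "1 - c"]] B0(4)
        by (simp add: c algebra_simps)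
    qed
    obtain B2 where B2: "add_equiv ?I A B2" "\<bar>B2 a a\<bar> = int m"
    proof (cases "j0 = a")
      case True
      then show thesis using that B1 by blast
    next
      case False
      obtain c where c: "B1 a a = B1 a j0 * c"
        using dvd_row[OF B1(1) _ B0(3) _ B1(2), of a] by auto
      show thesis
        using that[OF add_equiv.add_col[OF B1(1) _ B0(3) False[symmetric], of "1 - c"]] B1(2)
        by (simp add: c algebra_simps)
    qed
    have "\<exists>B. add_equiv ?I A B \<and> \<bar>B a a\<bar> = int m \<and> (\<forall>x\<in>K. B x a = 0)" if "K \<subseteq> J" for K
      using finite_subset[OF that \<open>finite J\<close>] that
    proof (induction K rule: finite_induct)
      case empty
      then show ?case using B2 by blast
    next
      case (insert x K)
      then obtain B where B: "add_equiv ?I A B" "\<bar>B a a\<bar> = int m" "\<forall>x\<in>K. B x a = 0" by auto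
      have x: "x \<in> ?I" "x \<noteq> a" using insert.prems \<open>a \<notin> J\<close> by auto
      obtain c where "B x a = B a a * c"
        using dvd_col[OF B(1) _ _ x(1) B(2)] by auto
      then show ?case
        using add_equiv.add_row[OF B(1) x(1) _ x(2), of "- c"] B(2,3) x(2)
        by (intro exI[of _ "\<lambda>x' y. if x' = x then B x y + - c * B a y else B x' y"]) auto
    qed
    then obtain B3 where B3: "add_equiv ?I A B3" "\<bar>B3 a a\<bar> = int m" "\<forall>x\<in>J. B3 x a = 0" by blast
    \<comment> \<open>Subtracting multiples of column \<open>a\<close> alters only columns other
      than \<open>a\<close>, so column \<open>a\<close> stays cleared.\<close>
    have "\<exists>B. add_equiv ?I A B \<and> \<bar>B a a\<bar> = int m \<and> (\<forall>x\<in>J. B x a = 0) \<and> (\<forall>y\<in>K. B a y = 0)"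
      if "K \<subseteq> J" for K
      using finite_subset[OF that \<open>finite J\<close>] that
    proof (induction K rule: finite_induct)
      case empty
      then show ?case using B3 by blast
    next
      case (insert y K)
      then obtain B where B: "add_equiv ?I A B" "\<bar>B a a\<bar> = int m" "\<forall>x\<in>J. B x a = 0" "\<forall>y\<in>K. B a y = 0"
        by auto
      have y: "y \<in> ?I" "y \<noteq> a" using insert.prems \<open>a \<notin> J\<close> by auto
      obtain c where "B a y = B a a * c"
        using dvd_row[OF B(1) _ _ y(1) B(2)] by auto
      then show ?case
        using add_equiv.add_col[OF B(1) y(1) _ y(2), of "- c"] B(2,3,4) y(2) \<open>a \<notin> J\<close>
        by (intro exI[of _ "\<lambda>x y'. if y' = y then B x y + - c * B x a else B x y'"]) auto
    qed
    then obtain B4 where B4: "add_equiv ?I A B4" "\<forall>x\<in>J. B4 x a = 0" "\<forall>y\<in>J. B4 a y = 0" by blast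
    obtain D where D: "add_equiv J B4 D" "\<forall>i\<in>J. \<forall>j\<in>J. i \<noteq> j \<longrightarrow> D i j = 0"
      using insert.IH[of B4] by blast
    have "add_equiv ?I A D"
      by (rule add_equiv_trans[OF add_equiv_mono[OF D(1)] B4(1)]) auto
    moreover have "\<forall>x\<in>J. D x a = 0 \<and> D a x = 0"
      using add_equiv_isolated[OF D(1) \<open>a \<notin> J\<close>] B4 by blast
    ultimately show ?thesis using D(2) by auto
  qed
qed

section \<open>Presented abelian groups\<close>

locale presentation =
  fixes G :: "'b set" and Rels :: "('b \<Rightarrow>\<^sub>0 int) set"
  assumes rels: "\<And>x. x \<in> Rels \<Longrightarrow> Poly_Mapping.keys x \<subseteq> G"
begin

abbreviation "\<F> \<equiv> free_Abelian_group G"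
abbreviation "\<P> \<equiv> presented_abelian_group G Rels"
abbreviation "\<N> \<equiv> generate \<F> Rels"

definition cls :: "('b \<Rightarrow>\<^sub>0 int) \<Rightarrow> ('b \<Rightarrow>\<^sub>0 int) set" where
  "cls x = \<N> #>\<^bsub>\<F>\<^esub> x"

lemma subgroup_relations: "subgroup \<N> \<F>"
  by (intro group.generate_is_subgroup) (auto simp: rels)

lemma normal_relations: "\<N> \<lhd> \<F>"
  using abelian_free_Abelian_group comm_group.normal_iff_subgroup subgroup_relations by blast

lemma comm_group_presented: "comm_group \<P>"
  unfolding presented_abelian_group_def
  using abelian_free_Abelian_group comm_group.abelian_FactGroup subgroup_relations by blast

lemma group_presented: "group \<P>"
  using comm_group_presented comm_group.axioms(2) by blast

lemma carrier_presented: "carrier \<P> = cls ` {x. Poly_Mapping.keys x \<subseteq> G}"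
  unfolding presented_abelian_group_def carrier_FactGroup cls_def
  by (auto simp: free_Abelian_group_def)

lemma cls_in_carrier: "Poly_Mapping.keys x \<subseteq> G \<Longrightarrow> cls x \<in> carrier \<P>"
  by (simp add: carrier_presented)

lemma cls_hom: "cls \<in> hom \<F> \<P>"
  unfolding presented_abelian_group_def cls_def[abs_def]
  using normal.r_coset_hom_Mod[OF normal_relations] .

lemma cls_add:
  "Poly_Mapping.keys x \<subseteq> G \<Longrightarrow> Poly_Mapping.keys y \<subseteq> G \<Longrightarrow> cls (x + y) = cls x \<otimes>\<^bsub>\<P>\<^esub> cls y"
  using hom_mult[OF cls_hom, of x y] by simp

lemma cls_minus: "Poly_Mapping.keys x \<subseteq> G \<Longrightarrow> cls (- x) = inv\<^bsub>\<P>\<^esub> cls x"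
  using group_hom.hom_inv[of \<F> \<P> cls x] cls_hom group_presented
  by (simp add: group_hom_def group_hom_axioms_def)

lemma cls_diff:
  "Poly_Mapping.keys x \<subseteq> G \<Longrightarrow> Poly_Mapping.keys y \<subseteq> G \<Longrightarrow>
    cls (x - y) = cls x \<otimes>\<^bsub>\<P>\<^esub> inv\<^bsub>\<P>\<^esub> cls y"
  using cls_add[of x "- y"] cls_minus[of y] by simp

lemma cls_pow: "Poly_Mapping.keys x \<subseteq> G \<Longrightarrow> cls x [^]\<^bsub>\<P>\<^esub> (n :: nat) = cls (frag_cmul (int n) x)"
  using group_hom.hom_nat_pow[of \<F> \<P> cls x n] cls_hom group_presented
  by (simp add: group_hom_def group_hom_axioms_def)

lemma cls_eq_one_iff:
  assumes "Poly_Mapping.keys x \<subseteq> G"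
  shows "cls x = \<one>\<^bsub>\<P>\<^esub> \<longleftrightarrow> x \<in> \<N>"
proof -
  have "cls x = \<N> \<longleftrightarrow> x \<in> \<N>"
    unfolding cls_def
    using assms group.coset_join1[OF group_free_Abelian_group _ _ subgroup_relations, of x]
      group.coset_join2[OF group_free_Abelian_group _ subgroup_relations, of x]
      subgroup.subset[OF subgroup_relations] by auto
  then show ?thesis unfolding presented_abelian_group_def by simp
qed

lemma cls_eq_iff:
  assumes "Poly_Mapping.keys x \<subseteq> G" "Poly_Mapping.keys y \<subseteq> G"
  shows "cls x = cls y \<longleftrightarrow> x - y \<in> \<N>"
proof -
  interpret P: group \<P> by (rule group_presented)
  have "Poly_Mapping.keys (x - y) \<subseteq> G" using assms keys_diff[of x y] by (meson Un_least order_trans)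
  then have "x - y \<in> \<N> \<longleftrightarrow> cls x \<otimes>\<^bsub>\<P>\<^esub> inv\<^bsub>\<P>\<^esub> cls y = \<one>\<^bsub>\<P>\<^esub>"
    using cls_eq_one_iff[of "x - y"] cls_diff[OF assms] by simp
  also have "\<dots> \<longleftrightarrow> cls x = cls y"
    using P.inv_solve_right'[of "\<one>\<^bsub>\<P>\<^esub>" "cls x" "cls y"] assms by (auto simp: cls_in_carrier)
  finally show ?thesis by simp
qed

lemma cls_relation: "x \<in> Rels \<Longrightarrow> cls x = \<one>\<^bsub>\<P>\<^esub>"
  using cls_eq_one_iff[OF rels] by (simp add: generate.incl)

lemma presented_universal:
  assumes "group H" "h \<in> hom \<F> H" "\<And>x. x \<in> Rels \<Longrightarrow> h x = \<one>\<^bsub>H\<^esub>"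
  obtains g where "g \<in> hom \<P> H" "\<And>x. Poly_Mapping.keys x \<subseteq> G \<Longrightarrow> g (cls x) = h x"
proof -
  interpret h: group_hom \<F> H h
    using assms(1,2) by (simp add: group_hom_def group_hom_axioms_def)
  have "Rels \<subseteq> kernel \<F> H h" using assms(3) rels by (auto simp: kernel_def)
  then have "\<N> \<subseteq> kernel \<F> H h"
    using h.subgroup_kernel group.generate_subgroup_incl group_free_Abelian_group by blast
  then obtain g where "g \<in> hom (\<F> Mod \<N>) H" "\<And>x. x \<in> carrier \<F> \<Longrightarrow> g (\<N> #>\<^bsub>\<F>\<^esub> x) = h x"
    using h.FactGroup_universal_kernel[OF normal_relations] by blast
  then show thesis using that by (simp add: presented_abelian_group_def cls_def)
qed

lemma presented_generation:
  assumes K: "subgroup K \<P>" and gens: "\<And>a. a \<in> G \<Longrightarrow> cls (frag_of a) \<in> K"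
  shows "carrier \<P> \<subseteq> K"
proof
  fix y assume "y \<in> carrier \<P>"
  then obtain x where x: "Poly_Mapping.keys x \<subseteq> G" "y = cls x" by (auto simp: carrier_presented)
  have "cls x \<in> K"
  proof (rule free_Abelian_group_induct[OF x(1), where P = "\<lambda>x. cls x \<in> K"])
    show "cls 0 \<in> K"
      using cls_eq_one_iff[of 0] subgroup.one_closed[OF K] subgroup.one_closed[OF subgroup_relations]
      by simp
    show "cls (u - v) \<in> K"
      if "Poly_Mapping.keys u \<subseteq> G" "Poly_Mapping.keys v \<subseteq> G" "cls u \<in> K" "cls v \<in> K" for u v
      using that by (simp add: cls_diff subgroup.m_closed[OF K] subgroup.m_inv_closed[OF K])
  qed (rule gens)
  then show "y \<in> K" using x by simp
qed

lemma presented_hom_eq: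
  assumes H: "group H" and g: "g \<in> hom \<P> H" "g' \<in> hom \<P> H"
    and gens: "\<And>a. a \<in> G \<Longrightarrow> g (cls (frag_of a)) = g' (cls (frag_of a))"
    and x: "x \<in> carrier \<P>"
  shows "g x = g' x"
proof -
  interpret g: group_hom \<P> H g
    using H g group_presented by (simp add: group_hom_def group_hom_axioms_def)
  interpret g': group_hom \<P> H g'
    using H g group_presented by (simp add: group_hom_def group_hom_axioms_def)
  have "subgroup {x \<in> carrier \<P>. g x = g' x} \<P>"
    by unfold_locales auto
  from presented_generation[OF this] gens x show ?thesis by (auto simp: cls_in_carrier)
qed

text \<open>Integer weights on the generators that annihilate the relators: the degree map, the free
  coordinates of a diagonal presentation and the two vertex weightings all arise in this
  way.\<close>

lemma presented_functional:
  assumes "finite G" "\<And>x. x \<in> Rels \<Longrightarrow> (\<Sum>a\<in>G. Poly_Mapping.lookup x a * w a) = 0"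
  obtains f where "f \<in> hom \<P> integer_group"
    "\<And>x. Poly_Mapping.keys x \<subseteq> G \<Longrightarrow> f (cls x) = (\<Sum>a\<in>G. Poly_Mapping.lookup x a * w a)"
proof -
  have "(\<lambda>x. \<Sum>a\<in>G. Poly_Mapping.lookup x a * w a) \<in> hom \<F> integer_group"
    by (auto simp: hom_def lookup_add distrib_right sum.distrib)
  moreover have "(\<Sum>a\<in>G. Poly_Mapping.lookup x a * w a) = \<one>\<^bsub>integer_group\<^esub>" if "x \<in> Rels" for x
    using assms(2)[OF that] by simp
  ultimately show thesis
    by (rule presented_universal[OF group_integer_group]) (assumption, rule that)
qed

end

text \<open>Each map respects the relators of its source and so descends to the quotient. The
  induced maps are mutually inverse as soon as this holds on generators.\<close>

lemma presented_iso:
  assumes GR: "presentation G R" and HQ: "presentation H Q"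
    and f: "f \<in> hom (free_Abelian_group G) (free_Abelian_group H)"
      "\<And>x. x \<in> R \<Longrightarrow> f x \<in> generate (free_Abelian_group H) Q"
      "\<And>a. a \<in> G \<Longrightarrow> f' (f (frag_of a)) = frag_of a"
    and f': "f' \<in> hom (free_Abelian_group H) (free_Abelian_group G)"
      "\<And>x. x \<in> Q \<Longrightarrow> f' x \<in> generate (free_Abelian_group G) R"
      "\<And>a. a \<in> H \<Longrightarrow> f (f' (frag_of a)) = frag_of a"
  shows "presented_abelian_group G R \<cong> presented_abelian_group H Q"
proof -
  interpret P: presentation G R by fact
  interpret Q: presentation H Q by fact
  have keys: "Poly_Mapping.keys (f x) \<subseteq> H" if "Poly_Mapping.keys x \<subseteq> G" for x
    using hom_in_carrier[OF f(1)] that by simp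
  have keys': "Poly_Mapping.keys (f' x) \<subseteq> G" if "Poly_Mapping.keys x \<subseteq> H" for x
    using hom_in_carrier[OF f'(1)] that by simp
  have "(\<lambda>x. Q.cls (f x)) \<in> hom P.\<F> Q.\<P>"
    using hom_compose[OF f(1) Q.cls_hom] by (simp add: o_def)
  moreover have "Q.cls (f x) = \<one>\<^bsub>Q.\<P>\<^esub>" if "x \<in> R" for x
    using that f(2) Q.cls_eq_one_iff[OF keys] P.rels by simp
  ultimately obtain g where g: "g \<in> hom P.\<P> Q.\<P>"
      "\<And>x. Poly_Mapping.keys x \<subseteq> G \<Longrightarrow> g (P.cls x) = Q.cls (f x)"
    by (rule P.presented_universal[OF Q.group_presented]) (assumption, rule that)
  have "(\<lambda>x. P.cls (f' x)) \<in> hom Q.\<F> P.\<P>"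
    using hom_compose[OF f'(1) P.cls_hom] by (simp add: o_def)
  moreover have "P.cls (f' x) = \<one>\<^bsub>P.\<P>\<^esub>" if "x \<in> Q" for x
    using that f'(2) P.cls_eq_one_iff[OF keys'] Q.rels by simp
  ultimately obtain g' where g': "g' \<in> hom Q.\<P> P.\<P>"
      "\<And>x. Poly_Mapping.keys x \<subseteq> H \<Longrightarrow> g' (Q.cls x) = P.cls (f' x)"
    by (rule Q.presented_universal[OF P.group_presented]) (assumption, rule that)
  have "(g' \<circ> g) x = id x" if "x \<in> carrier P.\<P>" for x
  proof (rule P.presented_hom_eq[OF P.group_presented _ _ _ that, where g = "g' \<circ> g" and g' = id])
    show "g' \<circ> g \<in> hom P.\<P> P.\<P>" using hom_compose[OF g(1) g'(1)] .
    show "id \<in> hom P.\<P> P.\<P>" by (simp add: hom_def)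
    show "(g' \<circ> g) (P.cls (frag_of a)) = id (P.cls (frag_of a))" if "a \<in> G" for a
      using that g g' keys[of "frag_of a"] f(3) by simp
  qed
  moreover have "(g \<circ> g') x = id x" if "x \<in> carrier Q.\<P>" for x
  proof (rule Q.presented_hom_eq[OF Q.group_presented _ _ _ that, where g = "g \<circ> g'" and g' = id])
    show "g \<circ> g' \<in> hom Q.\<P> Q.\<P>" using hom_compose[OF g'(1) g(1)] .
    show "id \<in> hom Q.\<P> Q.\<P>" by (simp add: hom_def)
    show "(g \<circ> g') (Q.cls (frag_of a)) = id (Q.cls (frag_of a))" if "a \<in> H" for a
      using that g g' keys'[of "frag_of a"] f'(3) by simp
  qed
  ultimately have "group_isomorphisms P.\<P> Q.\<P> g g'"
    using g(1) g'(1) by (simp add: group_isomorphisms_def)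
  then show ?thesis by (rule is_isoI[OF group_isomorphisms_imp_iso])
qed

section \<open>Groups presented by the rows of an integer matrix\<close>

definition matrix_rows :: "'i set \<Rightarrow> ('i \<Rightarrow> 'i \<Rightarrow> int) \<Rightarrow> ('i \<Rightarrow>\<^sub>0 int) set" where
  "matrix_rows I t = (\<lambda>i. \<Sum>j\<in>I. frag_cmul (t i j) (frag_of j)) ` I"

lemma keys_linear_combination: "Poly_Mapping.keys (\<Sum>j\<in>I. frag_cmul (c j) (frag_of j)) \<subseteq> I"
proof -
  have "(\<Sum>j\<in>I. frag_cmul (c j) (frag_of j)) \<in> carrier (free_Abelian_group I)"
    by (rule sum_closed_free_Abelian_group) (use keys_cmul in \<open>fastforce simp: keys_frag_of\<close>)
  then show ?thesis by simp
qed

lemma presentation_matrix_rows: "presentation I (matrix_rows I t)"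
  by unfold_locales (use keys_linear_combination in \<open>force simp: matrix_rows_def\<close>)

lemma matrix_group_eq: "matrix_group k t = presented_abelian_group {1..k} (matrix_rows {1..k} t)"
  unfolding matrix_group_def matrix_rows_def setcompr_eq_image by (simp only: mem_Collect_eq Collect_mem_eq)

lemma lookup_linear_combination:
  assumes "finite I"
  shows "Poly_Mapping.lookup (\<Sum>j\<in>I. frag_cmul (c j) (frag_of j)) a = (if a \<in> I then c a else 0)"
  using assms by (simp add: lookup_sum if_distrib[of "(*) _"] cong: if_cong)

lemma frag_eq_linear_combination:
  assumes "finite I" "Poly_Mapping.keys x \<subseteq> I"
  shows "x = (\<Sum>j\<in>I. frag_cmul (Poly_Mapping.lookup x j) (frag_of j))"
  by (rule poly_mapping_eqI) (use assms in \<open>auto simp: lookup_linear_combination in_keys_iff\<close>)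

lemma generate_matrix_rows_row_addition:
  assumes "i \<in> I" "j \<in> I" "i \<noteq> j"
  shows "generate (free_Abelian_group I)
      (matrix_rows I (\<lambda>x y. if x = i then t i y + q * t j y else t x y)) \<subseteq>
    generate (free_Abelian_group I) (matrix_rows I t)"
proof -
  interpret presentation I "matrix_rows I t" by (rule presentation_matrix_rows)
  interpret N: subgroup \<N> \<F> by (rule subgroup_relations)
  let ?row = "\<lambda>x. \<Sum>y\<in>I. frag_cmul (t x y) (frag_of y)"
  have row: "?row x \<in> \<N>" if "x \<in> I" for x
    using that by (auto simp: matrix_rows_def intro: generate.incl)
  have "frag_cmul q (?row j) = ?row j [^]\<^bsub>\<F>\<^esub> q"
    by (subst int_pow_free_Abelian_group[OF keys_linear_combination]) simp
  also have "\<dots> \<in> \<N>"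
    using group.subgroup_int_pow_closed[OF group_free_Abelian_group subgroup_relations row[OF assms(2)]] .
  finally have qrow: "frag_cmul q (?row j) \<in> \<N>" .
  have sum_i: "(\<Sum>y\<in>I. frag_cmul (t i y + q * t j y) (frag_of y)) \<in> \<N>"
  proof -
    have "(\<Sum>y\<in>I. frag_cmul (t i y + q * t j y) (frag_of y)) = ?row i + frag_cmul q (?row j)"
      by (simp add: frag_cmul_distrib sum.distrib frag_cmul_sum)
    then show ?thesis using N.m_closed[OF row[OF assms(1)] qrow] by simp
  qed
  show ?thesis
  proof (rule group.generate_subgroup_incl[OF group_free_Abelian_group _ subgroup_relations])
    show "matrix_rows I (\<lambda>x y. if x = i then t i y + q * t j y else t x y) \<subseteq> \<N>"
    proof
      fix z assume "z \<in> matrix_rows I (\<lambda>x y. if x = i then t i y + q * t j y else t x y)"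
      then obtain x where "x \<in> I"
        "z = (\<Sum>y\<in>I. frag_cmul (if x = i then t i y + q * t j y else t x y) (frag_of y))"
        by (auto simp: matrix_rows_def)
      then show "z \<in> \<N>" using row sum_i by (cases "x = i") auto
    qed
  qed
qed

text \<open>A row operation leaves the subgroup of relations unchanged, so the groups are even
  equal. One inclusion suffices, applied to the operation and to its inverse with
  \<open>- q\<close>.\<close>

lemma presented_row_addition:
  assumes "i \<in> I" "j \<in> I" "i \<noteq> j"
  shows "presented_abelian_group I (matrix_rows I (\<lambda>x y. if x = i then t i y + q * t j y else t x y)) =
    presented_abelian_group I (matrix_rows I t)"
proof -
  let ?t = "\<lambda>x y. if x = i then t i y + q * t j y else t x y"
  have "(\<lambda>x y. if x = i then ?t i y + - q * ?t j y else ?t x y) = t"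
    using assms(3) by (auto simp: fun_eq_iff)
  then show ?thesis
    unfolding presented_abelian_group_def
    using generate_matrix_rows_row_addition[OF assms, of t q]
      generate_matrix_rows_row_addition[OF assms, of ?t "- q"] by simp
qed

lemma frag_extend_hom:
  assumes "\<And>a. a \<in> G \<Longrightarrow> Poly_Mapping.keys (f a) \<subseteq> H"
  shows "frag_extend f \<in> hom (free_Abelian_group G) (free_Abelian_group H)"
proof (rule homI)
  fix x assume "x \<in> carrier (free_Abelian_group G)"
  then show "frag_extend f x \<in> carrier (free_Abelian_group H)"
    using assms keys_frag_extend[of f x] by (simp add: subset_iff) blast
qed (simp add: frag_extend_add)

text \<open>A column operation is a change of basis of the free group: generator \<open>j\<close> is
  sent to itself plus \<open>q\<close> times generator \<open>i\<close>, with inverse given by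
  \<open>- q\<close>.\<close>

lemma presented_column_addition:
  assumes I: "finite I" "i \<in> I" "j \<in> I" "i \<noteq> j"
  shows "presented_abelian_group I (matrix_rows I t) \<cong>
    presented_abelian_group I (matrix_rows I (\<lambda>x y. if y = i then t x i + q * t x j else t x y))"
proof -
  define e where "e q y = frag_of y + (if y = j then frag_cmul q (frag_of i) else 0)" for q y
  let ?op = "\<lambda>q t x y. if y = i then t x i + q * t x j else (t x y :: int)"
  have keys: "Poly_Mapping.keys (e q a) \<subseteq> I" if "a \<in> I" for a q
  proof -
    have "e q a \<in> carrier (free_Abelian_group I)"
      unfolding e_def using that I keys_add[of "frag_of a" "frag_cmul q (frag_of i)"]
      by (auto simp: keys_frag_of)
    then show ?thesis by simp
  qed
  have inverse: "frag_extend (e p) (frag_extend (e q) (frag_of a)) = frag_of a"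
    if "a \<in> I" "p = - q" for a p q
    using that I(4) unfolding e_def
    by (auto simp: frag_extend_add frag_extend_cmul frag_cmul_distrib[symmetric] add.assoc)
  have image: "frag_extend (e q) z \<in> matrix_rows I (?op q t)" if z: "z \<in> matrix_rows I t" for z q t
  proof -
    obtain x where x: "x \<in> I" "z = (\<Sum>y\<in>I. frag_cmul (t x y) (frag_of y))"
      using z by (auto simp: matrix_rows_def)
    have "frag_extend (e q) z = (\<Sum>y\<in>I. frag_cmul (t x y) (e q y))"
      unfolding x(2) by (simp add: frag_extend_sum[OF I(1)] frag_extend_cmul)
    also have "\<dots> = (\<Sum>y\<in>I. frag_cmul (t x y) (frag_of y)) +
        (\<Sum>y\<in>I. if y = j then frag_cmul (t x j * q) (frag_of i) else 0)"
      unfolding e_def by (subst sum.distrib[symmetric], rule sum.cong) (auto simp: frag_cmul_distrib2)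
    also have "\<dots> = (\<Sum>y\<in>I. frag_cmul (t x y) (frag_of y)) +
        (\<Sum>y\<in>I. if y = i then frag_cmul (q * t x j) (frag_of i) else 0)"
      using I by (simp add: mult.commute)
    also have "\<dots> = (\<Sum>y\<in>I. frag_cmul (?op q t x y) (frag_of y))"
      by (subst sum.distrib[symmetric], rule sum.cong) (auto simp: frag_cmul_distrib)
    finally show ?thesis using x(1) unfolding matrix_rows_def by blast
  qed
  have undo: "?op (- q) (?op q t) = t" using I(4) by (auto simp: fun_eq_iff)
  show ?thesis
  proof (rule presented_iso[OF presentation_matrix_rows presentation_matrix_rows,
        where f = "frag_extend (e q)" and f' = "frag_extend (e (- q))"])
    show "frag_extend (e q) \<in> hom (free_Abelian_group I) (free_Abelian_group I)"
      "frag_extend (e (- q)) \<in> hom (free_Abelian_group I) (free_Abelian_group I)"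
      using keys by (auto intro!: frag_extend_hom)
    show "frag_extend (e q) z \<in> generate (free_Abelian_group I) (matrix_rows I (?op q t))"
      if "z \<in> matrix_rows I t" for z
      using image[OF that] by (rule generate.incl)
    show "frag_extend (e (- q)) z \<in> generate (free_Abelian_group I) (matrix_rows I t)"
      if "z \<in> matrix_rows I (?op q t)" for z
      using image[OF that, of "- q"] unfolding undo by (rule generate.incl)
    show "frag_extend (e (- q)) (frag_extend (e q) (frag_of a)) = frag_of a" if "a \<in> I" for a
      using inverse[OF that, of "- q" q] by simp
    show "frag_extend (e q) (frag_extend (e (- q)) (frag_of a)) = frag_of a" if "a \<in> I" for a
      using inverse[OF that, of q "- q"] by simp
  qed
qed

lemma presented_add_equiv:
  assumes "finite I" "add_equiv I A B"
  shows "presented_abelian_group I (matrix_rows I A) \<cong> presented_abelian_group I (matrix_rows I B)"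
  using assms(2)
proof (induction rule: add_equiv.induct)
  case base
  show ?case by simp
next
  case (add_row B i j q)
  then show ?case using presented_row_addition[of i I j B q] by simp
next
  case (add_col B i j q)
  then show ?case
    using presented_column_addition[OF assms(1) add_col.hyps(2-4)] iso_trans by blast
qed

text \<open>Transposing the operations that lead from \<open>A\<close> to a diagonal matrix
  \<open>D\<close> leads from the transpose of \<open>A\<close> to the transpose of
  \<open>D\<close>, which agrees with \<open>D\<close> on \<open>I\<close>.\<close>

lemma presented_transpose:
  assumes "finite I"
  shows "presented_abelian_group I (matrix_rows I A) \<cong>
    presented_abelian_group I (matrix_rows I (\<lambda>i j. A j i))"
proof -
  obtain D where D: "add_equiv I A D" "\<forall>i\<in>I. \<forall>j\<in>I. i \<noteq> j \<longrightarrow> D i j = 0"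
    using add_equiv_diagonal[OF assms, of A] by blast
  have "(\<Sum>j\<in>I. frag_cmul (D i j) (frag_of j)) = (\<Sum>j\<in>I. frag_cmul (D j i) (frag_of j))" if "i \<in> I" for i
    by (rule sum.cong) (use D(2) that in \<open>auto, metis\<close>)
  then have "matrix_rows I D = matrix_rows I (\<lambda>i j. D j i)"
    unfolding matrix_rows_def by (intro image_cong) auto
  moreover have "presented_abelian_group I (matrix_rows I (\<lambda>i j. A j i)) \<cong>
      presented_abelian_group I (matrix_rows I (\<lambda>i j. D j i))"
    by (rule presented_add_equiv[OF assms add_equiv_transpose[OF D(1)]])
  then have "presented_abelian_group I (matrix_rows I (\<lambda>i j. D j i)) \<cong>
      presented_abelian_group I (matrix_rows I (\<lambda>i j. A j i))"
    by (rule group.iso_sym[OF presentation.group_presented[OF presentation_matrix_rows]])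
  ultimately show ?thesis
    using presented_add_equiv[OF assms D(1)] iso_trans by metis
qed

text \<open>Two facts about finitely generated abelian groups: the torsion is finite, and an element
  on which all homomorphisms to \<int> vanish is torsion. Both are isomorphism invariants, so it is
  enough to check them for diagonal presentations.\<close>

definition torsion_controlled :: "('a, 'm) monoid_scheme \<Rightarrow> bool" where
  "torsion_controlled G \<longleftrightarrow> finite (carrier (torsion_subgroup G)) \<and>
     (\<forall>x\<in>carrier G. (\<forall>f\<in>hom G integer_group. f x = 0) \<longrightarrow> x \<in> carrier (torsion_subgroup G))"

lemma carrier_torsion_subgroup:
  "x \<in> carrier (torsion_subgroup G) \<longleftrightarrow>
    x \<in> carrier G \<and> (\<exists>n::nat. n > 0 \<and> x [^]\<^bsub>G\<^esub> n = \<one>\<^bsub>G\<^esub>)"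
  by (simp add: torsion_subgroup_def)

lemma subgroup_torsion:
  assumes "comm_group G"
  shows "subgroup (carrier (torsion_subgroup G)) G"
proof -
  interpret G: comm_group G by fact
  show ?thesis
  proof (rule G.subgroupI)
    show "carrier (torsion_subgroup G) \<subseteq> carrier G" by (auto simp: carrier_torsion_subgroup)
    have "\<one>\<^bsub>G\<^esub> \<in> carrier (torsion_subgroup G)"
      by (auto simp: carrier_torsion_subgroup intro!: exI[of _ 1])
    then show "carrier (torsion_subgroup G) \<noteq> {}" by blast
    show "inv\<^bsub>G\<^esub> x \<in> carrier (torsion_subgroup G)" if "x \<in> carrier (torsion_subgroup G)" for x
      using that by (auto simp: carrier_torsion_subgroup G.nat_pow_inv)
    show "x \<otimes>\<^bsub>G\<^esub> y \<in> carrier (torsion_subgroup G)"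
      if x: "x \<in> carrier (torsion_subgroup G)" and y: "y \<in> carrier (torsion_subgroup G)" for x y
    proof -
      obtain m where m: "x \<in> carrier G" "m > 0" "x [^]\<^bsub>G\<^esub> (m::nat) = \<one>\<^bsub>G\<^esub>"
        using x by (auto simp: carrier_torsion_subgroup)
      obtain n where n: "y \<in> carrier G" "n > 0" "y [^]\<^bsub>G\<^esub> (n::nat) = \<one>\<^bsub>G\<^esub>"
        using y by (auto simp: carrier_torsion_subgroup)
      have "x [^]\<^bsub>G\<^esub> (m * n) = \<one>\<^bsub>G\<^esub>"
        using G.nat_pow_pow[OF m(1), of m n] m(3) by simp
      moreover have "y [^]\<^bsub>G\<^esub> (m * n) = \<one>\<^bsub>G\<^esub>"
        using G.nat_pow_pow[OF n(1), of n m] n(3) by (simp add: mult.commute)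
      ultimately have "(x \<otimes>\<^bsub>G\<^esub> y) [^]\<^bsub>G\<^esub> (m * n) = \<one>\<^bsub>G\<^esub>"
        using m n by (simp add: G.pow_mult_distrib G.m_comm)
      then show ?thesis using m n by (auto simp: carrier_torsion_subgroup intro!: exI[of _ "m * n"])
    qed
  qed
qed

lemma torsion_subgroup_eq: "torsion_subgroup G = G\<lparr>carrier := carrier (torsion_subgroup G)\<rparr>"
  by (simp add: torsion_subgroup_def)

lemma group_torsion_subgroup: "comm_group G \<Longrightarrow> group (torsion_subgroup G)"
  by (subst torsion_subgroup_eq)
    (intro group.subgroup_imp_group subgroup_torsion comm_group.axioms(2))

lemma torsion_subgroup_iso:
  assumes "group G" "group H" "h \<in> iso G H"
  shows "h \<in> iso (torsion_subgroup G) (torsion_subgroup H)"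
proof -
  interpret h: group_hom G H h
    using assms by (simp add: group_hom_def group_hom_axioms_def iso_iff)
  have inj: "inj_on h (carrier G)" and surj: "h ` carrier G = carrier H"
    using assms(3) by (simp_all add: iso_iff)
  have tors: "h x \<in> carrier (torsion_subgroup H) \<longleftrightarrow> x \<in> carrier (torsion_subgroup G)"
    if x: "x \<in> carrier G" for x
  proof -
    have "h x [^]\<^bsub>H\<^esub> n = \<one>\<^bsub>H\<^esub> \<longleftrightarrow> x [^]\<^bsub>G\<^esub> n = \<one>\<^bsub>G\<^esub>" for n :: nat
    proof -
      have "h x [^]\<^bsub>H\<^esub> n = \<one>\<^bsub>H\<^esub> \<longleftrightarrow> h (x [^]\<^bsub>G\<^esub> n) = h \<one>\<^bsub>G\<^esub>"
        using x by (simp add: h.hom_nat_pow)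
      also have "\<dots> \<longleftrightarrow> x [^]\<^bsub>G\<^esub> n = \<one>\<^bsub>G\<^esub>"
        using inj x by (intro inj_on_eq_iff) auto
      finally show ?thesis .
    qed
    then show ?thesis using x by (simp add: carrier_torsion_subgroup)
  qed
  have "h \<in> hom (torsion_subgroup G) (torsion_subgroup H)"
  proof (rule homI)
    fix x y assume xy: "x \<in> carrier (torsion_subgroup G)" "y \<in> carrier (torsion_subgroup G)"
    then have "x \<in> carrier G" "y \<in> carrier G" by (auto simp: carrier_torsion_subgroup)
    then show "h (x \<otimes>\<^bsub>torsion_subgroup G\<^esub> y) = h x \<otimes>\<^bsub>torsion_subgroup H\<^esub> h y"
      by (simp add: torsion_subgroup_def)
  qed (use tors in \<open>auto simp: carrier_torsion_subgroup\<close>)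
  moreover have "h ` carrier (torsion_subgroup G) = carrier (torsion_subgroup H)"
  proof
    show "h ` carrier (torsion_subgroup G) \<subseteq> carrier (torsion_subgroup H)"
      using tors by (auto simp: carrier_torsion_subgroup)
    show "carrier (torsion_subgroup H) \<subseteq> h ` carrier (torsion_subgroup G)"
    proof
      fix y assume y: "y \<in> carrier (torsion_subgroup H)"
      then have "y \<in> h ` carrier G" unfolding surj by (simp add: carrier_torsion_subgroup)
      then obtain x where "x \<in> carrier G" "y = h x" by blast
      then show "y \<in> h ` carrier (torsion_subgroup G)" using tors[of x] y by simp
    qed
  qed
  moreover have "inj_on h (carrier (torsion_subgroup G))"
    by (rule inj_on_subset[OF inj]) (auto simp: carrier_torsion_subgroup)
  ultimately show ?thesis by (simp add: iso_iff)
qed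

lemma torsion_controlled_iso:
  assumes "group G" "group H" "G \<cong> H" "torsion_controlled H"
  shows "torsion_controlled G"
proof -
  obtain h where h: "h \<in> iso G H" using assms(3) by (auto simp: is_iso_def)
  have ht: "h \<in> iso (torsion_subgroup G) (torsion_subgroup H)"
    using torsion_subgroup_iso assms(1,2) h by blast
  have hom: "h \<in> hom G H" and inj: "inj_on h (carrier G)" using h by (auto simp: iso_iff)
  have "finite (carrier (torsion_subgroup G))"
    using ht assms(4) iso_finite[OF is_isoI[OF ht]] by (simp add: torsion_controlled_def)
  moreover have "x \<in> carrier (torsion_subgroup G)"
    if x: "x \<in> carrier G" and zero: "\<forall>f\<in>hom G integer_group. f x = 0" for x
  proof -
    have "f (h x) = 0" if "f \<in> hom H integer_group" for f
      using bspec[OF zero hom_compose[OF hom that]] by simp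
    moreover have "h x \<in> carrier H" using hom x by (rule hom_in_carrier)
    ultimately have "h x \<in> carrier (torsion_subgroup H)"
      using assms(4) by (simp add: torsion_controlled_def)
    then obtain y where y: "y \<in> carrier (torsion_subgroup G)" "h y = h x"
      using ht unfolding iso_iff by (metis imageE)
    then have "y = x" using inj_onD[OF inj, of y x] x by (simp add: carrier_torsion_subgroup)
    then show ?thesis using y by simp
  qed
  ultimately show ?thesis by (simp add: torsion_controlled_def)
qed

text \<open>Row \<open>i\<close> is \<open>D i i\<close> times generator \<open>i\<close>, so the
  presented group is a direct sum of cyclic groups. Where \<open>D i i = 0\<close>, divisibility
  means that the coordinate vanishes, and the summand is \<int>.\<close>

lemma diagonal_relations_iff:
  assumes I: "finite I" and D: "\<And>i j. i \<in> I \<Longrightarrow> j \<in> I \<Longrightarrow> i \<noteq> j \<Longrightarrow> D i j = 0"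
    and x: "Poly_Mapping.keys x \<subseteq> I"
  shows "x \<in> generate (free_Abelian_group I) (matrix_rows I D) \<longleftrightarrow>
    (\<forall>i\<in>I. D i i dvd Poly_Mapping.lookup x i)"
proof
  interpret presentation I "matrix_rows I D" by (rule presentation_matrix_rows)
  interpret N: subgroup \<N> \<F> by (rule subgroup_relations)
  have row: "(\<Sum>j\<in>I. frag_cmul (D i j) (frag_of j)) = frag_cmul (D i i) (frag_of i)" if "i \<in> I" for i
  proof -
    have "(\<Sum>j\<in>I. frag_cmul (D i j) (frag_of j)) =
        (\<Sum>j\<in>I. if j = i then frag_cmul (D i i) (frag_of i) else 0)"
      using D[OF that] by (intro sum.cong) auto
    then show ?thesis using I that by simp
  qed
  show "\<forall>i\<in>I. D i i dvd Poly_Mapping.lookup x i" if "x \<in> \<N>"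
  proof -
    let ?K = "{z. Poly_Mapping.keys z \<subseteq> I \<and> (\<forall>i\<in>I. D i i dvd Poly_Mapping.lookup z i)}"
    have "subgroup ?K \<F>"
    proof (rule group.subgroupI[OF group_free_Abelian_group])
      show "?K \<subseteq> carrier \<F>" by auto
      have "0 \<in> ?K" by simp
      then show "?K \<noteq> {}" by blast
      show "inv\<^bsub>\<F>\<^esub> a \<in> ?K" if "a \<in> ?K" for a using that by simp
      show "a \<otimes>\<^bsub>\<F>\<^esub> b \<in> ?K" if "a \<in> ?K" "b \<in> ?K" for a b
        using that keys_add[of a b] by (auto simp: lookup_add)
    qed
    moreover have "matrix_rows I D \<subseteq> ?K"
    proof
      fix z assume "z \<in> matrix_rows I D"
      then obtain i where i: "i \<in> I" "z = frag_cmul (D i i) (frag_of i)"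
        using row by (auto simp: matrix_rows_def)
      then show "z \<in> ?K" by auto
    qed
    ultimately have "\<N> \<subseteq> ?K"
      by (intro group.generate_subgroup_incl[OF group_free_Abelian_group])
    then show ?thesis using that by auto
  qed
  show "x \<in> \<N>" if dvd: "\<forall>i\<in>I. D i i dvd Poly_Mapping.lookup x i"
  proof -
    have multiple: "frag_cmul (Poly_Mapping.lookup x i) (frag_of i) \<in> \<N>" if i: "i \<in> I" for i
    proof -
      obtain c where c: "Poly_Mapping.lookup x i = D i i * c" using bspec[OF dvd i] by (rule dvdE)
      have "(\<Sum>j\<in>I. frag_cmul (D i j) (frag_of j)) \<in> matrix_rows I D"
        unfolding matrix_rows_def using i by (rule imageI)
      then have "frag_cmul (D i i) (frag_of i) \<in> \<N>"
        unfolding row[OF i] by (rule generate.incl)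
      then have "frag_cmul (D i i) (frag_of i) [^]\<^bsub>\<F>\<^esub> c \<in> \<N>"
        by (rule group.subgroup_int_pow_closed[OF group_free_Abelian_group subgroup_relations])
      moreover have "Poly_Mapping.keys (frag_cmul (D i i) (frag_of i)) \<subseteq> I"
        using i keys_cmul[of "D i i" "frag_of i"] by (auto simp: keys_frag_of)
      ultimately show ?thesis by (simp add: c mult.commute)
    qed
    have "(\<Sum>j\<in>J. frag_cmul (Poly_Mapping.lookup x j) (frag_of j)) \<in> \<N>" if "J \<subseteq> I" for J
      using finite_subset[OF that I] that
    proof (induction J rule: finite_induct)
      case empty
      then show ?case using N.one_closed by simp
    next
      case (insert i J)
      then show ?case using N.m_closed[OF multiple[of i]] by simp
    qed
    from this[OF subset_refl] show ?thesis
      by (simp only: frag_eq_linear_combination[OF I x, symmetric])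
  qed
qed

text \<open>A torsion element has coordinate zero in the infinite cyclic summands and one of
  finitely many residues in the others. The infinite coordinates are homomorphisms to \<int>; once
  they vanish, the product of the absolute values of the nonzero diagonal entries annihilates the
  element.\<close>

lemma torsion_controlled_diagonal:
  assumes I: "finite I" and D: "\<And>i j. i \<in> I \<Longrightarrow> j \<in> I \<Longrightarrow> i \<noteq> j \<Longrightarrow> D i j = 0"
  shows "torsion_controlled (presented_abelian_group I (matrix_rows I D))"
proof -
  interpret presentation I "matrix_rows I D" by (rule presentation_matrix_rows)
  let ?lk = Poly_Mapping.lookup
  have iff: "x \<in> \<N> \<longleftrightarrow> (\<forall>i\<in>I. D i i dvd ?lk x i)" if "Poly_Mapping.keys x \<subseteq> I" for x
    by (rule diagonal_relations_iff[OF I _ that]) (rule D)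
  have one: "cls x = \<one>\<^bsub>\<P>\<^esub> \<longleftrightarrow> (\<forall>i\<in>I. D i i dvd ?lk x i)" if "Poly_Mapping.keys x \<subseteq> I" for x
    using cls_eq_one_iff[OF that] iff[OF that] by simp
  have keys_cmul_I: "Poly_Mapping.keys (frag_cmul c x) \<subseteq> I" if "Poly_Mapping.keys x \<subseteq> I" for c x
    using that keys_cmul[of c x] by blast
  have pow: "cls x [^]\<^bsub>\<P>\<^esub> n = \<one>\<^bsub>\<P>\<^esub> \<longleftrightarrow> (\<forall>i\<in>I. D i i dvd int n * ?lk x i)"
    if "Poly_Mapping.keys x \<subseteq> I" for x and n :: nat
    using one[OF keys_cmul_I[OF that]] cls_pow[OF that] by simp
  have free_coordinate: "?lk x i = 0"
    if x: "Poly_Mapping.keys x \<subseteq> I" and i: "i \<in> I" "D i i = 0"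
      and tors: "cls x \<in> carrier (torsion_subgroup \<P>)" for x i
  proof -
    obtain n :: nat where "n > 0" "cls x [^]\<^bsub>\<P>\<^esub> n = \<one>\<^bsub>\<P>\<^esub>"
      using tors by (auto simp: carrier_torsion_subgroup)
    then show ?thesis using pow[OF x, of n] i by force
  qed
  \<comment> \<open>The upper bound is included so that the range is \<open>{0}\<close>, not empty,
    where \<open>D i i = 0\<close>.\<close>
  let ?U = "PiE I (\<lambda>i. {0..\<bar>D i i\<bar>})"
  let ?comb = "\<lambda>u. \<Sum>j\<in>I. frag_cmul (u j) (frag_of j)"
  have "carrier (torsion_subgroup \<P>) \<subseteq> (\<lambda>u. cls (?comb u)) ` ?U"
  proof
    fix y assume y: "y \<in> carrier (torsion_subgroup \<P>)"
    then obtain x where x: "Poly_Mapping.keys x \<subseteq> I" "y = cls x"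
      by (auto simp: carrier_torsion_subgroup carrier_presented)
    define u where "u = restrict (\<lambda>i. ?lk x i mod \<bar>D i i\<bar>) I"
    have "u i \<in> {0..\<bar>D i i\<bar>}" if "i \<in> I" for i
    proof (cases "D i i = 0")
      case True
      then show ?thesis using free_coordinate[OF x(1) that True] y x(2) that True by (simp add: u_def)
    next
      case False
      then show ?thesis using that by (simp add: u_def pos_mod_bound[THEN less_imp_le])
    qed
    then have "u \<in> ?U" by (auto simp: u_def)
    moreover have "cls x = cls (?comb u)"
    proof -
      have keys: "Poly_Mapping.keys (x - ?comb u) \<subseteq> I"
        using x(1) keys_diff[of x "?comb u"] keys_linear_combination[of u I]
        by (meson Un_least order_trans)
      have "D i i dvd ?lk (x - ?comb u) i" if "i \<in> I" for i
      proof -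
        have "D i i dvd ?lk x i - ?lk x i mod \<bar>D i i\<bar>"
          using dvd_minus_mod[of "\<bar>D i i\<bar>" "?lk x i"] by (simp only: abs_dvd_iff)
        then show ?thesis
          using that by (simp add: lookup_minus lookup_linear_combination[OF I] u_def)
      qed
      then have "x - ?comb u \<in> \<N>" by (simp add: iff[OF keys])
      then show ?thesis using cls_eq_iff[OF x(1) keys_linear_combination] by simp
    qed
    ultimately show "y \<in> (\<lambda>u. cls (?comb u)) ` ?U" using x(2) by blast
  qed
  moreover have "finite ?U" using I by (intro finite_PiE) auto
  ultimately have "finite (carrier (torsion_subgroup \<P>))" by (rule finite_subset[OF _ finite_imageI])
  moreover have "y \<in> carrier (torsion_subgroup \<P>)"
    if y: "y \<in> carrier \<P>" and zero: "\<forall>f\<in>hom \<P> integer_group. f y = 0" for y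
  proof -
    obtain x where x: "Poly_Mapping.keys x \<subseteq> I" "y = cls x" using y by (auto simp: carrier_presented)
    have free: "?lk x i = 0" if i: "i \<in> I" "D i i = 0" for i
    proof -
      \<comment> \<open>The weight concentrated at \<open>i\<close> reads off coordinate
        \<open>i\<close>; it annihilates the relators because \<open>D i i = 0\<close>.\<close>
      have delta: "(\<Sum>a\<in>I. ?lk z a * (if a = i then 1 else 0)) = ?lk z i" for z :: "_ \<Rightarrow>\<^sub>0 int"
        using I i(1) by (simp add: if_distrib cong: if_cong)
      have "(\<Sum>a\<in>I. ?lk z a * (if a = i then 1 else 0)) = 0" if z: "z \<in> matrix_rows I D" for z
      proof -
        have "z \<in> \<N>" using z by (rule generate.incl)
        then have "\<forall>j\<in>I. D j j dvd ?lk z j"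
          by (simp only: iff[OF rels[OF z]])
        then have "D i i dvd ?lk z i" using i(1) by (rule bspec)
        then show ?thesis using i by (simp add: delta)
      qed
      then obtain f where f: "f \<in> hom \<P> integer_group"
        "\<And>z. Poly_Mapping.keys z \<subseteq> I \<Longrightarrow> f (cls z) = (\<Sum>a\<in>I. ?lk z a * (if a = i then 1 else 0))"
        by (rule presented_functional[OF I]) (assumption, rule that)
      have "f (cls x) = 0" using zero f(1) x(2) by blast
      then show ?thesis using f(2)[OF x(1)] by (simp add: delta)
    qed
    define n where "n = (\<Prod>i\<in>{i\<in>I. D i i \<noteq> 0}. nat \<bar>D i i\<bar>)"
    have "n > 0" unfolding n_def using I by (intro prod_pos) auto
    have "D i i dvd int n * ?lk x i" if i: "i \<in> I" for i
    proof (cases "D i i = 0")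
      case True
      then show ?thesis using free[OF i True] by simp
    next
      case False
      then have "nat \<bar>D i i\<bar> dvd n" unfolding n_def using I i by (intro dvd_prodI) auto
      then have "D i i dvd int n" by (simp add: nat_abs_dvd_iff)
      then show ?thesis by (rule dvd_mult2)
    qed
    then have "cls x [^]\<^bsub>\<P>\<^esub> n = \<one>\<^bsub>\<P>\<^esub>" using pow[OF x(1)] by blast
    then show ?thesis using y x(2) \<open>n > 0\<close> by (auto simp: carrier_torsion_subgroup)
  qed
  ultimately show ?thesis by (simp add: torsion_controlled_def)
qed

lemma torsion_controlled_matrix:
  assumes "finite I"
  shows "torsion_controlled (presented_abelian_group I (matrix_rows I A))"
proof -
  obtain D where D: "add_equiv I A D" "\<forall>i\<in>I. \<forall>j\<in>I. i \<noteq> j \<longrightarrow> D i j = 0"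
    using add_equiv_diagonal[OF assms, of A] by blast
  show ?thesis
  proof (rule torsion_controlled_iso)
    show "presented_abelian_group I (matrix_rows I A) \<cong> presented_abelian_group I (matrix_rows I D)"
      by (rule presented_add_equiv[OF assms D(1)])
    show "torsion_controlled (presented_abelian_group I (matrix_rows I D))"
      by (rule torsion_controlled_diagonal[OF assms]) (use D(2) in blast)
  qed (rule presentation.group_presented[OF presentation_matrix_rows])+
qed

text \<open>A homomorphism onto \<int> splits by the choice of a preimage \<open>a\<close> of
  \<open>1\<close>: every \<open>x\<close> is the power of \<open>a\<close> with exponent
  \<open>\<epsilon> x\<close>, times an element of the kernel.\<close>

lemma integer_summand_iso:
  assumes A: "comm_group A" and \<epsilon>: "\<epsilon> \<in> hom A integer_group" and a: "a \<in> carrier A" "\<epsilon> a = 1"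
  shows "A \<cong> integer_group \<times>\<times> A\<lparr>carrier := {x \<in> carrier A. \<epsilon> x = 0}\<rparr>"
proof -
  interpret A: comm_group A by fact
  interpret \<epsilon>: group_hom A integer_group \<epsilon>
    using \<epsilon> by (simp add: group_hom_def group_hom_axioms_def)
  let ?K = "{x \<in> carrier A. \<epsilon> x = 0}"
  define h where "h = (\<lambda>(n::int, x). a [^]\<^bsub>A\<^esub> n \<otimes>\<^bsub>A\<^esub> x)"
  have eps_h: "\<epsilon> (a [^]\<^bsub>A\<^esub> n \<otimes>\<^bsub>A\<^esub> x) = n" if "x \<in> ?K" for n :: int and x
    using that a \<epsilon>.hom_int_pow[OF a(1), of n] by simp
  have K: "subgroup ?K A"
    using \<epsilon>.subgroup_kernel by (simp add: kernel_def)
  have "h \<in> iso (integer_group \<times>\<times> A\<lparr>carrier := ?K\<rparr>) A"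
    unfolding iso_iff
  proof (intro conjI)
    show "h \<in> hom (integer_group \<times>\<times> A\<lparr>carrier := ?K\<rparr>) A"
      using a by (auto simp: hom_def h_def A.int_pow_mult A.m_ac)
    show "inj_on h (carrier (integer_group \<times>\<times> A\<lparr>carrier := ?K\<rparr>))"
    proof (rule inj_onI, clarify)
      fix n x n' x'
      assume xs: "(n, x) \<in> carrier (integer_group \<times>\<times> A\<lparr>carrier := ?K\<rparr>)"
        "(n', x') \<in> carrier (integer_group \<times>\<times> A\<lparr>carrier := ?K\<rparr>)" and eq: "h (n, x) = h (n', x')"
      then have "n = n'" using eps_h[of x n] eps_h[of x' n'] by (simp add: h_def)
      then show "n = n' \<and> x = x'" using xs eq a by (simp add: h_def)
    qed
    show "h ` carrier (integer_group \<times>\<times> A\<lparr>carrier := ?K\<rparr>) = carrier A"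
    proof
      show "h ` carrier (integer_group \<times>\<times> A\<lparr>carrier := ?K\<rparr>) \<subseteq> carrier A"
        using a by (auto simp: h_def)
      show "carrier A \<subseteq> h ` carrier (integer_group \<times>\<times> A\<lparr>carrier := ?K\<rparr>)"
      proof
        fix x assume x: "x \<in> carrier A"
        let ?y = "inv\<^bsub>A\<^esub> (a [^]\<^bsub>A\<^esub> \<epsilon> x) \<otimes>\<^bsub>A\<^esub> x"
        have "?y \<in> ?K" using x a \<epsilon>.hom_int_pow[OF a(1), of "\<epsilon> x"] by simp
        moreover have "x = h (\<epsilon> x, ?y)"
          using x a by (simp add: h_def A.m_assoc[symmetric])
        ultimately show "x \<in> h ` carrier (integer_group \<times>\<times> A\<lparr>carrier := ?K\<rparr>)"
          by (intro image_eqI[of _ _ "(\<epsilon> x, ?y)"]) auto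
      qed
    qed
  qed
  moreover have "group (integer_group \<times>\<times> A\<lparr>carrier := ?K\<rparr>)"
    using A.subgroup_imp_group[OF K] by (intro DirProd_group) auto
  ultimately show ?thesis using group.iso_sym is_isoI by blast
qed

section \<open>Two families of paired triangles\<close>

lemma (in presentation) integer_hom_linear:
  assumes f: "f \<in> hom \<P> integer_group" and J: "finite J" "J \<subseteq> G"
  shows "f (cls (\<Sum>j\<in>J. frag_cmul (c j) (frag_of j))) = (\<Sum>j\<in>J. c j * f (cls (frag_of j)))"
proof -
  interpret fc: group_hom \<F> integer_group "f \<circ> cls"
    using hom_compose[OF cls_hom f] by (simp add: group_hom_def group_hom_axioms_def)
  have cmul: "f (cls (frag_cmul n (frag_of j))) = n * f (cls (frag_of j))" if "j \<in> G" for n j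
    using fc.hom_int_pow[of "frag_of j" n] that by simp
  show ?thesis
    using J
  proof (induction J rule: finite_induct)
    case empty
    show ?case using fc.hom_one by simp
  next
    case (insert j J)
    have "Poly_Mapping.keys (frag_cmul (c j) (frag_of j)) \<subseteq> G"
      using insert.prems by auto
    moreover have "Poly_Mapping.keys (\<Sum>j\<in>J. frag_cmul (c j) (frag_of j)) \<subseteq> G"
      using keys_linear_combination[of c J] insert.prems by auto
    ultimately show ?case
      using fc.hom_mult[of "frag_cmul (c j) (frag_of j)" "\<Sum>j\<in>J. frag_cmul (c j) (frag_of j)"]
        insert cmul by simp
  qed
qed

text \<open>\<open>cs\<close>, \<open>rc\<close> and \<open>rs\<close> send a white triangle to the black triangle across its edge with
  ends in \<open>C \<union> S\<close>, \<open>R \<union> C\<close> and \<open>R \<union> S\<close>, respectively.\<close>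

locale paired_triangles =
  fixes W B :: "'f set" and R C S :: "'v set" and \<rho> \<gamma> \<sigma> :: "'f \<Rightarrow> 'v" and cs rc rs :: "'f \<Rightarrow> 'f"
  assumes finite_W: "finite W" and W_nonempty: "W \<noteq> {}"
    and bij: "bij_betw cs W B" "bij_betw rc W B" "bij_betw rs W B"
    and cs: "\<And>F. F \<in> W \<Longrightarrow> \<gamma> (cs F) = \<gamma> F" "\<And>F. F \<in> W \<Longrightarrow> \<sigma> (cs F) = \<sigma> F"
    and rc: "\<And>F. F \<in> W \<Longrightarrow> \<rho> (rc F) = \<rho> F" "\<And>F. F \<in> W \<Longrightarrow> \<gamma> (rc F) = \<gamma> F"
    and rs: "\<And>F. F \<in> W \<Longrightarrow> \<rho> (rs F) = \<rho> F" "\<And>F. F \<in> W \<Longrightarrow> \<sigma> (rs F) = \<sigma> F"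
    and vertices: "R = \<rho> ` W" "C = \<gamma> ` W" "S = \<sigma> ` W"
    and disjoint: "R \<inter> C = {}" "R \<inter> S = {}" "C \<inter> S = {}"
    and connected: "\<And>P F F'. (\<And>G. G \<in> W \<Longrightarrow> P (cs G) = P G) \<Longrightarrow> (\<And>G. G \<in> W \<Longrightarrow> P (rc G) = P G) \<Longrightarrow>
      (\<And>G. G \<in> W \<Longrightarrow> P (rs G) = P G) \<Longrightarrow> F \<in> W \<Longrightarrow> F' \<in> W \<Longrightarrow> P F \<Longrightarrow> P F'"
begin

lemma connected_eq:
  assumes "\<And>G. G \<in> W \<Longrightarrow> f (cs G) = f G" "\<And>G. G \<in> W \<Longrightarrow> f (rc G) = f G"
    "\<And>G. G \<in> W \<Longrightarrow> f (rs G) = f G" "F \<in> W" "F' \<in> W"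
  shows "f F = f F'"
  using connected[of "\<lambda>G. f F = f G" F F'] assms by simp

text \<open>Both sides are the sum of \<open>h\<close> over the black triangles at \<open>v\<close>,
  reached through \<open>cs\<close> on the left and through \<open>g\<close> on the right.\<close>

lemma sum_around_vertex:
  fixes h :: "'f \<Rightarrow> 'b::comm_monoid_add"
  assumes g: "bij_betw g W B" "\<And>F. F \<in> W \<Longrightarrow> \<rho> (g F) = \<rho> F"
  shows "(\<Sum>F | F \<in> W \<and> \<rho> (cs F) = v. h (cs F)) = (\<Sum>F | F \<in> W \<and> \<rho> F = v. h (g F))"
proof -
  have "bij_betw cs {F \<in> W. \<rho> (cs F) = v} {F \<in> B. \<rho> F = v}"
    using bij(1) unfolding bij_betw_def by (auto intro: inj_on_subset)
  then have "(\<Sum>F\<in>{F \<in> W. \<rho> (cs F) = v}. h (cs F)) = (\<Sum>F\<in>{F \<in> B. \<rho> F = v}. h F)"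
    by (rule sum.reindex_bij_betw)
  moreover have "bij_betw g {F \<in> W. \<rho> F = v} {F \<in> B. \<rho> F = v}"
    using g unfolding bij_betw_def by (auto intro: inj_on_subset)
  then have "(\<Sum>F\<in>{F \<in> W. \<rho> F = v}. h (g F)) = (\<Sum>F\<in>{F \<in> B. \<rho> F = v}. h F)"
    by (rule sum.reindex_bij_betw)
  ultimately show ?thesis by simp
qed

definition relator :: "'f \<Rightarrow> 'v \<Rightarrow>\<^sub>0 int" where
  "relator F = frag_of (\<rho> F) + frag_of (\<gamma> F) + frag_of (\<sigma> F)"

text \<open>A white triangle with \<open>\<rho> (cs F) = v\<close> has the same vertices in
  \<open>C\<close> and \<open>S\<close> as the black triangle at \<open>v\<close> that it adjoins.
  These recur, with the same multiplicities, in the white triangles at \<open>v\<close>, through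
  \<open>rc\<close> for \<open>C\<close> and through \<open>rs\<close> for \<open>S\<close>; after
  subtraction only vertices of \<open>R\<close> remain.\<close>

lemma row_as_relators:
  "(\<Sum>F | F \<in> W \<and> \<rho> (cs F) = v. frag_of (\<rho> F) - frag_of v) =
    (\<Sum>F | F \<in> W \<and> \<rho> (cs F) = v. relator F) - (\<Sum>F | F \<in> W \<and> \<rho> F = v. relator F)"
proof -
  let ?W' = "{F. F \<in> W \<and> \<rho> (cs F) = v}" and ?W = "{F. F \<in> W \<and> \<rho> F = v}"
  have "(\<Sum>F\<in>?W'. frag_of (\<gamma> F)) = (\<Sum>F\<in>?W'. frag_of (\<gamma> (cs F)))"
    using cs by (intro sum.cong) auto
  also have "\<dots> = (\<Sum>F\<in>?W. frag_of (\<gamma> (rc F)))"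
    using sum_around_vertex[OF bij(2) rc(1), of "\<lambda>F. frag_of (\<gamma> F)"] by simp
  also have "\<dots> = (\<Sum>F\<in>?W. frag_of (\<gamma> F))"
    using rc by (intro sum.cong) auto
  finally have 1: "(\<Sum>F\<in>?W'. frag_of (\<gamma> F)) = (\<Sum>F\<in>?W. frag_of (\<gamma> F))" .
  have "(\<Sum>F\<in>?W'. frag_of (\<sigma> F)) = (\<Sum>F\<in>?W'. frag_of (\<sigma> (cs F)))"
    using cs by (intro sum.cong) auto
  also have "\<dots> = (\<Sum>F\<in>?W. frag_of (\<sigma> (rs F)))"
    using sum_around_vertex[OF bij(3) rs(1), of "\<lambda>F. frag_of (\<sigma> F)"] by simp
  also have "\<dots> = (\<Sum>F\<in>?W. frag_of (\<sigma> F))"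
    using rs by (intro sum.cong) auto
  finally have 2: "(\<Sum>F\<in>?W'. frag_of (\<sigma> F)) = (\<Sum>F\<in>?W. frag_of (\<sigma> F))" .
  have "(\<Sum>F\<in>?W'. frag_of v) = (\<Sum>F\<in>?W. frag_of v)"
    using sum_around_vertex[OF bij(2) rc(1), of "\<lambda>F. frag_of v"] by simp
  also have "\<dots> = (\<Sum>F\<in>?W. frag_of (\<rho> F))" by (intro sum.cong) auto
  finally have 3: "(\<Sum>F\<in>?W'. frag_of v) = (\<Sum>F\<in>?W. frag_of (\<rho> F))" .
  show ?thesis
    unfolding relator_def sum.distrib sum_subtractf 1 2 3 by (simp add: algebra_simps)
qed

lemma rho_cs:
  assumes "F \<in> W"
  shows "\<rho> (cs F) \<in> R"
proof -
  have "cs F \<in> rc ` W"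
    using assms bij(1,2) unfolding bij_betw_def by blast
  then obtain G where "G \<in> W" "cs F = rc G" by blast
  then show ?thesis using rc(1) vertices(1) by auto
qed

text \<open>The maximum principle in quadratic form: \<open>\<Sum> z(\<rho> F)\<^sup>2\<close> equals \<open>\<Sum> z(\<rho> (cs F))\<^sup>2\<close> by double
  counting, and so does \<open>\<Sum> z(\<rho> F) z(\<rho> (cs F))\<close> by harmonicity; hence
  \<open>\<Sum> (z(\<rho> F) - z(\<rho> (cs F)))\<^sup>2 = 0\<close>.\<close>

lemma harmonic_constant:
  fixes z :: "'v \<Rightarrow> int"
  assumes harmonic: "\<And>v. v \<in> R \<Longrightarrow> (\<Sum>F | F \<in> W \<and> \<rho> (cs F) = v. z (\<rho> F) - z v) = 0"
    and uv: "u \<in> R" "v \<in> R"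
  shows "z u = z v"
proof -
  \<comment> \<open>Grouping the white triangles by \<open>v = \<rho> (cs F)\<close> lets the factor
    \<open>z v\<close> be pulled out of a sum that vanishes by harmonicity.\<close>
  have "(\<Sum>F\<in>W. z (\<rho> (cs F)) * (z (\<rho> F) - z (\<rho> (cs F)))) =
      (\<Sum>v\<in>R. \<Sum>F | F \<in> W \<and> \<rho> (cs F) = v. z (\<rho> (cs F)) * (z (\<rho> F) - z (\<rho> (cs F))))"
    by (rule sum.group[OF finite_W, symmetric]) (use finite_W rho_cs in \<open>auto simp: vertices(1)\<close>)
  also have "\<dots> = (\<Sum>v\<in>R. z v * (\<Sum>F | F \<in> W \<and> \<rho> (cs F) = v. z (\<rho> F) - z v))"
    unfolding sum_distrib_left by (intro sum.cong) auto
  also have "\<dots> = 0" using harmonic by simp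
  finally have "(\<Sum>F\<in>W. z (\<rho> (cs F)) * (z (\<rho> F) - z (\<rho> (cs F)))) = 0" .
  moreover have "(\<Sum>F\<in>W. (z (\<rho> F))\<^sup>2) = (\<Sum>F\<in>W. (z (\<rho> (cs F)))\<^sup>2)"
  proof -
    have "(\<Sum>F\<in>W. (z (\<rho> F))\<^sup>2) = (\<Sum>F\<in>W. (z (\<rho> (rc F)))\<^sup>2)" using rc by simp
    also have "\<dots> = (\<Sum>F\<in>B. (z (\<rho> F))\<^sup>2)" by (rule sum.reindex_bij_betw[OF bij(2)])
    also have "\<dots> = (\<Sum>F\<in>W. (z (\<rho> (cs F)))\<^sup>2)" by (rule sum.reindex_bij_betw[OF bij(1), symmetric])
    finally show ?thesis .
  qed
  moreover have "(\<Sum>F\<in>W. (z (\<rho> F) - z (\<rho> (cs F)))\<^sup>2) =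
      (\<Sum>F\<in>W. (z (\<rho> F))\<^sup>2) - (\<Sum>F\<in>W. (z (\<rho> (cs F)))\<^sup>2) -
      2 * (\<Sum>F\<in>W. z (\<rho> (cs F)) * (z (\<rho> F) - z (\<rho> (cs F))))"
    unfolding sum_distrib_left sum_subtractf[symmetric]
    by (intro sum.cong) (auto simp: power2_eq_square algebra_simps)
  ultimately have "(\<Sum>F\<in>W. (z (\<rho> F) - z (\<rho> (cs F)))\<^sup>2) = 0" by simp
  then have "\<forall>F\<in>W. (z (\<rho> F) - z (\<rho> (cs F)))\<^sup>2 = 0"
    by (simp add: sum_nonneg_eq_0_iff[OF finite_W])
  then have "z (\<rho> (cs F)) = z (\<rho> F)" if "F \<in> W" for F using that by simp
  \<comment> \<open>\<open>rc\<close> and \<open>rs\<close> keep \<open>\<rho>\<close>, so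
    \<open>z\<close> composed with \<open>\<rho>\<close> is now invariant under all three
    pairings.\<close>
  then have "z (\<rho> F) = z (\<rho> F')" if "F \<in> W" "F' \<in> W" for F F'
    using connected_eq[of "\<lambda>F. z (\<rho> F)" F F'] rc rs that by simp
  then show ?thesis using uv vertices(1) by blast
qed

end

section \<open>The Laplacian and the splitting of the triangle group\<close>

locale indexed_triangles = paired_triangles +
  fixes k :: nat and r :: "nat \<Rightarrow> 'b"
  assumes index: "bij_betw r {1..k} R"
begin

text \<open>The adjacency matrix of a digraph on the vertices of \<open>R\<close> with one arc for
  each white triangle. The white triangle determines the column, as in \<open>T\<close>; a loop
  arises when it and its black neighbour have the same vertex in \<open>R\<close>.\<close>

definition num :: "nat \<Rightarrow> nat \<Rightarrow> int" where
  "num i j = int (card {F \<in> W. \<rho> F = r j \<and> \<rho> (cs F) = r i})"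

text \<open>Summing over all \<open>l\<close> keeps the index set uniform; the loops counted by
  \<open>num i i\<close> cancel on the diagonal, which is therefore that of
  \<open>T\<close>.\<close>

definition laplacian :: "nat \<Rightarrow> nat \<Rightarrow> int" where
  "laplacian i j = num i j - (if i = j then \<Sum>l\<in>{1..k}. num i l else 0)"

abbreviation "laplacian_rows \<equiv> matrix_rows {1..k} laplacian"

sublocale B: presentation "{1..k}" laplacian_rows
  by (rule presentation_matrix_rows)

sublocale A: presentation "R \<union> C \<union> S" "relator ` W"
proof
  fix x assume "x \<in> relator ` W"
  then obtain F where F: "F \<in> W" "x = relator F" by blast
  have "{\<rho> F, \<gamma> F, \<sigma> F} \<subseteq> R \<union> C \<union> S" using F(1) vertices by auto
  then have "relator F \<in> carrier (free_Abelian_group (R \<union> C \<union> S))"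
    unfolding relator_def
    using group.subgroup_self[OF group_free_Abelian_group] subgroup.m_closed
    by (auto simp: keys_frag_of dest!: subsetD[OF keys_add])
  then show "Poly_Mapping.keys x \<subseteq> R \<union> C \<union> S" using F by simp
qed

lemma finite_V: "finite (R \<union> C \<union> S)"
  using finite_W vertices by simp

lemma r_in_R: "j \<in> {1..k} \<Longrightarrow> r j \<in> R"
  using index by (auto simp: bij_betw_def)

lemma sum_by_index:
  assumes "finite U" "\<And>F. F \<in> U \<Longrightarrow> h F \<in> R"
  shows "(\<Sum>j\<in>{1..k}. int (card {F \<in> U. h F = r j}) * g (r j)) = (\<Sum>F\<in>U. g (h F))"
proof -
  have "(\<Sum>j\<in>{1..k}. int (card {F \<in> U. h F = r j}) * g (r j)) =
      (\<Sum>v\<in>R. int (card {F \<in> U. h F = v}) * g v)"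
    by (rule sum.reindex_bij_betw[OF index])
  also have "\<dots> = (\<Sum>v\<in>R. \<Sum>F | F \<in> U \<and> h F = v. g (h F))"
    by (intro sum.cong) auto
  also have "\<dots> = (\<Sum>F\<in>U. g (h F))"
    by (rule sum.group) (use assms finite_W in \<open>auto simp: vertices(1)\<close>)
  finally show ?thesis .
qed

text \<open>Counting triangles by their vertex in \<open>R\<close> turns a row of the matrix into a
  sum over triangles. The free choice of \<open>z\<close> serves three purposes: the constant
  \<open>1\<close> gives zero row sums, a coefficient of a formal sum gives the identity in the free
  group, and a homomorphism to \<int> gives harmonicity.\<close>

lemma laplacian_row:
  fixes z :: "'b \<Rightarrow> int"
  assumes i: "i \<in> {1..k}"
  shows "(\<Sum>j\<in>{1..k}. laplacian i j * z (r j)) = (\<Sum>F | F \<in> W \<and> \<rho> (cs F) = r i. z (\<rho> F) - z (r i))"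
proof -
  let ?W = "{F. F \<in> W \<and> \<rho> (cs F) = r i}"
  have count: "(\<Sum>j\<in>{1..k}. num i j * g (r j)) = (\<Sum>F\<in>?W. g (\<rho> F))" for g :: "'b \<Rightarrow> int"
  proof -
    have "{F \<in> ?W. \<rho> F = r j} = {F \<in> W. \<rho> F = r j \<and> \<rho> (cs F) = r i}" for j by blast
    then show ?thesis
      using sum_by_index[of ?W \<rho> g] finite_W vertices(1) by (simp add: num_def)
  qed
  have "(\<Sum>j\<in>{1..k}. laplacian i j * z (r j)) =
      (\<Sum>j\<in>{1..k}. num i j * z (r j)) - (\<Sum>j\<in>{1..k}. if j = i then (\<Sum>l\<in>{1..k}. num i l) * z (r i) else 0)"
    unfolding laplacian_def sum_subtractf[symmetric] by (intro sum.cong) (auto simp: algebra_simps)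
  also have "\<dots> = (\<Sum>F\<in>?W. z (\<rho> F)) - (\<Sum>F\<in>?W. z (r i))"
    using count[of z] count[of "\<lambda>_. 1"] i by simp
  finally show ?thesis by (simp add: sum_subtractf)
qed

text \<open>The two sums are the numbers of black and of white triangles at \<open>r i\<close>,
  which \<open>rc\<close> pairs.\<close>

lemma num_balanced: "(\<Sum>l\<in>{1..k}. num i l) = (\<Sum>l\<in>{1..k}. num l i)"
proof -
  have "{F \<in> {F \<in> W. \<rho> (cs F) = r i}. \<rho> F = r l} = {F \<in> W. \<rho> F = r l \<and> \<rho> (cs F) = r i}" for l
    by blast
  then have "(\<Sum>l\<in>{1..k}. num i l) = (\<Sum>F | F \<in> W \<and> \<rho> (cs F) = r i. 1)"
    using sum_by_index[of "{F \<in> W. \<rho> (cs F) = r i}" \<rho> "\<lambda>_. 1"] finite_W vertices(1)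
    by (simp add: num_def)
  also have "\<dots> = (\<Sum>F | F \<in> W \<and> \<rho> F = r i. 1)"
    by (rule sum_around_vertex[OF bij(2) rc(1)])
  also have "{F \<in> {F \<in> W. \<rho> F = r i}. \<rho> (cs F) = r l} = {F \<in> W. \<rho> F = r i \<and> \<rho> (cs F) = r l}" for l
    by blast
  then have "(\<Sum>F | F \<in> W \<and> \<rho> F = r i. 1) = (\<Sum>l\<in>{1..k}. num l i)"
    using sum_by_index[of "{F \<in> W. \<rho> F = r i}" "\<lambda>F. \<rho> (cs F)" "\<lambda>_. 1"] finite_W rho_cs
    by (simp add: num_def)
  finally show ?thesis .
qed

lemma laplacian_row_frag:
  assumes i: "i \<in> {1..k}"
  shows "(\<Sum>j\<in>{1..k}. frag_cmul (laplacian i j) (frag_of (r j))) =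
    (\<Sum>F | F \<in> W \<and> \<rho> (cs F) = r i. frag_of (\<rho> F) - frag_of (r i))"
proof (rule poly_mapping_eqI)
  fix v
  show "Poly_Mapping.lookup (\<Sum>j\<in>{1..k}. frag_cmul (laplacian i j) (frag_of (r j))) v =
    Poly_Mapping.lookup (\<Sum>F | F \<in> W \<and> \<rho> (cs F) = r i. frag_of (\<rho> F) - frag_of (r i)) v"
    using laplacian_row[OF i, of "\<lambda>u. Poly_Mapping.lookup (frag_of u) v"]
    by (simp only: lookup_sum lookup_frag_cmul lookup_minus)
qed

lemma sums_of_relators:
  assumes "U \<subseteq> W"
  shows "(\<Sum>F\<in>U. relator F) \<in> A.\<N>"
  using finite_subset[OF assms finite_W] assms
proof (induction U rule: finite_induct)
  case empty
  show ?case using subgroup.one_closed[OF A.subgroup_relations] by simp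
next
  case (insert F U)
  then show ?case
    using subgroup.m_closed[OF A.subgroup_relations, of "relator F" "\<Sum>F\<in>U. relator F"]
    by (simp add: generate.incl)
qed

text \<open>Weight \<open>1\<close> on every generator respects the relators because the rows sum to
  zero. The values of any homomorphism to \<int> on the generators form a harmonic function, so the
  homomorphism is a multiple of \<open>\<epsilon>\<close>. Hence all of them vanish on the kernel of
  \<open>\<epsilon>\<close>, which must be torsion; conversely, \<int> is torsion free.\<close>

lemma degree_hom:
  obtains \<epsilon> where "\<epsilon> \<in> hom B.\<P> integer_group" "\<And>j. j \<in> {1..k} \<Longrightarrow> \<epsilon> (B.cls (frag_of j)) = 1"
    "carrier (torsion_subgroup B.\<P>) = {x \<in> carrier B.\<P>. \<epsilon> x = 0}"
proof -
  have "(\<Sum>j\<in>{1..k}. Poly_Mapping.lookup x j * 1) = 0" if x: "x \<in> laplacian_rows" for x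
  proof -
    obtain i where i: "i \<in> {1..k}" "x = (\<Sum>j\<in>{1..k}. frag_cmul (laplacian i j) (frag_of j))"
      using x unfolding matrix_rows_def by blast
    have "(\<Sum>j\<in>{1..k}. Poly_Mapping.lookup x j * 1) = (\<Sum>j\<in>{1..k}. laplacian i j * 1)"
      unfolding i(2) lookup_linear_combination[OF finite_atLeastAtMost] by (intro sum.cong) auto
    then show ?thesis using laplacian_row[OF i(1), of "\<lambda>_. 1"] by simp
  qed
  then obtain \<epsilon> where \<epsilon>: "\<epsilon> \<in> hom B.\<P> integer_group"
    "\<And>x. Poly_Mapping.keys x \<subseteq> {1..k} \<Longrightarrow> \<epsilon> (B.cls x) = (\<Sum>j\<in>{1..k}. Poly_Mapping.lookup x j * 1)"
    by (rule B.presented_functional[OF finite_atLeastAtMost]) (assumption, rule that)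
  have eps1: "\<epsilon> (B.cls (frag_of j)) = 1" if "j \<in> {1..k}" for j
    using \<epsilon>(2)[of "frag_of j"] that by (simp add: keys_frag_of)
  interpret \<epsilon>: group_hom B.\<P> integer_group \<epsilon>
    using \<epsilon>(1) B.group_presented by (simp add: group_hom_def group_hom_axioms_def)
  have multiple: "f x = 0" if f: "f \<in> hom B.\<P> integer_group" and x: "x \<in> carrier B.\<P>" "\<epsilon> x = 0" for f x
  proof -
    define z where "z v = f (B.cls (frag_of (inv_into {1..k} r v)))" for v
    have z: "z (r j) = f (B.cls (frag_of j))" if "j \<in> {1..k}" for j
      using bij_betw_inv_into_left[OF index that] by (simp add: z_def)
    have "(\<Sum>F | F \<in> W \<and> \<rho> (cs F) = v. z (\<rho> F) - z v) = 0" if v: "v \<in> R" for v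
    proof -
      obtain i where i: "i \<in> {1..k}" "v = r i" using v index unfolding bij_betw_def by blast
      let ?row = "\<Sum>j\<in>{1..k}. frag_cmul (laplacian i j) (frag_of j)"
      have "?row \<in> laplacian_rows" using i(1) unfolding matrix_rows_def by blast
      then have "f (B.cls ?row) = f \<one>\<^bsub>B.\<P>\<^esub>" by (simp only: B.cls_relation)
      also have "\<dots> = 0" using hom_one[OF f B.group_presented group_integer_group] by simp
      finally have "(\<Sum>j\<in>{1..k}. laplacian i j * f (B.cls (frag_of j))) = 0"
        by (simp only: B.integer_hom_linear[OF f finite_atLeastAtMost subset_refl])
      then have "(\<Sum>j\<in>{1..k}. laplacian i j * z (r j)) = 0" using z by simp
      then show ?thesis unfolding i(2) laplacian_row[OF i(1)] .
    qed
    from harmonic_constant[OF this] have const: "z u = z v" if "u \<in> R" "v \<in> R" for u v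
      using that by blast
    obtain v where v: "v \<in> R" using W_nonempty vertices(1) by blast
    have "(\<lambda>x. z v * \<epsilon> x) \<in> hom B.\<P> integer_group"
      using \<epsilon>.hom_mult by (auto simp: hom_def distrib_left)
    moreover have "f (B.cls (frag_of j)) = z v * \<epsilon> (B.cls (frag_of j))" if "j \<in> {1..k}" for j
      using eps1[OF that] z[OF that] const[OF r_in_R[OF that] v] by simp
    ultimately have "f x = z v * \<epsilon> x"
      by (rule B.presented_hom_eq[OF group_integer_group f _ _ x(1)])
    then show ?thesis using x(2) by simp
  qed
  have "carrier (torsion_subgroup B.\<P>) = {x \<in> carrier B.\<P>. \<epsilon> x = 0}"
  proof
    show "carrier (torsion_subgroup B.\<P>) \<subseteq> {x \<in> carrier B.\<P>. \<epsilon> x = 0}"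
    proof
      fix x assume "x \<in> carrier (torsion_subgroup B.\<P>)"
      then obtain n :: nat where n: "x \<in> carrier B.\<P>" "n > 0" "x [^]\<^bsub>B.\<P>\<^esub> n = \<one>\<^bsub>B.\<P>\<^esub>"
        by (auto simp: carrier_torsion_subgroup)
      have "int n * \<epsilon> x = 0"
        using \<epsilon>.hom_nat_pow[OF n(1), of n] unfolding n(3) \<epsilon>.hom_one
        by (simp only: one_integer_group group_nat_pow_integer_group)
      then show "x \<in> {x \<in> carrier B.\<P>. \<epsilon> x = 0}" using n by simp
    qed
    show "{x \<in> carrier B.\<P>. \<epsilon> x = 0} \<subseteq> carrier (torsion_subgroup B.\<P>)"
      using torsion_controlled_matrix[of "{1..k}" laplacian] multiple
      unfolding torsion_controlled_def by blast
  qed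
  with \<epsilon>(1) eps1 show thesis by (rule that)
qed


text \<open>\<open>M\<close> is found inside \<open>A.\<P>\<close> as the common kernel of two
  weightings, with \<open>\<phi>\<close> induced by \<open>r\<close>. The kernel of one weighting is
  the image of \<open>\<phi>\<close>; the other pulls back to the degree \<open>\<epsilon>\<close>,
  so its kernel within that image is the image of the torsion.\<close>

lemma triangle_group_splitting:
  obtains M :: "('b \<Rightarrow>\<^sub>0 int) set monoid" and \<phi>
  where "group M" "\<phi> \<in> hom (torsion_subgroup B.\<P>) M"
    "\<phi> ` carrier (torsion_subgroup B.\<P>) = carrier M"
    "A.\<P> \<cong> integer_group \<times>\<times> integer_group \<times>\<times> M"
proof -
  obtain \<epsilon> where \<epsilon>: "\<epsilon> \<in> hom B.\<P> integer_group" "\<And>j. j \<in> {1..k} \<Longrightarrow> \<epsilon> (B.cls (frag_of j)) = 1"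
    "carrier (torsion_subgroup B.\<P>) = {x \<in> carrier B.\<P>. \<epsilon> x = 0}"
    by (rule degree_hom) (rule that)
  let ?V = "R \<union> C \<union> S"
  let ?q = "\<lambda>v. A.cls (frag_of v)"
  interpret A: comm_group A.\<P> by (rule A.comm_group_presented)
  have keys_r: "Poly_Mapping.keys (frag_of (r j)) \<subseteq> ?V" if "j \<in> {1..k}" for j
    using r_in_R[OF that] by (simp add: keys_frag_of)
  have hom_r: "frag_extend (\<lambda>j. frag_of (r j)) \<in> hom B.\<F> A.\<F>"
    by (rule frag_extend_hom) (rule keys_r)
  have "(\<lambda>x. A.cls (frag_extend (\<lambda>j. frag_of (r j)) x)) \<in> hom B.\<F> A.\<P>"
    using hom_compose[OF hom_r A.cls_hom] by (simp add: o_def)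
  moreover have "A.cls (frag_extend (\<lambda>j. frag_of (r j)) x) = \<one>\<^bsub>A.\<P>\<^esub>" if x: "x \<in> laplacian_rows" for x
  proof -
    obtain i where i: "i \<in> {1..k}" "x = (\<Sum>j\<in>{1..k}. frag_cmul (laplacian i j) (frag_of j))"
      using x unfolding matrix_rows_def by blast
    have "frag_extend (\<lambda>j. frag_of (r j)) x = (\<Sum>j\<in>{1..k}. frag_cmul (laplacian i j) (frag_of (r j)))"
      unfolding i(2) by (simp only: frag_extend_sum[OF finite_atLeastAtMost] frag_extend_cmul frag_extend_of o_def)
    also have "\<dots> = (\<Sum>F | F \<in> W \<and> \<rho> (cs F) = r i. relator F) - (\<Sum>F | F \<in> W \<and> \<rho> F = r i. relator F)"
      unfolding laplacian_row_frag[OF i(1)] by (rule row_as_relators)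
    finally have eq: "frag_extend (\<lambda>j. frag_of (r j)) x =
      (\<Sum>F | F \<in> W \<and> \<rho> (cs F) = r i. relator F) - (\<Sum>F | F \<in> W \<and> \<rho> F = r i. relator F)" .
    have N: "(\<Sum>F | F \<in> W \<and> \<rho> (cs F) = r i. relator F) \<in> A.\<N>" "(\<Sum>F | F \<in> W \<and> \<rho> F = r i. relator F) \<in> A.\<N>"
      by (intro sums_of_relators; blast)+
    then have keys: "Poly_Mapping.keys (\<Sum>F | F \<in> W \<and> \<rho> (cs F) = r i. relator F) \<subseteq> ?V"
      "Poly_Mapping.keys (\<Sum>F | F \<in> W \<and> \<rho> F = r i. relator F) \<subseteq> ?V"
      using subgroup.mem_carrier[OF A.subgroup_relations] by auto
    have "A.cls (\<Sum>F | F \<in> W \<and> \<rho> (cs F) = r i. relator F) = A.cls (\<Sum>F | F \<in> W \<and> \<rho> F = r i. relator F)"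
      using iffD2[OF A.cls_eq_one_iff[OF keys(1)] N(1)] iffD2[OF A.cls_eq_one_iff[OF keys(2)] N(2)]
      by (simp only:)
    then show ?thesis unfolding eq A.cls_diff[OF keys]
      using A.cls_in_carrier[OF keys(2)] by (simp only: A.r_inv)
  qed
  ultimately obtain \<phi> where \<phi>: "\<phi> \<in> hom B.\<P> A.\<P>"
    "\<And>x. Poly_Mapping.keys x \<subseteq> {1..k} \<Longrightarrow> \<phi> (B.cls x) = A.cls (frag_extend (\<lambda>j. frag_of (r j)) x)"
    by (rule B.presented_universal[OF A.group_presented]) (assumption, rule that)
  have phi_gen: "\<phi> (B.cls (frag_of j)) = ?q (r j)" if "j \<in> {1..k}" for j
    using \<phi>(2)[of "frag_of j"] that by (simp add: keys_frag_of)
  interpret \<phi>: group_hom B.\<P> A.\<P> \<phi>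
    using \<phi>(1) B.group_presented A.group_presented by (simp add: group_hom_def group_hom_axioms_def)

  \<comment> \<open>Weights constant on each of \<open>R\<close>, \<open>C\<close> and
    \<open>S\<close> annihilate every relator when the three constants have sum \<open>0\<close>, so
    two of them can be chosen freely.\<close>
  have functional: "\<exists>f. f \<in> hom A.\<P> integer_group \<and>
      (\<forall>x. Poly_Mapping.keys x \<subseteq> ?V \<longrightarrow> f (A.cls x) = (\<Sum>v\<in>?V. Poly_Mapping.lookup x v * w v))"
    if w: "\<And>v. v \<in> R \<Longrightarrow> w v = a" "\<And>v. v \<in> C \<Longrightarrow> w v = b" "\<And>v. v \<in> S \<Longrightarrow> w v = - a - b"
    for w :: "'b \<Rightarrow> int" and a b
  proof -
    have gen: "(\<Sum>v\<in>?V. Poly_Mapping.lookup (frag_of u) v * w v) = w u" if "u \<in> ?V" for u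
      using finite_V that by (simp add: if_distrib if_distribR cong: if_cong)
    have "(\<Sum>v\<in>?V. Poly_Mapping.lookup x v * w v) = 0" if x: "x \<in> relator ` W" for x
    proof -
      obtain F where F: "F \<in> W" "x = relator F" using x by blast
      then have "\<rho> F \<in> R" "\<gamma> F \<in> C" "\<sigma> F \<in> S" using vertices by auto
      then show ?thesis
        unfolding F(2) relator_def lookup_add distrib_right sum.distrib
        using gen[of "\<rho> F"] gen[of "\<gamma> F"] gen[of "\<sigma> F"] w by simp
    qed
    then obtain f where "f \<in> hom A.\<P> integer_group"
      "\<And>x. Poly_Mapping.keys x \<subseteq> ?V \<Longrightarrow> f (A.cls x) = (\<Sum>v\<in>?V. Poly_Mapping.lookup x v * w v)"
      by (rule A.presented_functional[OF finite_V]) (assumption, rule that)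
    then show ?thesis by blast
  qed
  \<comment> \<open>On \<open>R\<close>, \<open>C\<close>, \<open>S\<close> the values are
    \<open>0\<close>, \<open>1\<close>, \<open>- 1\<close> for \<open>w1\<close> and
    \<open>1\<close>, \<open>0\<close>, \<open>- 1\<close> for \<open>w2\<close>: the first kills
    the image of \<open>\<phi>\<close>, the second restricts to the degree there.\<close>
  define w1 where "w1 v = (if v \<in> C then 1 else if v \<in> S then - 1 else 0 :: int)" for v
  define w2 where "w2 v = (if v \<in> R then 1 else if v \<in> S then - 1 else 0 :: int)" for v
  define l1 where "l1 x = (\<Sum>v\<in>?V. Poly_Mapping.lookup x v * w1 v)" for x
  define l2 where "l2 x = (\<Sum>v\<in>?V. Poly_Mapping.lookup x v * w2 v)" for x
  have l_gen: "l1 (frag_of u) = w1 u" "l2 (frag_of u) = w2 u" if "u \<in> ?V" for u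
    unfolding l1_def l2_def using finite_V that by (simp_all add: if_distrib if_distribR cong: if_cong)
  have w: "w1 v = 0" "w2 v = 1" if "v \<in> R" for v
    using that disjoint by (auto simp: w1_def w2_def)
  have w': "w1 v = 1" "w2 v = 0" if "v \<in> C" for v
    using that disjoint by (auto simp: w1_def w2_def)
  have w'': "w1 v = - 1" "w2 v = - 1" if "v \<in> S" for v
    using that disjoint by (auto simp: w1_def w2_def)
  obtain \<epsilon>1 where \<epsilon>1: "\<epsilon>1 \<in> hom A.\<P> integer_group"
      "\<And>x. Poly_Mapping.keys x \<subseteq> ?V \<Longrightarrow> \<epsilon>1 (A.cls x) = l1 x"
    using functional[of w1 0 1] w w' w'' unfolding l1_def by auto
  obtain \<epsilon>2 where \<epsilon>2: "\<epsilon>2 \<in> hom A.\<P> integer_group"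
      "\<And>x. Poly_Mapping.keys x \<subseteq> ?V \<Longrightarrow> \<epsilon>2 (A.cls x) = l2 x"
    using functional[of w2 1 0] w w' w'' unfolding l2_def by auto
  have eps1_phi: "\<epsilon>1 (\<phi> x) = 0" if x: "x \<in> carrier B.\<P>" for x
  proof -
    have "(\<epsilon>1 \<circ> \<phi>) x = (\<lambda>_. 0) x"
    proof (rule B.presented_hom_eq[OF group_integer_group _ _ _ x])
      show "\<epsilon>1 \<circ> \<phi> \<in> hom B.\<P> integer_group" by (rule hom_compose[OF \<phi>(1) \<epsilon>1(1)])
      show "(\<lambda>_. 0) \<in> hom B.\<P> integer_group" by (simp add: hom_def)
      show "(\<epsilon>1 \<circ> \<phi>) (B.cls (frag_of j)) = 0" if "j \<in> {1..k}" for j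
        using phi_gen[OF that] \<epsilon>1(2)[OF keys_r[OF that]] l_gen[of "r j"] w r_in_R[OF that] by simp
    qed
    then show ?thesis by simp
  qed
  have eps2_phi: "\<epsilon>2 (\<phi> x) = \<epsilon> x" if x: "x \<in> carrier B.\<P>" for x
  proof -
    have "(\<epsilon>2 \<circ> \<phi>) x = \<epsilon> x"
    proof (rule B.presented_hom_eq[OF group_integer_group _ \<epsilon>(1) _ x])
      show "\<epsilon>2 \<circ> \<phi> \<in> hom B.\<P> integer_group" by (rule hom_compose[OF \<phi>(1) \<epsilon>2(1)])
      show "(\<epsilon>2 \<circ> \<phi>) (B.cls (frag_of j)) = \<epsilon> (B.cls (frag_of j))" if "j \<in> {1..k}" for j
        using phi_gen[OF that] \<epsilon>2(2)[OF keys_r[OF that]] \<epsilon>(2)[OF that] l_gen[of "r j"] w r_in_R[OF that]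
        by simp
    qed
    then show ?thesis by simp
  qed

  \<comment> \<open>The preimage of the image of \<open>\<phi>\<close> in the free group, where one
    can calculate with \<open>+\<close> and \<open>-\<close> and argue generator by
    generator.\<close>
  define L where "L = {x. Poly_Mapping.keys x \<subseteq> ?V \<and> A.cls x \<in> \<phi> ` carrier B.\<P>}"
  have im: "subgroup (\<phi> ` carrier B.\<P>) A.\<P>" by (rule \<phi>.img_is_subgroup)
  have L_add: "x + y \<in> L" if "x \<in> L" "y \<in> L" for x y
    using that keys_add[of x y] subgroup.m_closed[OF im] by (auto simp: L_def A.cls_add)
  have L_diff: "x - y \<in> L" if "x \<in> L" "y \<in> L" for x y
    using that keys_diff[of x y] subgroup.m_closed[OF im] subgroup.m_inv_closed[OF im]
    by (auto simp: L_def A.cls_diff)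
  have L_zero: "0 \<in> L"
    using subgroup.one_closed[OF im] hom_one[OF A.cls_hom _ A.group_presented] by (simp add: L_def)
  have L_R: "frag_of v \<in> L" if v: "v \<in> R" for v
  proof -
    obtain j where j: "j \<in> {1..k}" "v = r j" using v index unfolding bij_betw_def by blast
    then have "A.cls (frag_of v) = \<phi> (B.cls (frag_of j))" using phi_gen by simp
    moreover have "B.cls (frag_of j) \<in> carrier B.\<P>" using j by (intro B.cls_in_carrier) (simp add: keys_frag_of)
    ultimately show ?thesis using v by (auto simp: L_def keys_frag_of)
  qed
  have L_relator: "relator F \<in> L" if "F \<in> W" for F
    using that A.cls_relation[of "relator F"] A.rels[of "relator F"] subgroup.one_closed[OF im]
    by (auto simp: L_def)
  have L_white: "frag_of (\<gamma> F) + frag_of (\<sigma> F) \<in> L" if "F \<in> W" for F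
    using L_diff[OF L_relator[OF that] L_R[of "\<rho> F"]] that vertices(1) by (simp add: relator_def)
  obtain F0 where F0: "F0 \<in> W" using W_nonempty by blast
  define c0 where "c0 = frag_of (\<gamma> F0)"
  \<comment> \<open>Modulo \<open>L\<close> all vertices of \<open>C\<close> agree:
    \<open>cs\<close> and \<open>rc\<close> keep the vertex in \<open>C\<close>, while
    \<open>rs\<close> keeps the vertex in \<open>S\<close>, which modulo \<open>L\<close> is the
    negative of the vertex in \<open>C\<close> of any triangle containing it, white or
    black.\<close>
  have gamma_L: "frag_of (\<gamma> F) - c0 \<in> L" if F: "F \<in> W" for F
  proof (rule connected[of "\<lambda>F. frag_of (\<gamma> F) - c0 \<in> L", OF _ _ _ F0 F])
    show "frag_of (\<gamma> F0) - c0 \<in> L" using L_zero by (simp add: c0_def)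
    fix G assume G: "G \<in> W"
    show "(frag_of (\<gamma> (cs G)) - c0 \<in> L) = (frag_of (\<gamma> G) - c0 \<in> L)" using cs G by simp
    show "(frag_of (\<gamma> (rc G)) - c0 \<in> L) = (frag_of (\<gamma> G) - c0 \<in> L)" using rc G by simp
    have "rs G \<in> cs ` W" using bij(1,3) G unfolding bij_betw_def by blast
    then obtain G' where G': "G' \<in> W" "rs G = cs G'" by blast
    have "frag_of (\<gamma> (rs G)) + frag_of (\<sigma> (rs G)) \<in> L" using L_white[OF G'(1)] cs G' by simp
    then have "frag_of (\<gamma> (rs G)) + frag_of (\<sigma> G) \<in> L" using rs(2)[OF G] by simp
    from L_diff[OF this L_white[OF G]] have d: "frag_of (\<gamma> (rs G)) - frag_of (\<gamma> G) \<in> L"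
      by (simp only: add_diff_cancel_right)
    show "(frag_of (\<gamma> (rs G)) - c0 \<in> L) = (frag_of (\<gamma> G) - c0 \<in> L)"
      using L_add[OF d, of "frag_of (\<gamma> G) - c0"] L_diff[OF _ d, of "frag_of (\<gamma> (rs G)) - c0"]
      by auto
  qed
  \<comment> \<open>Modulo \<open>L\<close> every vertex is a multiple of \<open>c0\<close>, with
    factor \<open>0\<close> on \<open>R\<close>, \<open>1\<close> on \<open>C\<close> and
    \<open>- 1\<close> on \<open>S\<close>; these are the values of \<open>w1\<close>.\<close>
  have reduce: "x - frag_cmul (l1 x) c0 \<in> L" if x: "Poly_Mapping.keys x \<subseteq> ?V" for x
  proof (rule free_Abelian_group_induct[OF x, where P = "\<lambda>x. x - frag_cmul (l1 x) c0 \<in> L"])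
    show "0 - frag_cmul (l1 0) c0 \<in> L" using L_zero by (simp add: l1_def)
  next
    fix y z assume yz: "y - frag_cmul (l1 y) c0 \<in> L" "z - frag_cmul (l1 z) c0 \<in> L"
    have "l1 (y - z) = l1 y - l1 z"
      by (simp add: l1_def lookup_minus left_diff_distrib sum_subtractf)
    then have "(y - z) - frag_cmul (l1 (y - z)) c0 = (y - frag_cmul (l1 y) c0) - (z - frag_cmul (l1 z) c0)"
      by (simp only: frag_cmul_diff_distrib) (simp add: algebra_simps)
    then show "(y - z) - frag_cmul (l1 (y - z)) c0 \<in> L" using L_diff[OF yz] by (simp only:)
  next
    fix v assume "v \<in> ?V"
    then consider "v \<in> R" | "v \<in> C" | "v \<in> S" by blast
    then show "frag_of v - frag_cmul (l1 (frag_of v)) c0 \<in> L"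
    proof cases
      case 1
      then show ?thesis using L_R l_gen[of v] w by simp
    next
      case 2
      then obtain F where "F \<in> W" "v = \<gamma> F" using vertices by blast
      then show ?thesis using gamma_L l_gen[of v] w' 2 by simp
    next
      case 3
      then obtain F where F: "F \<in> W" "v = \<sigma> F" using vertices by blast
      have "(frag_of (\<gamma> F) + frag_of (\<sigma> F)) - (frag_of (\<gamma> F) - c0) \<in> L"
        by (rule L_diff[OF L_white[OF F(1)] gamma_L[OF F(1)]])
      then show ?thesis using F l_gen[of v] w'' 3 by simp
    qed
  qed
  have ker1: "{x \<in> carrier A.\<P>. \<epsilon>1 x = 0} = \<phi> ` carrier B.\<P>"
  proof
    show "\<phi> ` carrier B.\<P> \<subseteq> {x \<in> carrier A.\<P>. \<epsilon>1 x = 0}" using eps1_phi by auto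
    show "{x \<in> carrier A.\<P>. \<epsilon>1 x = 0} \<subseteq> \<phi> ` carrier B.\<P>"
    proof
      fix y assume y: "y \<in> {x \<in> carrier A.\<P>. \<epsilon>1 x = 0}"
      then obtain x where x: "Poly_Mapping.keys x \<subseteq> ?V" "y = A.cls x" by (auto simp: A.carrier_presented)
      then have "l1 x = 0" using y \<epsilon>1(2) by simp
      then show "y \<in> \<phi> ` carrier B.\<P>" using reduce[OF x(1)] x(2) by (simp add: L_def)
    qed
  qed
  let ?K = "{x \<in> carrier A.\<P>. \<epsilon>1 x = 0}"
  let ?AK = "A.\<P>\<lparr>carrier := ?K\<rparr>"
  let ?M = "A.\<P>\<lparr>carrier := {x \<in> ?K. \<epsilon>2 x = 0}\<rparr>"
  have K: "subgroup ?K A.\<P>" using im unfolding ker1 .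
  have comm_K: "comm_group ?AK"
    using A.subgroup_imp_group[OF K] by (rule group.group_comm_groupI) (auto simp: A.m_comm)
  have keys_c0: "Poly_Mapping.keys c0 \<subseteq> ?V" using F0 vertices by (auto simp: c0_def keys_frag_of)
  \<comment> \<open>\<open>c0\<close> supplies the preimage of \<open>1\<close> that splits off
    \<open>\<epsilon>1\<close>; the vertex \<open>\<rho> F0\<close>, with weights \<open>0\<close>
    and \<open>1\<close>, will do so for \<open>\<epsilon>2\<close> on the kernel of
    \<open>\<epsilon>1\<close>.\<close>
  have "\<epsilon>1 (A.cls c0) = 1"
    using \<epsilon>1(2)[OF keys_c0] l_gen[of "\<gamma> F0"] w' F0 vertices by (simp add: c0_def)
  then have iso1: "A.\<P> \<cong> integer_group \<times>\<times> ?AK"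
    by (rule integer_summand_iso[OF A.comm_group_presented \<epsilon>1(1) A.cls_in_carrier[OF keys_c0]])
  have hom2: "\<epsilon>2 \<in> hom ?AK integer_group" using \<epsilon>2(1) by (auto simp: hom_def)
  have rho0: "\<rho> F0 \<in> R" using F0 vertices by blast
  then have keys_r0: "Poly_Mapping.keys (frag_of (\<rho> F0)) \<subseteq> ?V" by (simp add: keys_frag_of)
  have "?q (\<rho> F0) \<in> carrier ?AK" "\<epsilon>2 (?q (\<rho> F0)) = 1"
    using \<epsilon>1(2)[OF keys_r0] \<epsilon>2(2)[OF keys_r0] l_gen[of "\<rho> F0"] w rho0 A.cls_in_carrier[OF keys_r0]
    by simp_all
  from integer_summand_iso[OF comm_K hom2 this] have iso2: "?AK \<cong> integer_group \<times>\<times> ?M" by simp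
  have "integer_group \<times>\<times> ?AK \<cong> integer_group \<times>\<times> integer_group \<times>\<times> ?M"
    using group.DirProd_iso_trans[OF group_integer_group iso_refl iso2] .
  then have iso: "A.\<P> \<cong> integer_group \<times>\<times> integer_group \<times>\<times> ?M" by (rule iso_trans[OF iso1])
  interpret \<epsilon>2: group_hom ?AK integer_group \<epsilon>2
    using hom2 comm_K by (simp add: group_hom_def group_hom_axioms_def comm_group.axioms(2))
  have "group (?AK\<lparr>carrier := {x \<in> ?K. \<epsilon>2 x = 0}\<rparr>)"
    using group.subgroup_imp_group[OF comm_group.axioms(2)[OF comm_K] \<epsilon>2.subgroup_kernel]
    by (simp add: kernel_def)
  then have "group ?M" by simp
  \<comment> \<open>Since \<open>\<epsilon>2\<close> after \<open>\<phi>\<close> is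
    \<open>\<epsilon>\<close>, an element \<open>\<phi> x\<close> lies in \<open>?M\<close> exactly
    when \<open>\<epsilon> x = 0\<close>, that is, when \<open>x\<close> is torsion.\<close>
  moreover have img: "\<phi> ` carrier (torsion_subgroup B.\<P>) = carrier ?M"
    unfolding \<epsilon>(3) ker1 using eps2_phi by auto
  moreover have "\<phi> \<in> hom (torsion_subgroup B.\<P>) ?M"
  proof (rule homI)
    show "\<phi> x \<in> carrier ?M" if "x \<in> carrier (torsion_subgroup B.\<P>)" for x using img that by blast
    show "\<phi> (x \<otimes>\<^bsub>torsion_subgroup B.\<P>\<^esub> y) = \<phi> x \<otimes>\<^bsub>?M\<^esub> \<phi> y"
      if "x \<in> carrier (torsion_subgroup B.\<P>)" "y \<in> carrier (torsion_subgroup B.\<P>)" for x y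
      using \<phi>.hom_mult[of x y] that by (simp add: torsion_subgroup_def)
  qed
  ultimately show thesis using iso by (intro that[of ?M \<phi>])
qed

end

section \<open>Three-coloured triangulations\<close>

locale tricoloured_triangulation = coloured_triangulation +
  fixes R C S :: "'a set"
  assumes vertex_colouring: "proper_vertex_3_colouring V E R C S"
begin

abbreviation "fe \<equiv> face_edges X E"
abbreviation "fv \<equiv> face_vertices X V"

lemma colour_classes: "V = R \<union> C \<union> S" "R \<inter> C = {}" "R \<inter> S = {}" "C \<inter> S = {}"
  using vertex_colouring unfolding proper_vertex_3_colouring_def by auto

lemma proper: "e \<in> E \<Longrightarrow> e \<inter> V = {u, v} \<Longrightarrow> Z \<in> {R, C, S} \<Longrightarrow> \<not> (u \<in> Z \<and> v \<in> Z)"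
  using vertex_colouring unfolding proper_vertex_3_colouring_def by blast

text \<open>The sides are recorded by their ends only, and the condition is symmetric in the three
  vertices, so the boundary of a face can be sorted by colour.\<close>

definition corners :: "'a set \<Rightarrow> 'a \<Rightarrow> 'a \<Rightarrow> 'a \<Rightarrow> bool" where
  "corners F x y z \<longleftrightarrow> fv F = {x, y, z} \<and> (\<lambda>e. e \<inter> V) ` fe F = {{x, y}, {y, z}, {x, z}}"

lemma corners_permute: "corners F x y z \<Longrightarrow> corners F y x z" "corners F x y z \<Longrightarrow> corners F x z y"
  by (auto simp: corners_def insert_commute)

lemma face_corners:
  assumes F: "F \<in> W \<union> B"
  obtains x y z where "x \<in> R" "y \<in> C" "z \<in> S" "corners F x y z"
proof -
  obtain u v w e1 e2 e3 where fv: "fv F = {u, v, w}" and fe: "fe F = {e1, e2, e3}"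
      and ne: "u \<noteq> v" "v \<noteq> w" "u \<noteq> w" and ends: "e1 \<inter> V = {u, v}" "e2 \<inter> V = {v, w}" "e3 \<inter> V = {u, w}"
    by (rule face_triangle[of F]) (use F in \<open>simp add: faces_eq\<close>, rule that)
  have c: "corners F u v w" unfolding corners_def fv fe using ends by simp
  have E: "e1 \<in> E" "e2 \<in> E" "e3 \<in> E" using fe by (auto simp: face_edges_def)
  have V: "u \<in> R \<union> C \<union> S" "v \<in> R \<union> C \<union> S" "w \<in> R \<union> C \<union> S"
    using ends colour_classes(1) by blast+
  have d: "\<not> (u \<in> Z \<and> v \<in> Z)" "\<not> (v \<in> Z \<and> w \<in> Z)" "\<not> (u \<in> Z \<and> w \<in> Z)" if "Z \<in> {R, C, S}" for Z
    using proper[OF E(1) ends(1) that] proper[OF E(2) ends(2) that] proper[OF E(3) ends(3) that] by auto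
  have "u \<in> R \<and> v \<in> C \<and> w \<in> S \<or> u \<in> R \<and> v \<in> S \<and> w \<in> C \<or> u \<in> C \<and> v \<in> R \<and> w \<in> S \<or>
    u \<in> C \<and> v \<in> S \<and> w \<in> R \<or> u \<in> S \<and> v \<in> R \<and> w \<in> C \<or> u \<in> S \<and> v \<in> C \<and> w \<in> R"
    using V d[of R] d[of C] d[of S] by auto
  then show thesis
    using that c corners_permute by metis
qed

text \<open>The graph may have parallel edges, but the three edges of one face have different pairs
  of ends; this makes \<open>side\<close> well defined.\<close>

lemma ends_inj:
  assumes "F \<in> W \<union> B"
  shows "inj_on (\<lambda>e. e \<inter> V) (fe F)"
proof -
  obtain u v w e1 e2 e3 where "fe F = {e1, e2, e3}" "u \<noteq> v" "v \<noteq> w" "u \<noteq> w"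
      "e1 \<inter> V = {u, v}" "e2 \<inter> V = {v, w}" "e3 \<inter> V = {u, w}"
    by (rule face_triangle[of F]) (use assms in \<open>simp add: faces_eq\<close>, rule that)
  then show ?thesis by (auto simp: inj_on_def doubleton_eq_iff)
qed

section \<open>Corner maps and the pairing of triangles across an edge\<close>

definition \<rho> :: "'a set \<Rightarrow> 'a" where "\<rho> F = the_elem (R \<inter> fv F)"
definition \<gamma> :: "'a set \<Rightarrow> 'a" where "\<gamma> F = the_elem (C \<inter> fv F)"
definition \<sigma> :: "'a set \<Rightarrow> 'a" where "\<sigma> F = the_elem (S \<inter> fv F)"

lemma face_corner:
  assumes F: "F \<in> W \<union> B"
  shows "R \<inter> fv F = {\<rho> F}" "C \<inter> fv F = {\<gamma> F}" "S \<inter> fv F = {\<sigma> F}" "corners F (\<rho> F) (\<gamma> F) (\<sigma> F)"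
proof -
  obtain x y z where xyz: "x \<in> R" "y \<in> C" "z \<in> S" "corners F x y z"
    by (rule face_corners[OF F])
  then have "R \<inter> fv F = {x}" "C \<inter> fv F = {y}" "S \<inter> fv F = {z}"
    using colour_classes(2-4) by (auto simp: corners_def)
  then show "R \<inter> fv F = {\<rho> F}" "C \<inter> fv F = {\<gamma> F}" "S \<inter> fv F = {\<sigma> F}" "corners F (\<rho> F) (\<gamma> F) (\<sigma> F)"
    using xyz(4) by (simp_all add: \<rho>_def \<gamma>_def \<sigma>_def)
qed

lemma corner_eqI:
  assumes "F \<in> W \<union> B" "v \<in> fv F"
  shows "v \<in> R \<Longrightarrow> \<rho> F = v" "v \<in> C \<Longrightarrow> \<gamma> F = v" "v \<in> S \<Longrightarrow> \<sigma> F = v"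
proof -
  show "v \<in> R \<Longrightarrow> \<rho> F = v" using face_corner(1)[OF assms(1)] assms(2) by (metis IntI singletonD)
  show "v \<in> C \<Longrightarrow> \<gamma> F = v" using face_corner(2)[OF assms(1)] assms(2) by (metis IntI singletonD)
  show "v \<in> S \<Longrightarrow> \<sigma> F = v" using face_corner(3)[OF assms(1)] assms(2) by (metis IntI singletonD)
qed

lemma corner_mem:
  assumes "F \<in> W \<union> B"
  shows "\<rho> F \<in> R" "\<gamma> F \<in> C" "\<sigma> F \<in> S" "\<rho> F \<in> fv F" "\<gamma> F \<in> fv F" "\<sigma> F \<in> fv F"
  using face_corner(1-3)[OF assms] by blast+

lemma ends_in_vertices: "e \<in> fe F \<Longrightarrow> e \<inter> V \<subseteq> fv F"
  by (auto simp: face_edges_def face_vertices_def)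

text \<open>What the three corner maps have in common: a vertex that is the chosen corner of one
  face is the chosen corner of every face containing it. The pairings across the three kinds of
  edges can thus be constructed once, for two arbitrary selectors.\<close>

definition mark_selector :: "('a set \<Rightarrow> 'a) \<Rightarrow> bool" where
  "mark_selector p \<longleftrightarrow> (\<forall>F\<in>W \<union> B. \<forall>F'\<in>W \<union> B. p F \<in> fv F' \<longrightarrow> p F' = p F)"

lemma mark_selectorD:
  "mark_selector p \<Longrightarrow> F \<in> W \<union> B \<Longrightarrow> F' \<in> W \<union> B \<Longrightarrow> p F \<in> fv F' \<Longrightarrow> p F' = p F"
  unfolding mark_selector_def by blast

lemma mark_selectors: "mark_selector \<rho>" "mark_selector \<gamma>" "mark_selector \<sigma>"
  unfolding mark_selector_def
  by (intro ballI impI; rule corner_eqI; (rule corner_mem)?; assumption)+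

definition side :: "('a set \<Rightarrow> 'a) \<Rightarrow> ('a set \<Rightarrow> 'a) \<Rightarrow> 'a set \<Rightarrow> 'a set" where
  "side p q F = (THE e. e \<in> fe F \<and> e \<inter> V = {p F, q F})"

definition across :: "('a set \<Rightarrow> 'a) \<Rightarrow> ('a set \<Rightarrow> 'a) \<Rightarrow> 'a set \<Rightarrow> 'a set" where
  "across p q F = (THE F'. F' \<in> B \<and> side p q F \<in> fe F')"

lemma white_face: "e \<in> E \<Longrightarrow> \<exists>!F. F \<in> W \<and> e \<in> fe F"
  and black_face: "e \<in> E \<Longrightarrow> \<exists>!F. F \<in> B \<and> e \<in> fe F"
  using edge_colours[of e W] edge_colours[of e B] by simp_all

context
  fixes p q :: "'a set \<Rightarrow> 'a"
  assumes sel: "mark_selector p" "mark_selector q"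
    and edge: "\<And>F. F \<in> W \<union> B \<Longrightarrow> {p F, q F} \<in> (\<lambda>e. e \<inter> V) ` fe F"
begin

lemma side_eqI:
  assumes "F \<in> W \<union> B" "e \<in> fe F" "e \<inter> V = {p F, q F}"
  shows "side p q F = e"
  unfolding side_def
proof (rule the_equality)
  show "e \<in> fe F \<and> e \<inter> V = {p F, q F}" using assms by blast
  show "e' = e" if "e' \<in> fe F \<and> e' \<inter> V = {p F, q F}" for e'
    using inj_onD[OF ends_inj[OF assms(1)], of e' e] that assms by simp
qed

lemma side:
  assumes "F \<in> W \<union> B"
  shows "side p q F \<in> fe F" "side p q F \<inter> V = {p F, q F}" "side p q F \<in> E"
proof -
  obtain e where e: "e \<in> fe F" "e \<inter> V = {p F, q F}" using edge[OF assms] by auto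
  then have "side p q F = e" by (rule side_eqI[OF assms])
  then show "side p q F \<in> fe F" "side p q F \<inter> V = {p F, q F}" "side p q F \<in> E"
    using e by (auto simp: face_edges_def)
qed

lemma same_side:
  assumes F: "F \<in> W \<union> B" "F' \<in> W \<union> B" and e: "side p q F \<in> fe F'"
  shows "p F' = p F" "q F' = q F" "side p q F' = side p q F"
proof -
  have "{p F, q F} \<subseteq> fv F'" using ends_in_vertices[OF e] side(2)[OF F(1)] by simp
  then show pq: "p F' = p F" "q F' = q F"
    using mark_selectorD[OF sel(1) F] mark_selectorD[OF sel(2) F] by simp_all
  show "side p q F' = side p q F"
    by (rule side_eqI[OF F(2) e]) (simp add: pq side(2)[OF F(1)])
qed

lemma across:
  assumes "F \<in> W"
  shows "across p q F \<in> B" "side p q F \<in> fe (across p q F)"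
proof -
  have "side p q F \<in> E" using assms by (intro side(3)) simp
  from theI'[OF black_face[OF this]] show "across p q F \<in> B" "side p q F \<in> fe (across p q F)"
    by (simp_all add: across_def)
qed

lemma across_eqI:
  assumes "F \<in> W" "F' \<in> B" "side p q F \<in> fe F'"
  shows "across p q F = F'"
proof -
  have "side p q F \<in> E" using assms(1) by (intro side(3)) simp
  then show ?thesis
    unfolding across_def using assms(2,3) by (intro the1_equality[OF black_face]) simp_all
qed

lemma across_corners:
  assumes "F \<in> W"
  shows "p (across p q F) = p F" "q (across p q F) = q F" "side p q (across p q F) = side p q F"
  by (rule same_side; use across[OF assms] assms in simp)+

lemma same_white_side:
  assumes "F \<in> W" "G \<in> W" "side p q F = side p q G"
  shows "F = G"
proof -
  have "side p q F \<in> fe F" "side p q F \<in> fe G"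
    using side(1)[of F] side(1)[of G] assms by simp_all
  then show ?thesis using same_colour_no_common_edge[of W F G] assms(1,2) by blast
qed

text \<open>A triangle and its partner have the same side. Hence the side recovers the white
  triangle, and the white triangle on the side of a given black one is its preimage.\<close>

lemma across_bij: "bij_betw (across p q) W B"
  unfolding bij_betw_def
proof
  show "inj_on (across p q) W"
  proof (rule inj_onI)
    fix F G assume F: "F \<in> W" "G \<in> W" "across p q F = across p q G"
    then have "side p q F = side p q G" using across_corners(3)[OF F(1)] across_corners(3)[OF F(2)] by simp
    then show "F = G" by (rule same_white_side[OF F(1,2)])
  qed
  show "across p q ` W = B"
  proof
    show "across p q ` W \<subseteq> B" using across by blast
    show "B \<subseteq> across p q ` W"
    proof
      fix H assume H: "H \<in> B"
      then have WB: "H \<in> W \<union> B" by simp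
      obtain F where F: "F \<in> W" "side p q H \<in> fe F"
        using ex1_implies_ex[OF white_face[OF side(3)[OF WB]]] by (elim exE conjE)
      then have "side p q F = side p q H" using same_side(3)[OF WB _ F(2)] by simp
      then have "across p q F = H" using across_eqI[OF F(1) H] side(1)[OF WB] by simp
      then show "H \<in> across p q ` W" using F(1) by blast
    qed
  qed
qed

end

abbreviation "cs \<equiv> across \<gamma> \<sigma>"
abbreviation "rc \<equiv> across \<rho> \<gamma>"
abbreviation "rs \<equiv> across \<rho> \<sigma>"

lemma corner_edges:
  assumes "F \<in> W \<union> B"
  shows "{\<gamma> F, \<sigma> F} \<in> (\<lambda>e. e \<inter> V) ` fe F" "{\<rho> F, \<gamma> F} \<in> (\<lambda>e. e \<inter> V) ` fe F"
    "{\<rho> F, \<sigma> F} \<in> (\<lambda>e. e \<inter> V) ` fe F"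
  using face_corner(4)[OF assms] by (simp_all add: corners_def)

lemmas cs_context = mark_selectors(2,3) corner_edges(1)
lemmas rc_context = mark_selectors(1,2) corner_edges(2)
lemmas rs_context = mark_selectors(1,3) corner_edges(3)

sublocale paired_triangles W B R C S \<rho> \<gamma> \<sigma> cs rc rs
proof
  show "finite W" using finite_faces by (simp add: faces_eq)
  obtain F where F: "F \<in> W \<union> B" using faces_nonempty faces_eq by blast
  then obtain e where "e \<in> E" using face_edges_nonempty[of F] by (auto simp: faces_eq face_edges_def)
  then show "W \<noteq> {}" using white_face by blast
  show "bij_betw cs W B" by (rule across_bij[OF cs_context])
  show "bij_betw rc W B" by (rule across_bij[OF rc_context])
  show "bij_betw rs W B" by (rule across_bij[OF rs_context])
  show "\<gamma> (cs F) = \<gamma> F" "\<sigma> (cs F) = \<sigma> F" if "F \<in> W" for F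
    using across_corners[OF cs_context that] by simp_all
  show rc: "\<rho> (rc F) = \<rho> F" "\<gamma> (rc F) = \<gamma> F" if "F \<in> W" for F
    using across_corners[OF rc_context that] by simp_all
  show rs: "\<rho> (rs F) = \<rho> F" "\<sigma> (rs F) = \<sigma> F" if "F \<in> W" for F
    using across_corners[OF rs_context that] by simp_all
  \<comment> \<open>A pairing that keeps a corner map makes its images on \<open>B\<close> and
    \<open>W\<close> equal. Every vertex is a corner of some face, hence of a white one.\<close>
  have black: "h ` B = h ` W" if "bij_betw g W B" "\<And>F. F \<in> W \<Longrightarrow> h (g F) = h F" for g :: "'a set \<Rightarrow> 'a set" and h :: "'a set \<Rightarrow> 'a"
  proof -
    have "B = g ` W" using that(1) by (simp add: bij_betw_def)
    then have "h ` B = (\<lambda>F. h (g F)) ` W" by (simp add: image_image)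
    also have "\<dots> = h ` W" using that(2) by (rule image_cong[OF refl])
    finally show ?thesis .
  qed
  have bR: "\<rho> ` B = \<rho> ` W" and bC: "\<gamma> ` B = \<gamma> ` W" and bS: "\<sigma> ` B = \<sigma> ` W"
    using black[OF across_bij[OF rc_context], of \<rho>] black[OF across_bij[OF rc_context], of \<gamma>]
      black[OF across_bij[OF rs_context], of \<sigma>] rc rs by simp_all
  have cover: "\<exists>F\<in>W \<union> B. v \<in> fv F" if "v \<in> V" for v
    using vertex_in_face[OF that] by (simp add: faces_eq)
  show "R = \<rho> ` W"
  proof
    show "R \<subseteq> \<rho> ` W"
    proof
      fix v assume v: "v \<in> R"
      then obtain F where "F \<in> W \<union> B" "v \<in> fv F" using cover[of v] colour_classes(1) by blast
      then have "v \<in> \<rho> ` (W \<union> B)" using corner_eqI(1) v by blast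
      then show "v \<in> \<rho> ` W" using bR by (simp add: image_Un)
    qed
    show "\<rho> ` W \<subseteq> R" using corner_mem(1) by blast
  qed
  show "C = \<gamma> ` W"
  proof
    show "C \<subseteq> \<gamma> ` W"
    proof
      fix v assume v: "v \<in> C"
      then obtain F where "F \<in> W \<union> B" "v \<in> fv F" using cover[of v] colour_classes(1) by blast
      then have "v \<in> \<gamma> ` (W \<union> B)" using corner_eqI(2) v by blast
      then show "v \<in> \<gamma> ` W" using bC by (simp add: image_Un)
    qed
    show "\<gamma> ` W \<subseteq> C" using corner_mem(2) by blast
  qed
  show "S = \<sigma> ` W"
  proof
    show "S \<subseteq> \<sigma> ` W"
    proof
      fix v assume v: "v \<in> S"
      then obtain F where "F \<in> W \<union> B" "v \<in> fv F" using cover[of v] colour_classes(1) by blast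
      then have "v \<in> \<sigma> ` (W \<union> B)" using corner_eqI(3) v by blast
      then show "v \<in> \<sigma> ` W" using bS by (simp add: image_Un)
    qed
    show "\<sigma> ` W \<subseteq> S" using corner_mem(3) by blast
  qed
  show "R \<inter> C = {}" "R \<inter> S = {}" "C \<inter> S = {}" by (rule colour_classes)+
next
  fix P F F'
  assume P: "\<And>G. G \<in> W \<Longrightarrow> P (cs G) = P G" "\<And>G. G \<in> W \<Longrightarrow> P (rc G) = P G"
      "\<And>G. G \<in> W \<Longrightarrow> P (rs G) = P G" and F: "F \<in> W" "F' \<in> W" "P F"
  \<comment> \<open>\<open>P\<close> is used as a truth-valued function on faces. An edge of
    \<open>G\<close> has the ends of one of the three sides of \<open>G\<close>, so it is that side,
    and the black face on it is the corresponding partner of \<open>G\<close>.\<close>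
  have "P F = P F'"
  proof (rule dual_graph_connected[of P])
    fix e G H assume G: "e \<in> E" "G \<in> W" "H \<in> B" "e \<in> fe G" "e \<in> fe H"
    have "e \<inter> V \<in> (\<lambda>e. e \<inter> V) ` fe G" using G(4) by blast
    then have "e \<inter> V \<in> {{\<rho> G, \<gamma> G}, {\<gamma> G, \<sigma> G}, {\<rho> G, \<sigma> G}}"
      using face_corner(4)[of G] G(2) by (simp add: corners_def)
    then consider "e \<inter> V = {\<rho> G, \<gamma> G}" | "e \<inter> V = {\<gamma> G, \<sigma> G}" | "e \<inter> V = {\<rho> G, \<sigma> G}" by auto
    then show "P G = P H"
    proof cases
      case 1
      then have "side \<rho> \<gamma> G = e" using side_eqI[OF rc_context] G by blast
      then show ?thesis using across_eqI[OF rc_context G(2,3)] P(2)[OF G(2)] G(5) by simp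
    next
      case 2
      then have "side \<gamma> \<sigma> G = e" using side_eqI[OF cs_context] G by blast
      then show ?thesis using across_eqI[OF cs_context G(2,3)] P(1)[OF G(2)] G(5) by simp
    next
      case 3
      then have "side \<rho> \<sigma> G = e" using side_eqI[OF rs_context] G by blast
      then show ?thesis using across_eqI[OF rs_context G(2,3)] P(3)[OF G(2)] G(5) by simp
    qed
  next
    show "F \<in> W \<union> B" "F' \<in> W \<union> B" using F(1,2) by blast+
  qed
  then show "P F'" using F(3) by simp
qed

lemma triangle_group_eq:
  "triangle_group X V R C S W = presented_abelian_group (R \<union> C \<union> S) (relator ` W)"
proof -
  have "{frag_of r + frag_of c + frag_of s |r c s F.
          F \<in> W \<and> r \<in> R \<and> c \<in> C \<and> s \<in> S \<and> fv F = {r, c, s}} = relator ` W"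
  proof
    show "{frag_of r + frag_of c + frag_of s |r c s F.
          F \<in> W \<and> r \<in> R \<and> c \<in> C \<and> s \<in> S \<and> fv F = {r, c, s}} \<subseteq> relator ` W"
    proof clarify
      fix r c s F assume F: "F \<in> W" "r \<in> R" "c \<in> C" "s \<in> S" "fv F = {r, c, s}"
      then have "\<rho> F = r" "\<gamma> F = c" "\<sigma> F = s" using corner_eqI[of F] by auto
      then have "frag_of r + frag_of c + frag_of s = relator F" by (simp add: relator_def)
      then show "frag_of r + frag_of c + frag_of s \<in> relator ` W" using F(1) by blast
    qed
    show "relator ` W \<subseteq> {frag_of r + frag_of c + frag_of s |r c s F.
          F \<in> W \<and> r \<in> R \<and> c \<in> C \<and> s \<in> S \<and> fv F = {r, c, s}}"
    proof clarify
      fix F assume F: "F \<in> W"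
      have "fv F = {\<rho> F, \<gamma> F, \<sigma> F}" using face_corner(4)[of F] F by (simp add: corners_def)
      then show "\<exists>r c s F'. relator F = frag_of r + frag_of c + frag_of s \<and>
          F' \<in> W \<and> r \<in> R \<and> c \<in> C \<and> s \<in> S \<and> fv F' = {r, c, s}"
        using F corner_mem[of F] by (intro exI[of _ "\<rho> F"] exI[of _ "\<gamma> F"] exI[of _ "\<sigma> F"] exI[of _ F])
          (simp add: relator_def)
    qed
  qed
  then show ?thesis unfolding triangle_group_def colour_classes(1) by simp
qed

text \<open>Each edge with ends in \<open>C\<close> and \<open>S\<close> lies in exactly one white
  triangle, and each white triangle has exactly one such edge; so
  \<open>side \<gamma> \<sigma>\<close> lets edges be counted as white triangles.\<close>

lemma card_CS_edges:
  assumes "u \<in> R" "v \<in> R"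
  shows "card (CS_edges X V E C S W B u v) = card {F \<in> W. \<rho> F = u \<and> \<rho> (cs F) = v}"
proof -
  have "bij_betw (side \<gamma> \<sigma>) {F \<in> W. \<rho> F = u \<and> \<rho> (cs F) = v} (CS_edges X V E C S W B u v)"
    unfolding bij_betw_def
  proof
    show "inj_on (side \<gamma> \<sigma>) {F \<in> W. \<rho> F = u \<and> \<rho> (cs F) = v}"
    proof (rule inj_onI)
      fix F G assume F: "F \<in> {F \<in> W. \<rho> F = u \<and> \<rho> (cs F) = v}" "G \<in> {F \<in> W. \<rho> F = u \<and> \<rho> (cs F) = v}"
        "side \<gamma> \<sigma> F = side \<gamma> \<sigma> G"
      then show "F = G" using same_white_side[OF cs_context, of F G] by simp
    qed
    show "side \<gamma> \<sigma> ` {F \<in> W. \<rho> F = u \<and> \<rho> (cs F) = v} = CS_edges X V E C S W B u v"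
    proof
      show "side \<gamma> \<sigma> ` {F \<in> W. \<rho> F = u \<and> \<rho> (cs F) = v} \<subseteq> CS_edges X V E C S W B u v"
      proof clarify
        fix F assume F: "F \<in> W" "u = \<rho> F" "v = \<rho> (cs F)"
        have "cs F \<in> B" "side \<gamma> \<sigma> F \<in> fe (cs F)" using across[OF cs_context F(1)] by auto
        moreover have "side \<gamma> \<sigma> F \<in> fe F" "side \<gamma> \<sigma> F \<inter> V = {\<gamma> F, \<sigma> F}" "side \<gamma> \<sigma> F \<in> E"
          using side[OF cs_context, of F] F(1) by auto
        ultimately show "side \<gamma> \<sigma> F \<in> CS_edges X V E C S W B (\<rho> F) (\<rho> (cs F))"
          using corner_mem[of F] corner_mem[of "cs F"] F(1) unfolding CS_edges_def by blast
      qed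
      show "CS_edges X V E C S W B u v \<subseteq> side \<gamma> \<sigma> ` {F \<in> W. \<rho> F = u \<and> \<rho> (cs F) = v}"
      proof
        fix e assume "e \<in> CS_edges X V E C S W B u v"
        then obtain c s F G where e: "e \<in> E" "c \<in> C" "s \<in> S" "e \<inter> V = {c, s}"
          and F: "F \<in> W" "e \<in> fe F" "u \<in> fv F" and G: "G \<in> B" "e \<in> fe G" "v \<in> fv G"
          unfolding CS_edges_def by blast
        have "{c, s} \<subseteq> fv F" using ends_in_vertices[OF F(2)] e(4) by simp
        then have "\<gamma> F = c" "\<sigma> F = s" using corner_eqI[of F] e F(1) by auto
        then have side_F: "side \<gamma> \<sigma> F = e" using side_eqI[OF cs_context _ F(2)] e(4) F(1) by simp
        then have "cs F = G" using across_eqI[OF cs_context F(1) G(1)] G(2) by simp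
        moreover have "\<rho> F = u" "\<rho> G = v" using corner_eqI(1)[of F u] corner_eqI(1)[of G v] F G assms by auto
        ultimately show "e \<in> side \<gamma> \<sigma> ` {F \<in> W. \<rho> F = u \<and> \<rho> (cs F) = v}"
          using side_F F(1) by blast
      qed
    qed
  qed
  then show ?thesis by (simp add: bij_betw_same_card)
qed

text \<open>The hypotheses are symmetric in the colours, so all results about white triangles can be
  reused for black ones.\<close>

lemma swap_colours: "tricoloured_triangulation X V E B W R C S"
proof
  show "closed_surface X" by (rule surface)
  show "triangulation X V E" by (rule triangulation)
  show "proper_face_2_colouring X V E B W"
    using face_colouring unfolding proper_face_2_colouring_def by (auto simp: Un_commute Int_commute)
  show "proper_vertex_3_colouring V E R C S" by (rule vertex_colouring)
qed

end

section \<open>The two matrices as the Laplacian and its transpose\<close>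

locale indexed_triangulation = tricoloured_triangulation +
  fixes k :: nat and r :: "nat \<Rightarrow> 'a"
  assumes index_R: "bij_betw r {1..k} R"
begin

sublocale indexed_triangles W B R C S \<rho> \<gamma> \<sigma> cs rc rs k r
  by unfold_locales (rule index_R)

lemma CS_matrix_eq_laplacian:
  assumes i: "i \<in> {1..k}" and j: "j \<in> {1..k}"
  shows "CS_matrix X V E C S k r W B i j = laplacian i j"
proof (cases "i = j")
  case False
  then show ?thesis
    using card_CS_edges[OF r_in_R[OF j] r_in_R[OF i]] by (simp add: CS_matrix_def laplacian_def num_def)
next
  case True
  have "(\<Sum>l\<in>{1..k} - {i}. int (card (CS_edges X V E C S W B (r l) (r i)))) = (\<Sum>l\<in>{1..k} - {i}. num i l)"
  proof (rule sum.cong)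
    show "int (card (CS_edges X V E C S W B (r l) (r i))) = num i l" if "l \<in> {1..k} - {i}" for l
      using card_CS_edges[OF r_in_R[of l] r_in_R[OF i]] that by (simp add: num_def)
  qed simp
  then show ?thesis
    using True sum.remove[of "{1..k}" i "num i"] i by (simp add: CS_matrix_def laplacian_def)
qed

text \<open>Exchanging the colours reverses each arc, which transposes the entries off the diagonal.
  The diagonal now holds a column sum in place of a row sum; the two agree because the counts are
  balanced.\<close>

lemma CS_matrix_swap:
  assumes i: "i \<in> {1..k}" and j: "j \<in> {1..k}"
  shows "CS_matrix X V E C S k r B W i j = laplacian j i"
proof -
  have swap: "CS_edges X V E C S B W u v = CS_edges X V E C S W B v u" for u v
    unfolding CS_edges_def by (simp only: conj_commute conj_left_commute)
  show ?thesis
  proof (cases "i = j")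
    case False
    then show ?thesis
      using card_CS_edges[OF r_in_R[OF i] r_in_R[OF j]] by (simp add: CS_matrix_def laplacian_def num_def swap)
  next
    case True
    have "(\<Sum>l\<in>{1..k} - {i}. int (card (CS_edges X V E C S B W (r l) (r i)))) = (\<Sum>l\<in>{1..k} - {i}. num l i)"
    proof (rule sum.cong)
      show "int (card (CS_edges X V E C S B W (r l) (r i))) = num l i" if "l \<in> {1..k} - {i}" for l
        using card_CS_edges[OF r_in_R[OF i] r_in_R[of l]] that by (simp add: num_def swap)
    qed simp
    then show ?thesis
      using True sum.remove[of "{1..k}" i "\<lambda>l. num l i"] i num_balanced[of i]
      by (simp add: CS_matrix_def laplacian_def)
  qed
qed

lemma matrix_rows_cong:
  "(\<And>i j. i \<in> I \<Longrightarrow> j \<in> I \<Longrightarrow> t i j = t' i j) \<Longrightarrow> matrix_rows I t = matrix_rows I t'"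
  unfolding matrix_rows_def by (intro image_cong sum.cong) auto

lemma matrix_group_white:
  "matrix_group k (CS_matrix X V E C S k r W B) = presented_abelian_group {1..k} laplacian_rows"
proof -
  have "matrix_rows {1..k} (CS_matrix X V E C S k r W B) = laplacian_rows"
    by (rule matrix_rows_cong) (rule CS_matrix_eq_laplacian)
  then show ?thesis by (simp only: matrix_group_eq)
qed

lemma matrix_groups_iso:
  "matrix_group k (CS_matrix X V E C S k r W B) \<cong> matrix_group k (CS_matrix X V E C S k r B W)"
proof -
  have "matrix_rows {1..k} (CS_matrix X V E C S k r B W) = matrix_rows {1..k} (\<lambda>i j. laplacian j i)"
    by (rule matrix_rows_cong) (rule CS_matrix_swap)
  then show ?thesis
    unfolding matrix_group_white
    using presented_transpose[of "{1..k}" laplacian] by (simp add: matrix_group_eq)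
qed

lemma white_splitting:
  obtains M :: "('a \<Rightarrow>\<^sub>0 int) set monoid" and \<phi>
  where "group M" "\<phi> \<in> hom (torsion_subgroup (matrix_group k (CS_matrix X V E C S k r W B))) M"
    "\<phi> ` carrier (torsion_subgroup (matrix_group k (CS_matrix X V E C S k r W B))) = carrier M"
    "triangle_group X V R C S W \<cong> integer_group \<times>\<times> integer_group \<times>\<times> M"
  by (rule triangle_group_splitting) (rule that, simp_all only: matrix_group_white triangle_group_eq)

end

text \<open>The first isomorphism theorem replaces \<open>M\<close> by the quotient of
  \<open>G\<close> by the kernel of \<open>f\<close>.\<close>

lemma quotient_splitting:
  assumes G: "group G" and M: "group M" and f: "f \<in> hom G M" "f ` carrier G = carrier M"
    and A: "A \<cong> integer_group \<times>\<times> integer_group \<times>\<times> M"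
  shows "\<exists>H. H \<lhd> G \<and> A \<cong> integer_group \<times>\<times> integer_group \<times>\<times> (G Mod H)"
proof -
  interpret f: group_hom G M f
    using G M f by (simp add: group_hom_def group_hom_axioms_def)
  let ?H = "kernel G M f"
  have H: "?H \<lhd> G" by (rule f.normal_kernel)
  have "G Mod ?H \<cong> M" by (rule f.FactGroup_iso[OF f(2)])
  then have "M \<cong> G Mod ?H" by (rule group.iso_sym[OF normal.factorgroup_is_group[OF H]])
  then have "integer_group \<times>\<times> integer_group \<times>\<times> M \<cong> integer_group \<times>\<times> integer_group \<times>\<times> (G Mod ?H)"
    by (intro group.DirProd_iso_trans[OF group_integer_group] iso_refl)
  with A have "A \<cong> integer_group \<times>\<times> integer_group \<times>\<times> (G Mod ?H)" by (rule iso_trans)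
  with H show ?thesis by blast
qed

theorem theorem9:
  fixes X :: "'a topology" and V R C S :: "'a set" and E W B :: "'a set set"
    and k :: nat and r :: "nat \<Rightarrow> 'a"
    and T T' :: "nat \<Rightarrow> nat \<Rightarrow> int"
    and \<B>\<^sub>W \<B>\<^sub>B \<C>\<^sub>W :: "(nat \<Rightarrow>\<^sub>0 int) set monoid"
    and \<A>\<^sub>W \<A>\<^sub>B :: "('a \<Rightarrow>\<^sub>0 int) set monoid"
  assumes "closed_orientable_surface X"
    and "triangulation X V E"
    and "proper_face_2_colouring X V E W B"
    and "proper_vertex_3_colouring V E R C S"
    and "bij_betw r {1..k} R"
    and "T = CS_matrix X V E C S k r W B"
    and "T' = CS_matrix X V E C S k r B W"
    and "\<B>\<^sub>W = matrix_group k T"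
    and "\<B>\<^sub>B = matrix_group k T'"
    and "\<A>\<^sub>W = triangle_group X V R C S W"
    and "\<A>\<^sub>B = triangle_group X V R C S B"
    and "\<C>\<^sub>W = torsion_subgroup \<B>\<^sub>W"
  shows "\<B>\<^sub>W \<cong> \<B>\<^sub>B \<and>
    finite (carrier \<C>\<^sub>W) \<and>
    (\<exists>H. H \<lhd> \<C>\<^sub>W \<and> \<A>\<^sub>W \<cong> integer_group \<times>\<times> integer_group \<times>\<times> (\<C>\<^sub>W Mod H)) \<and>
    (\<exists>K. K \<lhd> \<C>\<^sub>W \<and> \<A>\<^sub>B \<cong> integer_group \<times>\<times> integer_group \<times>\<times> (\<C>\<^sub>W Mod K))"
proof -
  interpret white: indexed_triangulation X V E W B R C S k r
    using assms(1-5) by unfold_locales (simp_all add: closed_orientable_surface_def)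
  interpret black: indexed_triangulation X V E B W R C S k r
    using white.swap_colours assms(5)
    by (simp add: indexed_triangulation_def indexed_triangulation_axioms_def)
  have comm: "comm_group (matrix_group k t)" for t
    unfolding matrix_group_eq by (rule presentation.comm_group_presented[OF presentation_matrix_rows])
  then have grp: "group (matrix_group k t)" for t by (rule comm_group.axioms(2))
  have iso: "\<B>\<^sub>W \<cong> \<B>\<^sub>B" unfolding assms(6-9) by (rule white.matrix_groups_iso)
  then obtain h where "h \<in> iso \<B>\<^sub>W \<B>\<^sub>B" by (auto simp: is_iso_def)
  then have h: "h \<in> iso \<C>\<^sub>W (torsion_subgroup \<B>\<^sub>B)"
    unfolding assms(8,9,12) by (rule torsion_subgroup_iso[OF grp grp])
  have C: "group \<C>\<^sub>W" unfolding assms(8,12) by (rule group_torsion_subgroup[OF comm])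
  have "finite (carrier \<C>\<^sub>W)"
    using torsion_controlled_matrix[of "{1..k}" T] unfolding assms(8,12) matrix_group_eq
    by (simp add: torsion_controlled_def)
  moreover have "\<exists>H. H \<lhd> \<C>\<^sub>W \<and> \<A>\<^sub>W \<cong> integer_group \<times>\<times> integer_group \<times>\<times> (\<C>\<^sub>W Mod H)"
  proof (rule white.white_splitting)
    fix M :: "('a \<Rightarrow>\<^sub>0 int) set monoid" and \<phi>
    assume "group M" "\<phi> \<in> hom (torsion_subgroup (matrix_group k (CS_matrix X V E C S k r W B))) M"
      "\<phi> ` carrier (torsion_subgroup (matrix_group k (CS_matrix X V E C S k r W B))) = carrier M"
      "triangle_group X V R C S W \<cong> integer_group \<times>\<times> integer_group \<times>\<times> M"
    then show ?thesis
      using quotient_splitting[OF C] unfolding assms(6,8,10,12) by blast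
  qed
  moreover have "\<exists>K. K \<lhd> \<C>\<^sub>W \<and> \<A>\<^sub>B \<cong> integer_group \<times>\<times> integer_group \<times>\<times> (\<C>\<^sub>W Mod K)"
  proof (rule black.white_splitting)
    fix M :: "('a \<Rightarrow>\<^sub>0 int) set monoid" and \<phi>
    assume M: "group M" "\<phi> \<in> hom (torsion_subgroup (matrix_group k (CS_matrix X V E C S k r B W))) M"
      "\<phi> ` carrier (torsion_subgroup (matrix_group k (CS_matrix X V E C S k r B W))) = carrier M"
      "triangle_group X V R C S B \<cong> integer_group \<times>\<times> integer_group \<times>\<times> M"
    have hom: "h \<in> hom \<C>\<^sub>W (torsion_subgroup \<B>\<^sub>B)"
      and img: "h ` carrier \<C>\<^sub>W = carrier (torsion_subgroup \<B>\<^sub>B)" using h by (simp_all add: iso_iff)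
    \<comment> \<open>Precomposing with the isomorphism \<open>h\<close> of torsion subgroups makes
      \<open>M\<close> an image of \<open>\<C>\<^sub>W\<close> itself.\<close>
    have "\<phi> \<circ> h \<in> hom \<C>\<^sub>W M"
      using hom_compose[OF hom] M(2) unfolding assms(7,9) by blast
    moreover have "(\<phi> \<circ> h) ` carrier \<C>\<^sub>W = carrier M"
      using M(3) img unfolding image_comp[symmetric] assms(7,9) by simp
    ultimately show ?thesis
      using quotient_splitting[OF C M(1) _ _ M(4)] unfolding assms(11) by blast
  qed
  ultimately show ?thesis using iso by blast
qed

end
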